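(* Let $S_{g,k}$ be an oriented surface of genus $g$ with $k\ge 1$ punctures and negative Euler characteristic, let $T$ be a bipartite ideal triangulation of $S_{g,k}$, and let $\rho:\pi_1(S_{g,k})\to\mathrm{PU}(2,1)$ be a $T$-bent representation. Let $\rho_0:\pi_1(S_{g,k})\to\mathrm{PO}(2,1)$ be a discrete and faithful representation that dominates $\rho$, i.e. $\ell(\rho(\gamma))\le\ell(\rho_0(\gamma))$ for all $\gamma\in\pi_1(S_{g,k})$, and such that $\ell(\rho(\gamma))=\ell(\rho_0(\gamma))$ for every peripheral loop $\gamma$. Then $$|\mathrm{tr}(\rho(\gamma))|\le|\mathrm{tr}(\rho_0(\gamma))|\qquad\text{for all }\gamma\in\pi_1(S_{g,k}).$$
   Context: Complex hyperbolic plane: equip $\mathbb{C}^3$ with the Hermitian form of signature $(2,1)$ $\langle \mathbf z,\mathbf w\rangle=z_1\bar w_3+z_2\bar w_2+z_3\bar w_1$, with matrix $J=\begin{pmatrix}0&0&1\\0&1&0\\1&0&0\end{pmatrix}$. $\mathbf{H}^2_{\mathbb C}$ is the set of complex lines in $\mathbb{C}^3$ spanned by negative vectors, and $\partial \mathbf{H}^2_{\mathbb C}$ the set of complex lines spanned by non-zero null vectors. $\mathrm{U}(2,1)=\{A\in \mathrm{GL}_3(\mathbb C): A^*JA=J\}$ and $\mathrm{PU}(2,1)$ is its quotient by unit scalars. $\mathrm{PO}(2,1)$ denotes the identity component of the isometry group of the real hyperbolic plane $\mathbf{H}^2_{\mathbb R}$, regarded as the subgroup of $\mathrm{PU}(2,1)$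 which is the image of the identity component of the group of real matrices preserving $J$. For $A\in \mathrm{PU}(2,1)$ with lift $\tilde A\in \mathrm{U}(2,1)$: the Bergman translation length is $\ell(A):=2\ln\sigma(\tilde A)$, where $\sigma$ is the spectral radius; and $|\mathrm{tr}(A)|:=|\mathrm{tr}(\tilde A)|$. Both are independent of the lift. Real ideal triangles: a real plane is a totally geodesic Lagrangian copy of $\mathbf{H}^2_{\mathbb R}$ in $\mathbf{H}^2_{\mathbb C}$ (intersection of $\mathbf{H}^2_{\mathbb C}$ with the projectivization of a totally real subspace). A real ideal triangle is a triple of distinct points of $\partial\mathbf{H}^2_{\mathbb C}$ lying on the boundary of a common real plane. $T$-bent representations: an ideal triangulation $T$ of $S_{g,k}$ has its vertices at the punctures; it is bipartite if its dual graph is bipartite. Let $\widetilde T$ be its lift to the universal cover and let $\mathcal F_\infty\subset\partial\widetilde S_{g,k}$ be the set of lifts of the punctures, i.e. the set of vertices of $\widetilde T$, on which $\pi_1(S_{g,k})$ acts. A representation $\rho:\pi_1(S_{g,k})\to\mathrm{PU}(2,1)$ is $T$-bent if there is a $\rho$-equivariant map $\phi:\mathcal F_\infty\to\partial\mathbf{H}^2_{\mathbb C}$ such that for every ideal triangle of $\widetilde T$ with vertices $a,b,c$, the points $\phi(a),\phi(b),\phi(c)$ form a real ideal triangle. A peripheral loop is an element of $\pi_1(S_{g,k})$ freely homotopic into a neighbourhood of a puncture. *)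

theory Defs
  imports "HOL-Analysis.Analysis" "HOL-Algebra.Coset" "HOL-Homology.Homology"
begin

section \<open>The complex hyperbolic plane and its isometries\<close>

definition herm :: "complex^3 \<Rightarrow> complex^3 \<Rightarrow> complex" where
  "herm z w = z $ 1 * cnj (w $ 3) + z $ 2 * cnj (w $ 2) + z $ 3 * cnj (w $ 1)"

definition J :: "'a::zero_neq_one^3^3" where
  "J = vector [vector [0, 0, 1], vector [0, 1, 0], vector [1, 0, 0]]"

definition conj_transpose :: "complex^'n^'m \<Rightarrow> complex^'m^'n" where
  "conj_transpose A = (\<chi> i j. cnj (A $ j $ i))"

definition U21 :: "(complex^3^3) monoid" where
  "U21 = \<lparr>carrier = {A. invertible A \<and> conj_transpose A ** J ** A = J},
          monoid.mult = (**), one = mat 1\<rparr>"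

definition unit_scalars :: "(complex^3^3) set" where
  "unit_scalars = {mat c | c. cmod c = 1}"

text \<open>An element of \<open>PU(2,1)\<close> is the set of all its lifts to \<open>U(2,1)\<close>.\<close>

definition PU21 :: "(complex^3^3) set monoid" where
  "PU21 = U21 Mod unit_scalars"

definition pu_class :: "complex^3^3 \<Rightarrow> (complex^3^3) set" where
  "pu_class A = unit_scalars #>\<^bsub>U21\<^esub> A"

definition pu_lift :: "(complex^3^3) set \<Rightarrow> complex^3^3" where
  "pu_lift X = (SOME A. A \<in> X)"

text \<open>The quotient topology.\<close>

definition PU21_topology :: "(complex^3^3) set topology" where
  "PU21_topology = topology (\<lambda>\<U>. \<U> \<subseteq> carrier PU21 \<and>
     openin (top_of_set (carrier U21)) {A \<in> carrier U21. pu_class A \<in> \<U>})"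

lemma openin_PU21_topology:
  "openin PU21_topology \<U> \<longleftrightarrow> \<U> \<subseteq> carrier PU21 \<and>
     openin (top_of_set (carrier U21)) {A \<in> carrier U21. pu_class A \<in> \<U>}"
proof -
  have "istopology (\<lambda>\<U>. \<U> \<subseteq> carrier PU21 \<and>
     openin (top_of_set (carrier U21)) {A \<in> carrier U21. pu_class A \<in> \<U>})"
    unfolding istopology_def
  proof (intro conjI allI impI)
    fix \<U> \<V> :: "(complex^3^3) set set"
    assume *: "\<U> \<subseteq> carrier PU21 \<and> openin (top_of_set (carrier U21)) {A \<in> carrier U21. pu_class A \<in> \<U>}"
       "\<V> \<subseteq> carrier PU21 \<and> openin (top_of_set (carrier U21)) {A \<in> carrier U21. pu_class A \<in> \<V>}"
    then show "\<U> \<inter> \<V> \<subseteq> carrier PU21" by blast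
    have "{A \<in> carrier U21. pu_class A \<in> \<U> \<inter> \<V>} =
        {A \<in> carrier U21. pu_class A \<in> \<U>} \<inter> {A \<in> carrier U21. pu_class A \<in> \<V>}" by blast
    with * show "openin (top_of_set (carrier U21)) {A \<in> carrier U21. pu_class A \<in> \<U> \<inter> \<V>}"
      by (simp add: openin_Int)
  next
    fix \<K> :: "(complex^3^3) set set set"
    assume *: "\<forall>\<U>\<in>\<K>. \<U> \<subseteq> carrier PU21 \<and> openin (top_of_set (carrier U21)) {A \<in> carrier U21. pu_class A \<in> \<U>}"
    then show "\<Union> \<K> \<subseteq> carrier PU21" by blast
    have "{A \<in> carrier U21. pu_class A \<in> \<Union> \<K>} =
        \<Union> ((\<lambda>\<U>. {A \<in> carrier U21. pu_class A \<in> \<U>}) ` \<K>)" by blast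
    moreover have "openin (top_of_set (carrier U21)) \<dots>"
      using * by (intro openin_Union) blast
    ultimately show "openin (top_of_set (carrier U21)) {A \<in> carrier U21. pu_class A \<in> \<Union> \<K>}"
      by simp
  qed
  then show ?thesis by (simp only: PU21_topology_def topology_inverse')
qed

definition real_J_group :: "(real^3^3) set" where
  "real_J_group = {A. transpose A ** J ** A = J}"

definition complexify :: "real^3^3 \<Rightarrow> complex^3^3" where
  "complexify A = (\<chi> i j. complex_of_real (A $ i $ j))"

definition PO21 :: "(complex^3^3) set set" where
  "PO21 = (pu_class \<circ> complexify) ` connected_component_set real_J_group (mat 1)"

definition eigenvalues :: "complex^3^3 \<Rightarrow> complex set" where
  "eigenvalues A = {\<mu>. \<exists>v. v \<noteq> 0 \<and> A *v v = \<mu> *s v}"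

definition spec_radius :: "complex^3^3 \<Rightarrow> real" where
  "spec_radius A = Max (cmod ` eigenvalues A)"

definition bergman_length :: "(complex^3^3) set \<Rightarrow> real" where
  "bergman_length X = 2 * ln (spec_radius (pu_lift X))"

definition abs_trace :: "(complex^3^3) set \<Rightarrow> real" where
  "abs_trace X = cmod (trace (pu_lift X))"

subsection \<open>Boundary and real ideal triangles\<close>

text \<open>Here \<^const>\<open>vec.span\<close> is the complex-linear span.\<close>

definition boundary_H2C :: "(complex^3) set set" where
  "boundary_H2C = {vec.span {z} | z. z \<noteq> 0 \<and> herm z z = 0}"

definition pu_act :: "(complex^3^3) set \<Rightarrow> (complex^3) set \<Rightarrow> (complex^3) set" where
  "pu_act X L = (*v) (pu_lift X) ` L"

text \<open>The real-linear subspaces whose projectivizations cut out the real (Lagrangian) planes: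
  of maximal dimension, with \<open>V \<inter> \<i>V = 0\<close>, and isotropic for the imaginary part of
  the Hermitian form.  The condition \<open>V \<inter> \<i>V = 0\<close> does not follow from the other two:
  without it, the span of a null vector \<open>v\<close>, of \<open>\<i>v\<close> and of a positive vector orthogonal
  to \<open>v\<close> would be allowed.\<close>

definition totally_real :: "(complex^3) set \<Rightarrow> bool" where
  "totally_real V \<longleftrightarrow> subspace V \<and> dim V = 3 \<and> V \<inter> (*s) \<i> ` V = {0} \<and>
     (\<forall>v\<in>V. \<forall>w\<in>V. Im (herm v w) = 0)"

definition boundary_real_plane :: "(complex^3) set \<Rightarrow> (complex^3) set set" where
  "boundary_real_plane V = {vec.span {z} | z. z \<in> V \<and> z \<noteq> 0 \<and> herm z z = 0}"

definition real_ideal_triangle ::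
    "(complex^3) set \<Rightarrow> (complex^3) set \<Rightarrow> (complex^3) set \<Rightarrow> bool" where
  "real_ideal_triangle a b c \<longleftrightarrow> a \<in> boundary_H2C \<and> b \<in> boundary_H2C \<and> c \<in> boundary_H2C \<and>
     a \<noteq> b \<and> b \<noteq> c \<and> a \<noteq> c \<and>
     (\<exists>V. totally_real V \<and> {a, b, c} \<subseteq> boundary_real_plane V)"

section \<open>Punctured surfaces and ideal triangulations\<close>

text \<open>Orientability is expressed by the top homology group.\<close>

definition closed_orientable_surface :: "nat \<Rightarrow> 'a::t2_space set \<Rightarrow> bool" where
  "closed_orientable_surface g M \<longleftrightarrow> compact M \<and> connected M \<and>
     (\<forall>x\<in>M. \<exists>U. openin (top_of_set M) U \<and> x \<in> U \<and> U homeomorphic (UNIV :: (real^2) set)) \<and>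
     homology_group 2 (top_of_set M) \<cong> integer_group \<and>
     homology_group 1 (top_of_set M) \<cong> free_Abelian_group {..<2 * g}"

text \<open>The punctured surface is \<open>M - P\<close>.\<close>

definition punctured_surface :: "nat \<Rightarrow> nat \<Rightarrow> 'a::t2_space set \<Rightarrow> 'a set \<Rightarrow> bool" where
  "punctured_surface g k M P \<longleftrightarrow>
     closed_orientable_surface g M \<and> P \<subseteq> M \<and> finite P \<and> card P = k"

definition std_triangle :: "(real^3) set" where
  "std_triangle = {x. (\<forall>i. 0 \<le> x $ i) \<and> (\<Sum>i\<in>UNIV. x $ i) = 1}"

definition open_triangle :: "(real^3) set" where
  "open_triangle = {x \<in> std_triangle. \<forall>i. 0 < x $ i}"

definition open_side :: "3 \<Rightarrow> (real^3) set" where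
  "open_side i = {x \<in> std_triangle. x $ i = 0 \<and> (\<forall>j. j \<noteq> i \<longrightarrow> 0 < x $ j)}"

definition barycenter :: "real^3" where
  "barycenter = (\<chi> i. 1 / 3)"

text \<open>An ideal triangulation of \<open>M - P\<close> is a finite set of parametrized triangles in \<open>M\<close>
  whose vertices (and no other points) are mapped to \<open>P\<close>.  Two sides of the same triangle
  may be glued to each other, and its vertices may coincide in \<open>M\<close>; hence injectivity
  is only demanded on the open triangle and on each open side.  A side is a pair consisting of
  a triangle and the index of the opposite vertex.\<close>

definition side_image :: "(real^3 \<Rightarrow> 'a) \<times> 3 \<Rightarrow> 'a set" where
  "side_image s = fst s ` open_side (snd s)"

definition ideal_triangulation ::
    "'a::t2_space set \<Rightarrow> 'a set \<Rightarrow> (real^3 \<Rightarrow> 'a) set \<Rightarrow> bool" where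
  "ideal_triangulation M P T \<longleftrightarrow>
     finite T \<and>
     (\<forall>\<tau>\<in>T. continuous_on std_triangle \<tau> \<and> \<tau> ` std_triangle \<subseteq> M \<and>
        (\<forall>x\<in>std_triangle. \<tau> x \<in> P \<longleftrightarrow> (\<exists>i. x = axis i 1)) \<and>
        inj_on \<tau> open_triangle \<and> (\<forall>i. inj_on \<tau> (open_side i))) \<and>
     (\<Union>\<tau>\<in>T. \<tau> ` std_triangle) = M \<and>
     (\<forall>\<tau>\<in>T. \<forall>\<tau>'\<in>T. \<tau> \<noteq> \<tau>' \<longrightarrow> \<tau> ` open_triangle \<inter> \<tau>' ` open_triangle = {}) \<and>
     (\<forall>\<tau>\<in>T. \<forall>s\<in>T \<times> UNIV. \<tau> ` open_triangle \<inter> side_image s = {}) \<and>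
     (\<forall>s\<in>T \<times> UNIV. \<forall>s'\<in>T \<times> UNIV.
        side_image s = side_image s' \<or> side_image s \<inter> side_image s' = {}) \<and>
     (\<forall>s\<in>T \<times> UNIV. \<exists>!s'. s' \<in> T \<times> UNIV \<and> s' \<noteq> s \<and> side_image s' = side_image s)"

text \<open>Adjacency in the dual graph, which may have loops (a triangle with two sides glued
  together) and multiple edges.\<close>

definition dual_adjacent :: "(real^3 \<Rightarrow> 'a) set \<Rightarrow> (real^3 \<Rightarrow> 'a) \<Rightarrow> (real^3 \<Rightarrow> 'a) \<Rightarrow> bool" where
  "dual_adjacent T \<tau> \<tau>' \<longleftrightarrow> \<tau> \<in> T \<and> \<tau>' \<in> T \<and>
     (\<exists>i j. (\<tau>, i) \<noteq> (\<tau>', j) \<and> side_image (\<tau>, i) = side_image (\<tau>', j))"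

definition bipartite_triangulation :: "(real^3 \<Rightarrow> 'a) set \<Rightarrow> bool" where
  "bipartite_triangulation T \<longleftrightarrow> (\<exists>B W. B \<union> W = T \<and> B \<inter> W = {} \<and>
     (\<forall>\<tau> \<tau>'. dual_adjacent T \<tau> \<tau>' \<longrightarrow> (\<tau> \<in> B \<and> \<tau>' \<in> W) \<or> (\<tau> \<in> W \<and> \<tau>' \<in> B)))"

subsection \<open>Fundamental group\<close>

definition path_class :: "'a::topological_space set \<Rightarrow> (real \<Rightarrow> 'a) \<Rightarrow> (real \<Rightarrow> 'a) set" where
  "path_class S c = {d. homotopic_paths S c d}"

definition pi1 :: "'a::topological_space set \<Rightarrow> 'a \<Rightarrow> (real \<Rightarrow> 'a) set monoid" where
  "pi1 S x0 =
     \<lparr>carrier = {path_class S c | c. path c \<and> path_image c \<subseteq> S \<and> pathstart c = x0 \<and> pathfinish c = x0},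
      monoid.mult = (\<lambda>A B. \<Union>a\<in>A. \<Union>b\<in>B. path_class S (a +++ b)),
      one = path_class S (\<lambda>_. x0)\<rparr>"

definition peripheral ::
    "'a::topological_space set \<Rightarrow> 'a set \<Rightarrow> (real \<Rightarrow> 'a) set \<Rightarrow> bool" where
  "peripheral M P \<gamma> \<longleftrightarrow> (\<exists>v\<in>P. \<forall>U. openin (top_of_set M) U \<and> v \<in> U \<longrightarrow>
     (\<exists>c\<in>\<gamma>. \<exists>d. homotopic_loops (M - P) c d \<and> path_image d \<subseteq> U))"

subsection \<open>Lifts to the universal cover\<close>

text \<open>The universal cover of \<open>S\<close> is the space of homotopy classes, relative to the
  endpoints, of paths in \<open>S\<close> issuing from the base point, with \<open>\<pi>\<^sub>1\<close> acting by
  precomposition.  In the same way, a lift of a puncture \<open>v\<close> is a homotopy class of paths that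
  issue from the base point and stay in \<open>S\<close> until they reach \<open>v\<close> at time \<open>1\<close>; the homotopies
  are through such paths.  In the universal cover these are the rays running into an ideal point
  above \<open>v\<close>, and two of them are homotopic if and only if they run into the same ideal point.\<close>

definition cusp_path :: "'a::topological_space set \<Rightarrow> 'a \<Rightarrow> 'a \<Rightarrow> (real \<Rightarrow> 'a) \<Rightarrow> bool" where
  "cusp_path S x0 v c \<longleftrightarrow> path c \<and> pathstart c = x0 \<and> pathfinish c = v \<and> c ` {0..<1} \<subseteq> S"

definition cusp_class :: "'a::topological_space set \<Rightarrow> (real \<Rightarrow> 'a) \<Rightarrow> (real \<Rightarrow> 'a) set" where
  "cusp_class S c = {d. homotopic_with_canon
     (\<lambda>r. pathstart r = pathstart c \<and> pathfinish r = pathfinish c \<and> r ` {0..<1} \<subseteq> S)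
     {0..1} (insert (pathfinish c) S) c d}"

definition puncture_lifts ::
    "'a::topological_space set \<Rightarrow> 'a set \<Rightarrow> 'a \<Rightarrow> (real \<Rightarrow> 'a) set set" where
  "puncture_lifts S P x0 = {cusp_class S c | c v. v \<in> P \<and> cusp_path S x0 v c}"

definition puncture_act ::
    "'a::topological_space set \<Rightarrow> (real \<Rightarrow> 'a) set \<Rightarrow> (real \<Rightarrow> 'a) set \<Rightarrow> (real \<Rightarrow> 'a) set" where
  "puncture_act S \<gamma> \<xi> = (\<Union>a\<in>\<gamma>. \<Union>c\<in>\<xi>. cusp_class S (a +++ c))"

text \<open>A lift of the triangle \<open>\<tau>\<close> is determined by the lift of its barycenter, i.e. by the
  class of a path \<open>c\<close> to that point.  The vertices of the lifted triangle are reached by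
  continuing \<open>c\<close> along the segments from the barycenter to the vertices of \<open>\<tau>\<close>.\<close>

definition lifted_triangles ::
    "'a::topological_space set \<Rightarrow> (real^3 \<Rightarrow> 'a) set \<Rightarrow> 'a \<Rightarrow> (3 \<Rightarrow> (real \<Rightarrow> 'a) set) set" where
  "lifted_triangles S T x0 =
     {(\<lambda>i. cusp_class S (c +++ (\<tau> \<circ> linepath barycenter (axis i 1)))) | c \<tau>.
        \<tau> \<in> T \<and> path c \<and> path_image c \<subseteq> S \<and> pathstart c = x0 \<and> pathfinish c = \<tau> barycenter}"

definition T_bent ::
    "'a::topological_space set \<Rightarrow> 'a set \<Rightarrow> (real^3 \<Rightarrow> 'a) set \<Rightarrow> 'a \<Rightarrow>
     ((real \<Rightarrow> 'a) set \<Rightarrow> (complex^3^3) set) \<Rightarrow> bool" where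
  "T_bent S P T x0 \<rho> \<longleftrightarrow> \<rho> \<in> hom (pi1 S x0) PU21 \<and>
     (\<exists>\<phi>. \<phi> \<in> puncture_lifts S P x0 \<rightarrow> boundary_H2C \<and>
        (\<forall>\<gamma>\<in>carrier (pi1 S x0). \<forall>\<xi>\<in>puncture_lifts S P x0.
           \<phi> (puncture_act S \<gamma> \<xi>) = pu_act (\<rho> \<gamma>) (\<phi> \<xi>)) \<and>
        (\<forall>t\<in>lifted_triangles S T x0. real_ideal_triangle (\<phi> (t 1)) (\<phi> (t 2)) (\<phi> (t 3))))"

definition discrete_faithful_PO21 ::
    "'a::topological_space set \<Rightarrow> 'a \<Rightarrow> ((real \<Rightarrow> 'a) set \<Rightarrow> (complex^3^3) set) \<Rightarrow> bool" where
  "discrete_faithful_PO21 S x0 \<rho> \<longleftrightarrow>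
     \<rho> \<in> hom (pi1 S x0) PU21 \<and> \<rho> ` carrier (pi1 S x0) \<subseteq> PO21 \<and>
     inj_on \<rho> (carrier (pi1 S x0)) \<and>
     subtopology PU21_topology (\<rho> ` carrier (pi1 S x0)) =
       discrete_topology (\<rho> ` carrier (pi1 S x0))"

end

theory Submission
  imports Defs "HOL-Computational_Algebra.Fundamental_Theorem_Algebra"
begin

text \<open>The eigenvalues of an element of \<open>U(2,1)\<close> are permuted by inversion in the unit circle, and
  their product has modulus one.  Hence the modulus of its trace is at most
  \<open>\<sigma> + 1/\<sigma> + 1\<close>, where \<open>\<sigma> \<ge> 1\<close> is the spectral radius, with equality for the parabolic and the
  hyperbolic elements of \<open>PO(2,1)\<close>.  As this bound is monotone in \<open>\<sigma>\<close>, only the elliptic values of the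
  discrete and faithful representation are a problem.  By discreteness and faithfulness they come
  from torsion elements, so it suffices to show that the fundamental group of the punctured surface
  has no torsion.

  A loop is homotopic to a word in the edges of the triangulation that it crosses.  If a nonempty
  word is contractible, then it backtracks: a disc bounded by the loop is cut by the preimages of
  the edges, each component of which separates it because circle-valued functions on the disc lift
  to the line.  Applied to the powers of a cyclically reduced word, this shows that a nontrivial
  element has infinite order.  Bipartiteness excludes that a triangle is glued to itself.\<close>

section \<open>Isometries of the complex hyperbolic plane\<close>

subsection \<open>The groups U(2,1) and PU(2,1)\<close>

text \<open>An elliptic element of \<open>PO(2,1)\<close> has spectral radius 1 whatever its angle,
  while the modulus of its trace takes every value between 0 and 3. The comparison of lengths
  therefore gives no lower bound for that trace, and such values have to be excluded by the group.

  The obstacle in the disc argument is that a null homotopy is merely continuous: the preimage of an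
  edge need not consist of arcs, and no general position is available. Components of open sets
  replace the arcs. The circle-valued function of an edge is -1 away from the edge and makes one
  full turn across it. Composed with the homotopy and replaced by -1 outside one component of the
  set where it differs from -1, it stays continuous, so it lifts to the line. Along the boundary the
  lift changes exactly at the crossings of that component, and its total change is zero. Hence no
  component is crossed just once, and a connected set that avoids the component sees a constant
  lift. These two facts force backtracking.\<close>

lemma J_nth [simp]:
  "J $ 1 $ 1 = 0" "J $ 1 $ 2 = 0" "J $ 1 $ 3 = 1" "J $ 2 $ 1 = 0" "J $ 2 $ 2 = 1"
  "J $ 2 $ 3 = 0" "J $ 3 $ 1 = 1" "J $ 3 $ 2 = 0" "J $ 3 $ 3 = 0"
  by (simp_all add: J_def)

lemma det_J: "det (J :: 'a::comm_ring_1^3^3) = -1"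
  by (simp add: det_3)

lemma conj_transpose_mult: "conj_transpose (A ** B) = conj_transpose B ** conj_transpose A"
  by (simp add: vec_eq_iff conj_transpose_def matrix_matrix_mult_def mult.commute)

lemma conj_transpose_mat: "conj_transpose (mat c) = mat (cnj c)"
  by (simp add: vec_eq_iff conj_transpose_def mat_def)

lemma det_conj_transpose: "det (conj_transpose A) = cnj (det A)" for A :: "complex^3^3"
  by (simp add: det_3 conj_transpose_def algebra_simps)

lemma mat_mult_nth: "(mat c ** A) $ i $ j = c * A $ i $ j" for A :: "'a::comm_ring_1^'n^'n"
  by (simp add: matrix_matrix_mult_def mat_def if_distrib if_distribR cong: if_cong)

lemma mult_mat_nth: "(A ** mat c) $ i $ j = c * A $ i $ j" for A :: "'a::comm_ring_1^'n^'n"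
  by (simp add: matrix_matrix_mult_def mat_def if_distrib if_distribR mult.commute cong: if_cong)

lemma mat_mult_commute: "mat c ** A = A ** mat c" for A :: "'a::comm_ring_1^'n^'n"
  by (simp add: vec_eq_iff mat_mult_nth mult_mat_nth)

lemma mat_mult_mat: "mat c ** mat d = mat (c * d :: 'a::comm_ring_1)"
  by (simp add: vec_eq_iff mat_mult_nth) (simp add: mat_def)

lemma det_mat_3: "det (mat c :: 'a::comm_ring_1^3^3) = c ^ 3"
  by (simp add: det_3 mat_def power3_eq_cube)

lemma invertible_mat: "c \<noteq> 0 \<Longrightarrow> invertible (mat c :: 'a::field^'n^'n)"
  unfolding invertible_def by (intro exI[of _ "mat (inverse c)"]) (simp add: mat_mult_mat)

lemma U21_simps [simp]:
  "A \<in> carrier U21 \<longleftrightarrow> invertible A \<and> conj_transpose A ** J ** A = J"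
  "A \<otimes>\<^bsub>U21\<^esub> B = A ** B" "\<one>\<^bsub>U21\<^esub> = mat 1"
  by (simp_all add: U21_def)

lemma group_U21: "group U21"
proof (rule groupI)
  fix A B assume "A \<in> carrier U21" "B \<in> carrier U21"
  moreover from this have "conj_transpose (A ** B) ** J ** (A ** B) =
      conj_transpose B ** (conj_transpose A ** J ** A) ** B"
    by (simp only: conj_transpose_mult matrix_mul_assoc)
  ultimately show "A \<otimes>\<^bsub>U21\<^esub> B \<in> carrier U21" by (simp add: invertible_mult)
next
  fix A assume A: "A \<in> carrier U21"
  then obtain B where B: "A ** B = mat 1" "B ** A = mat 1" by (auto simp: invertible_def)
  have B': "conj_transpose B ** conj_transpose A = mat 1"
    using arg_cong[OF B(1), of conj_transpose] by (simp add: conj_transpose_mult conj_transpose_mat)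
  have "conj_transpose B ** J ** B = conj_transpose B ** (conj_transpose A ** J ** A) ** B"
    using A by simp
  also have "\<dots> = (conj_transpose B ** conj_transpose A) ** J ** (A ** B)"
    by (simp only: matrix_mul_assoc)
  finally have "conj_transpose B ** J ** B = J" using B B' by simp
  then show "\<exists>B\<in>carrier U21. B \<otimes>\<^bsub>U21\<^esub> A = \<one>\<^bsub>U21\<^esub>"
    using B by (intro bexI[of _ B]) (auto simp: invertible_def)
next
  show "\<one>\<^bsub>U21\<^esub> \<in> carrier U21"
    using invertible_mat[of 1] by (simp add: conj_transpose_mat)
qed (simp_all add: matrix_mul_assoc)

lemma unit_scalars_subset: "unit_scalars \<subseteq> carrier U21"
proof
  fix A assume "A \<in> unit_scalars"
  then obtain c where c: "A = mat c" "cmod c = 1" by (auto simp: unit_scalars_def)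
  have "conj_transpose A ** J ** A = J ** (mat (cnj c) ** mat c)"
    unfolding c(1) conj_transpose_mat mat_mult_commute[of "cnj c" J] by (simp add: matrix_mul_assoc)
  then have "conj_transpose A ** J ** A = J ** mat (cnj c * c)"
    by (simp add: mat_mult_mat)
  also have "cnj c * c = 1" using c(2) complex_norm_square[of c] by (simp add: mult.commute)
  finally have "conj_transpose A ** J ** A = J" by simp
  moreover have "c \<noteq> 0" using c(2) by auto
  ultimately show "A \<in> carrier U21" using invertible_mat[of c] c(1) by simp
qed

lemma normal_unit_scalars: "unit_scalars \<lhd> U21"
proof (rule group.normalI[OF group_U21])
  interpret group U21 by (rule group_U21)
  show "subgroup unit_scalars U21"
  proof
    show "inv\<^bsub>U21\<^esub> A \<in> unit_scalars" if A: "A \<in> unit_scalars" for A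
    proof -
      obtain c where c: "A = mat c" "cmod c = 1" using A by (auto simp: unit_scalars_def)
      then have "c \<noteq> 0" by auto
      then have "mat (inverse c) \<otimes>\<^bsub>U21\<^esub> A = \<one>\<^bsub>U21\<^esub>" by (simp add: c mat_mult_mat)
      moreover have "mat (inverse c) \<in> unit_scalars"
        using c by (auto simp: unit_scalars_def norm_inverse intro!: exI[of _ "inverse c"])
      moreover have "inv\<^bsub>U21\<^esub> A = mat (inverse c)"
        by (rule inv_equality) (use calculation A unit_scalars_subset in blast)+
      ultimately show ?thesis by simp
    qed
    show "A \<otimes>\<^bsub>U21\<^esub> B \<in> unit_scalars" if AB: "A \<in> unit_scalars" "B \<in> unit_scalars" for A B
    proof -
      obtain c d where "A = mat c" "cmod c = 1" "B = mat d" "cmod d = 1"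
        using AB by (auto simp: unit_scalars_def)
      then show ?thesis
        by (auto simp: unit_scalars_def mat_mult_mat norm_mult intro!: exI[of _ "c * d"])
    qed
    show "\<one>\<^bsub>U21\<^esub> \<in> unit_scalars" by (auto simp: unit_scalars_def intro!: exI[of _ 1])
  qed (rule unit_scalars_subset)
  show "\<forall>x\<in>carrier U21. unit_scalars #>\<^bsub>U21\<^esub> x = x <#\<^bsub>U21\<^esub> unit_scalars"
    unfolding r_coset_def l_coset_def
    by (intro ballI SUP_cong refl) (auto simp: unit_scalars_def intro: mat_mult_commute)
qed

lemma group_PU21: "group PU21"
  unfolding PU21_def using normal_unit_scalars by (rule normal.factorgroup_is_group)

lemma pu_class_hom: "pu_class \<in> hom U21 PU21"
  using normal.r_coset_hom_Mod[OF normal_unit_scalars] unfolding PU21_def pu_class_def by simp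

lemma one_PU21: "\<one>\<^bsub>PU21\<^esub> = pu_class (mat 1)"
  using hom_one[OF pu_class_hom group_U21 group_PU21] by simp

section \<open>Lifts from PU(2,1) and the invariants that do not depend on them\<close>

lemma mem_pu_class: "B \<in> pu_class A \<longleftrightarrow> (\<exists>c. cmod c = 1 \<and> B = mat c ** A)"
  by (auto simp: pu_class_def r_coset_def unit_scalars_def)

lemma pu_lift_in_U21:
  assumes "X \<in> carrier PU21"
  shows "pu_lift X \<in> carrier U21" "X = pu_class (pu_lift X)"
proof -
  interpret group U21 by (rule group_U21)
  have sub: "subgroup unit_scalars U21"
    using normal_unit_scalars by (rule normal_imp_subgroup)
  obtain A where A: "A \<in> carrier U21" "X = unit_scalars #>\<^bsub>U21\<^esub> A"
    using assms by (auto simp: PU21_def FactGroup_def RCOSETS_def)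
  then have "A \<in> X" using rcos_self sub by blast
  then have L: "pu_lift X \<in> X" unfolding pu_lift_def by (rule someI)
  then show "pu_lift X \<in> carrier U21"
    using A sub subgroup.subset[OF sub] r_coset_subset_G by blast
  show "X = pu_class (pu_lift X)"
    unfolding pu_class_def using repr_independence[OF _ A(1) sub] L A(2) by simp
qed

text \<open>\<open>pu_lift\<close> picks a representative by choice, so it is known only up to a
  unit scalar. This suffices: such a scalar changes neither the modulus of the trace nor the moduli
  of the eigenvalues.\<close>

lemma pu_lift_pu_class: "\<exists>c. cmod c = 1 \<and> pu_lift (pu_class A) = mat c ** A"
proof -
  have "A \<in> pu_class A" unfolding mem_pu_class by (intro exI[of _ 1]) simp
  then have "pu_lift (pu_class A) \<in> pu_class A" unfolding pu_lift_def by (rule someI)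
  then show ?thesis by (simp add: mem_pu_class)
qed

lemma abs_trace_pu_class: "abs_trace (pu_class A) = cmod (trace A)"
proof -
  obtain c where "cmod c = 1" "pu_lift (pu_class A) = mat c ** A" using pu_lift_pu_class by blast
  moreover have "trace (mat c ** A) = c * trace A"
    by (simp add: trace_def mat_mult_nth sum_distrib_left)
  ultimately show ?thesis by (simp add: abs_trace_def norm_mult)
qed

lemma mat_vector_mult: "mat c *v x = c *s (x :: complex^'n)"
  by (simp add: vec_eq_iff matrix_vector_mult_def mat_def if_distrib if_distribR cong: if_cong)

lemma eigenvalues_mat_mult:
  assumes "c \<noteq> 0"
  shows "eigenvalues (mat c ** A) = (*) c ` eigenvalues A"
proof -
  have "\<mu> \<in> eigenvalues (mat c ** A) \<longleftrightarrow> \<mu> / c \<in> eigenvalues A" for \<mu>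
  proof -
    have "mat c ** A *v v = \<mu> *s v \<longleftrightarrow> A *v v = (\<mu> / c) *s v" for v
    proof -
      have "(mat c ** A *v v) $ i = c * (A *v v) $ i" for i
        by (simp add: mat_vector_mult flip: matrix_vector_mul_assoc)
      then show ?thesis using assms by (auto simp: vec_eq_iff field_simps)
    qed
    then show ?thesis by (simp add: eigenvalues_def)
  qed
  moreover have "\<mu> / c \<in> eigenvalues A \<longleftrightarrow> \<mu> \<in> (*) c ` eigenvalues A" for \<mu>
    using assms by (auto simp: image_iff) (metis nonzero_eq_divide_eq mult.commute)
  ultimately show ?thesis by blast
qed

lemma spec_radius_pu_lift: "spec_radius (pu_lift (pu_class A)) = spec_radius A"
proof -
  obtain c where c: "cmod c = 1" "pu_lift (pu_class A) = mat c ** A" using pu_lift_pu_class by blast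
  then have "c \<noteq> 0" by auto
  then show ?thesis
    using c by (simp add: spec_radius_def eigenvalues_mat_mult image_image norm_mult)
qed

subsection \<open>Trace and spectral radius in U(2,1)\<close>

lemma cubic_roots:
  fixes t s d :: complex
  obtains a b c where "\<And>x. x ^ 3 - t * x\<^sup>2 + s * x - d = (x - a) * (x - b) * (x - c)"
proof -
  have "\<not> constant (poly [:-d, s, -t, 1:])"
    unfolding constant_degree by simp
  then obtain a where "poly [:-d, s, -t, 1:] a = 0"
    using fundamental_theorem_of_algebra by blast
  then have d: "d = a * s - a * a * t + a * a * a" by (simp add: algebra_simps)
  \<comment> \<open>Division of the cubic by \<open>x - a\<close> leaves the quadratic with
    coefficients 1, \<open>p\<close>, \<open>q\<close>; \<open>r\<close> is a square root of its
    discriminant.\<close>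
  define p where "p = a - t"
  define q where "q = a * a - a * t + s"
  define r where "r = csqrt (p\<^sup>2 - 4 * q)"
  have r: "r * r = p * p - 4 * q"
    unfolding r_def using power2_csqrt[of "p\<^sup>2 - 4 * q"] by (simp add: power2_eq_square)
  show thesis
  proof
    fix x
    have "(x - (r - p) / 2) * (x - (- r - p) / 2) = x * x + p * x + (p * p - r * r) / 4"
      by (simp add: field_simps)
    also have "\<dots> = x * x + p * x + q" using r by simp
    finally have "(x - a) * ((x - (r - p) / 2) * (x - (- r - p) / 2)) =
        (x - a) * (x * x + p * x + q)" by simp
    then show "x ^ 3 - t * x\<^sup>2 + s * x - d = (x - a) * (x - (r - p) / 2) * (x - (- r - p) / 2)"
      unfolding mult.assoc d p_def q_def by (simp add: algebra_simps power2_eq_square power3_eq_cube)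
  qed
qed

lemma char_poly_roots:
  fixes A :: "complex^3^3"
  obtains a b c where "\<And>x. det (mat x - A) = (x - a) * (x - b) * (x - c)"
    "trace A = a + b + c" "det A = a * b * c"
proof -
  \<comment> \<open>The sum of the principal 2-by-2 minors, which is the linear coefficient of the
    characteristic polynomial.\<close>
  define s where "s = A$1$1 * A$2$2 - A$1$2 * A$2$1 + A$1$1 * A$3$3 - A$1$3 * A$3$1
    + A$2$2 * A$3$3 - A$2$3 * A$3$2"
  have cp: "det (mat x - A) = x ^ 3 - trace A * x\<^sup>2 + s * x - det A" for x
    by (simp add: det_3 trace_def sum_3 mat_def s_def algebra_simps power2_eq_square power3_eq_cube)
  obtain a b c where abc:
      "\<And>x. x ^ 3 - trace A * x\<^sup>2 + s * x - det A = (x - a) * (x - b) * (x - c)"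
    using cubic_roots by blast
  have det: "det A = a * b * c" using abc[of 0] by simp
  \<comment> \<open>In the sum of the values at 1 and -1 the coefficient \<open>s\<close> cancels,
    which isolates the trace.\<close>
  have "1 - trace A + s - a * b * c = (1 - a) * (1 - b) * (1 - c)"
    "- 1 - trace A - s - a * b * c = (- 1 - a) * (- 1 - b) * (- 1 - c)"
    using abc[of 1] abc[of "-1"] det by simp_all
  note e = this
  have "2 * trace A = - ((1 - trace A + s - a * b * c) + (- 1 - trace A - s - a * b * c)
      + 2 * (a * b * c))"
    by (simp add: algebra_simps)
  also have "\<dots> = 2 * (a + b + c)"
    unfolding e by (simp add: algebra_simps)
  finally have "2 * trace A = 2 * (a + b + c)" .
  then have "trace A = a + b + c" by (simp only: mult_cancel_left) simp
  with det show thesis using that cp abc by auto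
qed

lemma eigenvalues_iff_det: "\<mu> \<in> eigenvalues A \<longleftrightarrow> det (mat \<mu> - A) = 0"
proof -
  have "A *v v = \<mu> *s v \<longleftrightarrow> (mat \<mu> - A) *v v = 0" for v
    by (auto simp: matrix_vector_mult_diff_rdistrib mat_vector_mult)
  then have "\<mu> \<in> eigenvalues A \<longleftrightarrow> \<not> invertible (mat \<mu> - A)"
    unfolding eigenvalues_def invertible_left_inverse matrix_left_invertible_ker by auto
  then show ?thesis by (simp add: invertible_det_nz)
qed

lemma eigenvalues_roots:
  assumes "\<And>x. det (mat x - A) = (x - a) * (x - b) * (x - c)"
  shows "eigenvalues A = {a, b, c}"
  by (auto simp: eigenvalues_iff_det assms)

lemma cmod_det_U21:
  assumes "A \<in> carrier U21"
  shows "cmod (det A) = 1"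
proof -
  have "det (conj_transpose A ** J ** A) = det (J :: complex^3^3)" using assms by simp
  then have "cnj (det A) * det A = 1" by (simp add: det_mul det_conj_transpose det_J)
  then have "(cmod (det A))\<^sup>2 = 1"
    by (metis complex_norm_square mult.commute of_real_eq_1_iff)
  then show ?thesis
    by (simp add: power2_eq_1_iff) (metis norm_ge_zero neg_0_le_iff_le not_one_le_zero)
qed

text \<open>Since A* J A = J, the matrix (\<mu> - A)* J A equals - cnj \<mu> J (1 / cnj \<mu> - A).
  For an eigenvalue \<mu> the first factor on the left is singular, hence so is the last factor on
  the right.\<close>

lemma eigenvalues_U21_symmetric:
  assumes "A \<in> carrier U21" "\<mu> \<in> eigenvalues A"
  shows "\<mu> \<noteq> 0" "1 / cnj \<mu> \<in> eigenvalues A"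
proof -
  have d: "det (mat \<mu> - A) = 0" using assms(2) by (simp add: eigenvalues_iff_det)
  show "\<mu> \<noteq> 0"
  proof
    assume "\<mu> = 0"
    then have "det A = 0" using d by (simp add: det_3 algebra_simps)
    then show False using cmod_det_U21[OF assms(1)] by simp
  qed
  have "conj_transpose (mat \<mu> - A) ** J ** A =
      conj_transpose (mat \<mu>) ** J ** A - conj_transpose A ** J ** A"
    by (simp add: vec_eq_iff matrix_matrix_mult_def conj_transpose_def sum_3 algebra_simps)
  also have "\<dots> = J ** (mat (cnj \<mu>) ** A) - J ** mat 1"
    using assms(1) unfolding conj_transpose_mat mat_mult_commute[of "cnj \<mu>" J]
    by (simp add: matrix_mul_assoc)
  also have "\<dots> = J ** (mat (cnj \<mu>) ** A - mat 1)"
    by (simp add: vec_eq_iff matrix_matrix_mult_def sum_3 algebra_simps)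
  also have "mat (cnj \<mu>) ** A - mat 1 = mat (- cnj \<mu>) ** (mat (1 / cnj \<mu>) - A)"
    using \<open>\<mu> \<noteq> 0\<close> by (simp add: vec_eq_iff mat_mult_nth) (simp add: mat_def field_simps)
  finally have "det (conj_transpose (mat \<mu> - A) ** J ** A) =
      det (J ** (mat (- cnj \<mu>) ** (mat (1 / cnj \<mu>) - A)))" by simp
  then have "cnj \<mu> ^ 3 * det (mat (1 / cnj \<mu>) - A) = 0"
    by (simp add: det_mul det_conj_transpose d det_J det_mat_3)
  then show "1 / cnj \<mu> \<in> eigenvalues A"
    using \<open>\<mu> \<noteq> 0\<close> by (simp add: eigenvalues_iff_det)
qed

text \<open>Here \<open>a\<close> has the largest modulus, which is at least 1 because the product
  has modulus 1. If it equals 1, all moduli are at most 1 and the bound is 3. Otherwise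
  \<open>1 / cnj a\<close> has a modulus different from that of \<open>a\<close>, so it is
  \<open>b\<close> or \<open>c\<close>, and the product forces the remaining number onto the unit
  circle.\<close>

lemma norm_sum3_le_of_symmetric:
  fixes a b c :: complex
  assumes prod: "cmod (a * b * c) = 1"
    and sym: "1 / cnj a \<in> {a, b, c}"
    and max: "cmod b \<le> cmod a" "cmod c \<le> cmod a"
  shows "cmod (a + b + c) \<le> cmod a + 1 / cmod a + 1" "1 \<le> cmod a"
proof -
  have tri: "cmod (a + b + c) \<le> cmod a + cmod b + cmod c"
    using norm_triangle_ineq[of "a + b" c] norm_triangle_ineq[of a b] by linarith
  have a0: "cmod a \<noteq> 0" using prod by auto
  show a1: "1 \<le> cmod a"
  proof (rule ccontr)
    assume "\<not> 1 \<le> cmod a"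
    then have "cmod a < 1" "cmod b < 1" "cmod c < 1" using max by auto
    then have "cmod a * cmod b * cmod c \<le> cmod a * 1 * 1"
      by (intro mult_mono) auto
    then show False using prod \<open>cmod a < 1\<close> by (simp add: norm_mult)
  qed
  show "cmod (a + b + c) \<le> cmod a + 1 / cmod a + 1"
  proof (cases "cmod a = 1")
    case True
    then show ?thesis using tri max by simp
  next
    case False
    have inv: "cmod (1 / cnj a) = 1 / cmod a" by (simp add: norm_divide)
    have "1 / cmod a \<noteq> cmod a"
    proof
      assume "1 / cmod a = cmod a"
      then have "(cmod a)\<^sup>2 = 1" using a0 by (simp add: field_simps power2_eq_square)
      then show False using False a1 by (simp add: power2_eq_1_iff)
    qed
    then consider "cmod b = 1 / cmod a" | "cmod c = 1 / cmod a" using sym inv by auto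
    then show ?thesis
    proof cases
      case 1
      then have "cmod a * cmod b = 1" using a0 by simp
      then have "cmod c = 1" using prod by (simp add: norm_mult)
      then show ?thesis using tri 1 by simp
    next
      case 2
      then have "cmod a * cmod c = 1" using a0 by simp
      moreover have "cmod b * (cmod a * cmod c) = 1" using prod by (simp add: norm_mult mult_ac)
      ultimately have "cmod b = 1" by simp
      then show ?thesis using tri 2 by simp
    qed
  qed
qed

lemma trace_le_spec_radius_U21:
  assumes "A \<in> carrier U21"
  shows "cmod (trace A) \<le> spec_radius A + 1 / spec_radius A + 1" "1 \<le> spec_radius A"
proof -
  obtain a b c where abc: "\<And>x. det (mat x - A) = (x - a) * (x - b) * (x - c)"
    "trace A = a + b + c" "det A = a * b * c" using char_poly_roots by blast
  have ev: "eigenvalues A = {a, b, c}" using eigenvalues_roots[OF abc(1)] .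
  have sym: "1 / cnj \<mu> \<in> {a, b, c}" if "\<mu> \<in> {a, b, c}" for \<mu>
    using eigenvalues_U21_symmetric[OF assms] that ev by simp
  have prod: "cmod (a * b * c) = 1" using cmod_det_U21[OF assms] abc by simp
  have sr: "spec_radius A = max (cmod a) (max (cmod b) (cmod c))"
    by (simp add: spec_radius_def ev)
  consider "cmod b \<le> cmod a" "cmod c \<le> cmod a" | "cmod a \<le> cmod b" "cmod c \<le> cmod b"
    | "cmod a \<le> cmod c" "cmod b \<le> cmod c" by linarith
  then have "cmod (trace A) \<le> spec_radius A + 1 / spec_radius A + 1 \<and> 1 \<le> spec_radius A"
  proof cases
    case 1
    then have "spec_radius A = cmod a" by (simp add: sr)
    with norm_sum3_le_of_symmetric[OF prod sym 1] abc(2) show ?thesis by simp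
  next
    case 2
    have p: "cmod (b * a * c) = 1" "1 / cnj b \<in> {b, a, c}"
      using prod sym[of b] by (auto simp: mult_ac)
    note norm_sum3_le_of_symmetric[OF p 2]
    moreover have "spec_radius A = cmod b" using 2 by (simp add: sr)
    ultimately show ?thesis using abc(2) by (simp add: add_ac)
  next
    case 3
    have p: "cmod (c * a * b) = 1" "1 / cnj c \<in> {c, a, b}"
      using prod sym[of c] by (auto simp: mult_ac)
    note norm_sum3_le_of_symmetric[OF p 3]
    moreover have "spec_radius A = cmod c" using 3 by (simp add: sr)
    ultimately show ?thesis using abc(2) by (simp add: add_ac)
  qed
  then show "cmod (trace A) \<le> spec_radius A + 1 / spec_radius A + 1" "1 \<le> spec_radius A" by auto
qed

lemma add_inverse_mono:
  fixes x y :: real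
  assumes "1 \<le> x" "x \<le> y"
  shows "x + 1 / x \<le> y + 1 / y"
proof -
  have "1 \<le> x * y" using mult_mono[of 1 x 1 y] assms by simp
  then have "0 \<le> 1 - 1 / (x * y)" by simp
  then have "0 \<le> (y - x) * (1 - 1 / (x * y))" using assms(2) by simp
  also have "\<dots> = (y + 1 / y) - (x + 1 / x)"
  proof -
    have "x \<noteq> 0" "y \<noteq> 0" using assms by auto
    then show ?thesis by (simp add: field_simps)
  qed
  finally show ?thesis by simp
qed

subsection \<open>The symmetric square of SL(2,R)\<close>

text \<open>The action of the matrix with rows (p, q) and (r, s) on the symmetric square of the
  plane, in the basis e1 e1, sqrt 2 e1 e2, - e2 e2. The factor sqrt 2 and the sign turn the
  invariant form, the discriminant of binary quadratic forms, into a multiple of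
  \<open>J\<close>.\<close>

definition sym2 :: "real \<Rightarrow> real \<Rightarrow> real \<Rightarrow> real \<Rightarrow> real^3^3" where
  "sym2 p q r s = vector [vector [p * p, sqrt 2 * p * q, - (q * q)],
     vector [sqrt 2 * p * r, p * s + q * r, - (sqrt 2 * q * s)],
     vector [- (r * r), - (sqrt 2 * r * s), s * s]]"

lemma sym2_nth [simp]:
  "sym2 p q r s $ 1 $ 1 = p * p" "sym2 p q r s $ 1 $ 2 = sqrt 2 * p * q"
  "sym2 p q r s $ 1 $ 3 = - (q * q)" "sym2 p q r s $ 2 $ 1 = sqrt 2 * p * r"
  "sym2 p q r s $ 2 $ 2 = p * s + q * r" "sym2 p q r s $ 2 $ 3 = - (sqrt 2 * q * s)"
  "sym2 p q r s $ 3 $ 1 = - (r * r)" "sym2 p q r s $ 3 $ 2 = - (sqrt 2 * r * s)"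
  "sym2 p q r s $ 3 $ 3 = s * s"
  by (simp_all add: sym2_def)

lemma sym2_mult:
  "sym2 p q r s ** sym2 p' q' r' s' =
    sym2 (p * p' + q * r') (p * q' + q * s') (r * p' + s * r') (r * q' + s * s')"
  by (simp add: vec_eq_iff forall_3 matrix_matrix_mult_def sum_3 algebra_simps)

lemma sym2_in_real_J_group:
  assumes "p * s - q * r = 1"
  shows "sym2 p q r s \<in> real_J_group"
proof -
  \<comment> \<open>The symmetric square multiplies the form by the square of the
    determinant.\<close>
  have "(p * s - q * r) * (p * s - q * r) = 1" using assms by simp
  then show ?thesis
    by (simp add: real_J_group_def vec_eq_iff forall_3 matrix_matrix_mult_def sum_3 transpose_def
        algebra_simps)
qed

section \<open>Real isometries: embedding into U(2,1) and description as symmetric squares\<close>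

lemma complexify_nth [simp]: "complexify A $ i $ j = of_real (A $ i $ j)"
  by (simp add: complexify_def)

lemma complexify_mult: "complexify (A ** B) = complexify A ** complexify B"
  by (simp add: vec_eq_iff matrix_matrix_mult_def)

lemma complexify_J: "complexify J = J"
  by (simp add: vec_eq_iff forall_3)

lemma complexify_mat_1: "complexify (mat 1) = mat 1"
  by (simp add: vec_eq_iff mat_def)

lemma complexify_in_U21:
  assumes "A \<in> real_J_group"
  shows "complexify A \<in> carrier U21"
proof -
  have T: "conj_transpose (complexify A) = complexify (transpose A)"
    by (simp add: vec_eq_iff conj_transpose_def transpose_def)
  have "complexify (transpose A ** J ** A) = J"
    using assms by (simp add: real_J_group_def complexify_J)
  then have J: "conj_transpose (complexify A) ** J ** complexify A = J"
    by (simp add: T complexify_mult complexify_J)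
  have "det (conj_transpose (complexify A) ** J ** complexify A) = det (J :: complex^3^3)"
    by (simp add: J)
  then have "det (complexify A) \<noteq> 0" by (auto simp: det_mul det_J)
  then show ?thesis using J by (simp add: invertible_det_nz)
qed

text \<open>For determinant 1 the inverse is the adjugate \<open>N\<close>. The inverse is also
  \<open>J ** transpose A ** J\<close>, so these entries turn into quadratic relations among the
  entries of \<open>A\<close> alone.\<close>

lemma adjugate_3:
  fixes A B :: "real^3^3"
  assumes "A ** B = mat 1" "det A = 1"
  shows "B$3$3 = A$1$1 * A$2$2 - A$1$2 * A$2$1" "B$2$3 = A$1$3 * A$2$1 - A$1$1 * A$2$3"
    "B$3$2 = A$1$2 * A$3$1 - A$1$1 * A$3$2" "B$2$2 = A$1$1 * A$3$3 - A$1$3 * A$3$1"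
proof -
  define N :: "real^3^3" where "N = vector
     [vector [A$2$2 * A$3$3 - A$2$3 * A$3$2, A$1$3 * A$3$2 - A$1$2 * A$3$3, A$1$2 * A$2$3 - A$1$3 * A$2$2],
      vector [A$2$3 * A$3$1 - A$2$1 * A$3$3, A$1$1 * A$3$3 - A$1$3 * A$3$1, A$1$3 * A$2$1 - A$1$1 * A$2$3],
      vector [A$2$1 * A$3$2 - A$2$2 * A$3$1, A$1$2 * A$3$1 - A$1$1 * A$3$2, A$1$1 * A$2$2 - A$1$2 * A$2$1]]"
  have "N ** A = mat (det A)"
    by (simp add: N_def vec_eq_iff forall_3 matrix_matrix_mult_def sum_3 mat_def det_3 algebra_simps)
  then have "N = N ** (A ** B)" "N ** A = mat 1" using assms by simp_all
  then have "N = B" by (metis matrix_mul_assoc matrix_mul_lid)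
  then show "B$3$3 = A$1$1 * A$2$2 - A$1$2 * A$2$1" "B$2$3 = A$1$3 * A$2$1 - A$1$1 * A$2$3"
    "B$3$2 = A$1$2 * A$3$1 - A$1$1 * A$3$2" "B$2$2 = A$1$1 * A$3$3 - A$1$3 * A$3$1"
    by (auto simp: N_def)
qed

lemma real_J_group_inverse:
  assumes "A \<in> real_J_group"
  shows "A ** (J ** transpose A ** J) = mat 1"
proof -
  have "J ** (J :: real^3^3) = mat 1"
    by (simp add: vec_eq_iff forall_3 matrix_matrix_mult_def sum_3 mat_def)
  then have "(J ** transpose A ** J) ** A = mat 1"
    using assms by (simp add: real_J_group_def flip: matrix_mul_assoc)
  then show ?thesis by (simp add: matrix_left_right_inverse)
qed

lemma J_conj_nth:
  fixes A :: "real^3^3"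
  shows "(J ** A ** J) $ i $ 1 = (J ** A) $ i $ 3" "(J ** A ** J) $ i $ 2 = (J ** A) $ i $ 2"
    "(J ** A ** J) $ i $ 3 = (J ** A) $ i $ 1"
    "(J ** A) $ 1 $ j = A $ 3 $ j" "(J ** A) $ 2 $ j = A $ 2 $ j" "(J ** A) $ 3 $ j = A $ 1 $ j"
  by (simp_all add: matrix_matrix_mult_def sum_3)

text \<open>The columns are the images of the basis vectors, so they have the products that
  \<open>J\<close> prescribes for the basis.\<close>

lemma real_J_group_columns:
  assumes "A \<in> real_J_group"
  shows "2 * (A$1$1 * A$3$1) + A$2$1 * A$2$1 = 0" "2 * (A$1$3 * A$3$3) + A$2$3 * A$2$3 = 0"
    "A$1$1 * A$3$3 + A$2$1 * A$2$3 + A$3$1 * A$1$3 = 1"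
    "A$1$2 * A$3$3 + A$2$2 * A$2$3 + A$3$2 * A$1$3 = 0"
proof -
  have "(transpose A ** J ** A) $ i $ j = J $ i $ j" for i j
    using assms by (simp add: real_J_group_def)
  from this[of 1 1] this[of 3 3] this[of 1 3] this[of 2 3]
  show "2 * (A$1$1 * A$3$1) + A$2$1 * A$2$1 = 0" "2 * (A$1$3 * A$3$3) + A$2$3 * A$2$3 = 0"
    "A$1$1 * A$3$3 + A$2$1 * A$2$3 + A$3$1 * A$1$3 = 1"
    "A$1$2 * A$3$3 + A$2$2 * A$2$3 + A$3$2 * A$1$3 = 0"
    by (simp_all add: matrix_matrix_mult_def sum_3 transpose_def algebra_simps)
qed

lemma real_J_group_rows:
  assumes "A \<in> real_J_group"
  shows "2 * (A$1$1 * A$1$3) + A$1$2 * A$1$2 = 0" "2 * (A$3$1 * A$3$3) + A$3$2 * A$3$2 = 0"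
proof -
  have "(A ** (J ** transpose A ** J)) $ i $ j = (mat 1 :: real^3^3) $ i $ j" for i j
    using real_J_group_inverse[OF assms] by simp
  from this[of 1 3] this[of 3 1]
  show "2 * (A$1$1 * A$1$3) + A$1$2 * A$1$2 = 0" "2 * (A$3$1 * A$3$3) + A$3$2 * A$3$2 = 0"
    by (simp_all add: matrix_matrix_mult_def[of A] sum_3 J_conj_nth transpose_def mat_def algebra_simps)
qed

text \<open>The product of \<open>A v\<close> and \<open>v\<close> for the negative vector \<open>v = (1, 0, -1)\<close>: its sign tells
  whether \<open>A\<close> preserves the half of the light cone that contains \<open>v\<close>.\<close>

definition time_sign :: "real^3^3 \<Rightarrow> real" where
  "time_sign A = A$1$3 + A$3$1 - A$1$1 - A$3$3"

lemma real_J_group_signs: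
  assumes "A \<in> real_J_group"
  shows "A$1$1 * A$3$1 \<le> 0" "A$1$3 * A$3$3 \<le> 0" "A$1$1 * A$1$3 \<le> 0" "A$3$1 * A$3$3 \<le> 0"
  using real_J_group_columns(1,2)[OF assms] real_J_group_rows[OF assms]
    zero_le_square[of "A$2$1"] zero_le_square[of "A$2$3"] zero_le_square[of "A$1$2"]
    zero_le_square[of "A$3$2"] by linarith+

text \<open>The four corner entries are coupled in a cycle by products of sign at most 0. The
  coupling can fail to fix all signs only where an entry vanishes; if \<open>A$3$1\<close> or
  \<open>A$1$1\<close> is zero, the relations between the columns make the product of the opposite
  pair of corners equal to 1.\<close>

lemma time_sign_cases:
  assumes "A \<in> real_J_group"
  shows "0 \<le> A$1$1 \<and> 0 \<le> A$3$3 \<and> A$1$3 \<le> 0 \<and> A$3$1 \<le> 0 \<and> time_sign A < 0 \<or>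
    A$1$1 \<le> 0 \<and> A$3$3 \<le> 0 \<and> 0 \<le> A$1$3 \<and> 0 \<le> A$3$1 \<and> 0 < time_sign A"
proof -
  let ?a = "A$1$1" and ?c = "A$1$3" and ?g = "A$3$1" and ?i = "A$3$3" and ?d = "A$2$1"
  note s = real_J_group_signs[OF assms, unfolded mult_le_0_iff]
  note c = real_J_group_columns[OF assms]
  have "?a * ?i = 1" if "?g = 0" using c(1,3) that by simp
  then have g: "?g = 0 \<Longrightarrow> 0 < ?a \<and> 0 < ?i \<or> ?a < 0 \<and> ?i < 0"
    using zero_less_mult_iff[of ?a ?i] by simp
  have "?g * ?c = 1" if "?a = 0" using c(1,3) that by simp
  then have a: "?a = 0 \<Longrightarrow> 0 < ?g \<and> 0 < ?c \<or> ?g < 0 \<and> ?c < 0"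
    using zero_less_mult_iff[of ?g ?c] by simp
  show ?thesis
    unfolding time_sign_def using s a g by linarith
qed

text \<open>The upper left entry must be p * p, so \<open>p\<close> is its square root;
  \<open>q\<close> and \<open>r\<close> are then read off from the neighbouring entries and
  \<open>s\<close> from the determinant. The quadratic relations determine all other entries. A
  negative time sign ensures that the square roots exist.\<close>

lemma sym2_of_time_preserving:
  assumes A: "A \<in> real_J_group" and det: "det A = 1" and neg: "time_sign A < 0"
  obtains p q r s where "p * s - q * r = 1" "A = sym2 p q r s"
proof -
  define a b c d e f g h i where abc: "a = A$1$1" "b = A$1$2" "c = A$1$3"
    "d = A$2$1" "e = A$2$2" "f = A$2$3" "g = A$3$1" "h = A$3$2" "i = A$3$3"
  have sg: "0 \<le> a" "0 \<le> i" "c \<le> 0" "g \<le> 0"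
    using time_sign_cases[OF A] neg unfolding abc by auto
  \<comment> \<open>Two expressions for the inverse are compared: the adjugate and
    \<open>J ** transpose A ** J\<close>.\<close>
  have m: "a = a * e - b * d" "b = c * d - a * f" "d = b * g - a * h" "e = a * i - c * g"
    using adjugate_3[OF real_J_group_inverse[OF A] det]
    by (simp_all add: J_conj_nth transpose_def abc)
  have col: "2 * (a * g) + d * d = 0" "2 * (c * i) + f * f = 0" "a * i + d * f + g * c = 1"
    "b * i + e * f + h * c = 0"
    using real_J_group_columns[OF A] by (simp_all add: abc)
  have row: "2 * (a * c) + b * b = 0"
    using real_J_group_rows[OF A] by (simp_all add: abc)
  have eq: "A = sym2 p q r s"
    if "a = p * p" "b = sqrt 2 * p * q" "c = - (q * q)" "d = sqrt 2 * p * r" "e = p * s + q * r"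
      "f = - (sqrt 2 * q * s)" "g = - (r * r)" "h = - (sqrt 2 * r * s)" "i = s * s" for p q r s
    using that by (simp add: vec_eq_iff forall_3 abc)
  show thesis
  proof (cases "a = 0")
    case True
    then have z: "b = 0" "d = 0" using row col(1) by auto
    then have gc: "g * c = 1" using col(3) True by simp
    then have c: "c < 0" using sg by (cases "c = 0") auto
    \<comment> \<open>Now \<open>p = 0\<close>, so the corner \<open>c\<close> has to supply
      \<open>q\<close>, and the determinant makes the third parameter
      \<open>- 1 / q\<close>.\<close>
    define q where "q = sqrt (- c)"
    have q: "q > 0" "c = - (q * q)" using c by (auto simp: q_def)
    define s where "s = - f / (sqrt 2 * q)"
    have f: "f = - (sqrt 2 * q * s)" using q by (simp add: s_def)
    have gg: "g = - ((- 1 / q) * (- 1 / q))" using gc q by (simp add: field_simps)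
    have "q * q * i = q * q * (s * s)" using col(2) q f by (simp add: algebra_simps)
    then have i: "i = s * s" using q by simp
    have e: "e = - 1" using m(4) True gc by (simp add: mult.commute)
    have "q * q * h = q * q * (sqrt 2 * s / q)" using col(4) z e f q by (simp add: algebra_simps)
    then have h: "h = sqrt 2 * s / q" using q(1) by (simp add: field_simps)
    have "A = sym2 0 q (- 1 / q) s"
      by (rule eq) (use True z q f gg i e h in auto)
    then show thesis using that[of 0 s q "- 1 / q"] q by auto
  next
    case False
    define p where "p = sqrt a"
    have p: "p > 0" "a = p * p" using False sg by (auto simp: p_def)
    have cancel: "x = y" if "p * p * x = p * p * y" for x y
      using that p(1) by simp
    define q where "q = b / (sqrt 2 * p)"
    define r where "r = d / (sqrt 2 * p)"
    define s where "s = (1 + q * r) / p"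
    have b: "b = sqrt 2 * p * q" and d: "d = sqrt 2 * p * r" using p by (simp_all add: q_def r_def)
    have ps: "p * s = 1 + q * r" using p by (simp add: s_def)
    have "p * p * c = p * p * (- (q * q))" using row p b by (simp add: algebra_simps)
    then have c: "c = - (q * q)" by (rule cancel)
    have "p * p * g = p * p * (- (r * r))" using col(1) p d by (simp add: algebra_simps)
    then have g: "g = - (r * r)" by (rule cancel)
    have "p * p * e = p * p * (1 + 2 * (q * r))" using m(1) p b d by (simp add: algebra_simps)
    then have e: "e = 1 + 2 * (q * r)" by (rule cancel)
    have "p * p * f = p * (- (sqrt 2 * q * (1 + q * r)))"
      using m(2) p b c d by (simp add: algebra_simps)
    also have "\<dots> = p * p * (- (sqrt 2 * q * s))" unfolding ps[symmetric] by simp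
    finally have f: "f = - (sqrt 2 * q * s)" by (rule cancel)
    have "p * p * h = p * (- (sqrt 2 * r * (1 + q * r)))"
      using m(3) p b g d by (simp add: algebra_simps)
    also have "\<dots> = p * p * (- (sqrt 2 * r * s))" unfolding ps[symmetric] by simp
    finally have h: "h = - (sqrt 2 * r * s)" by (rule cancel)
    have "p * p * i = (1 + q * r) * (1 + q * r)"
      using m(4) p e c g by (simp add: algebra_simps)
    also have "\<dots> = p * p * (s * s)" unfolding ps[symmetric] by simp
    finally have i: "i = s * s" by (rule cancel)
    have "A = sym2 p q r s"
      by (rule eq) (use p b c d e f g h i ps in auto)
    then show thesis using that[of p s q r] ps by auto
  qed
qed

lemma connected_same_sign:
  fixes f :: "'b::topological_space \<Rightarrow> real"
  assumes "connected C" "continuous_on C f" "\<And>x. x \<in> C \<Longrightarrow> f x \<noteq> 0" "a \<in> C" "b \<in> C" "f a < 0"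
  shows "f b < 0"
proof (rule ccontr)
  assume "\<not> f b < 0"
  then have "0 \<in> {f a..f b}" using assms(6) by auto
  moreover have "connected (f ` C)" using assms connected_continuous_image by blast
  ultimately have "0 \<in> f ` C" using assms connected_contains_Icc[of "f ` C" "f a" "f b"] by blast
  then show False using assms(3) by force
qed

text \<open>The determinant and the time sign are continuous and vanish nowhere on the real group,
  so on the identity component both keep the sign that they have at the identity.\<close>

lemma PO21_sym2:
  assumes "X \<in> PO21"
  obtains p q r s where "p * s - q * r = 1" "X = pu_class (complexify (sym2 p q r s))"
proof -
  let ?C = "connected_component_set real_J_group (mat 1)"
  obtain A where A: "A \<in> ?C" "X = pu_class (complexify A)" using assms by (auto simp: PO21_def)
  have C: "?C \<subseteq> real_J_group" by (rule connected_component_subset)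
  then have AG: "A \<in> real_J_group" using A(1) by blast
  have one: "mat 1 \<in> ?C"
    by (simp add: connected_component_refl_eq) (simp add: real_J_group_def transpose_mat)
  have det2: "det B * det B = 1" if "B \<in> real_J_group" for B
  proof -
    have "det (transpose B ** J ** B) = det (J :: real^3^3)" using that by (simp add: real_J_group_def)
    then show ?thesis by (simp add: det_mul det_J)
  qed
  have "continuous_on ?C (\<lambda>B. - det B)"
    unfolding det_3 by (intro continuous_intros)
  then have "- det A < 0"
  proof (rule connected_same_sign[rotated])
    show "- det B \<noteq> 0" if "B \<in> ?C" for B
      using det2[of B] that C by auto
    show "- det (mat 1 :: real^3^3) < 0" by simp
  qed (use A one in auto)
  moreover have "det A = 1 \<or> det A = -1"
    using det2[OF AG] by (simp add: square_eq_1_iff)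
  ultimately have det: "det A = 1" by auto
  have "continuous_on ?C time_sign"
    unfolding time_sign_def by (intro continuous_intros)
  then have "time_sign A < 0"
  proof (rule connected_same_sign[rotated])
    show "time_sign B \<noteq> 0" if "B \<in> ?C" for B
      using time_sign_cases[of B] that C by force
    show "time_sign (mat 1) < 0" by (simp add: time_sign_def mat_def)
  qed (use A one in auto)
  then obtain p q r s where "p * s - q * r = 1" "A = sym2 p q r s"
    by (rule sym2_of_time_preserving[OF AG det])
  then show thesis using that A(2) by blast
qed

section \<open>Traces and eigenvalues of symmetric squares\<close>

lemma abs_trace_sym2: "abs_trace (pu_class (complexify (sym2 p q r s))) = \<bar>p * p + (p * s + q * r) + s * s\<bar>"
proof -
  have "trace (complexify (sym2 p q r s)) = of_real (p * p + (p * s + q * r) + s * s)"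
    by (simp add: trace_def sum_3)
  then show ?thesis by (simp only: abs_trace_pu_class norm_of_real)
qed

text \<open>The eigenvalues of a symmetric square are the determinant and the squares of the
  eigenvalues of the 2-by-2 matrix, which have sum (p + s)^2 - 2 D and product D^2. Keeping
  \<open>D\<close> general makes this an identity of polynomials.\<close>

lemma det_sym2_char:
  fixes p q r s :: real
  defines "D \<equiv> complex_of_real (p * s - q * r)"
  shows "det (mat x - complexify (sym2 p q r s)) =
    (x - D) * (x * x - (of_real ((p + s) * (p + s)) - 2 * D) * x + D * D)"
proof -
  have sq: "complex_of_real (sqrt 2) * complex_of_real (sqrt 2) = 2"
    by (simp flip: of_real_mult)
  have sqc: "complex_of_real (sqrt 2) * (complex_of_real (sqrt 2) * y) = 2 * y" for y
    using sq by (simp flip: mult.assoc)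
  show ?thesis
    unfolding det_3 D_def by (simp add: mat_def algebra_simps sqc sq)
qed

text \<open>When |p + s| is at least 2, the 2-by-2 matrix has real eigenvalues, so those of its
  symmetric square are 1, \<open>l\<close> and \<open>1 / l\<close> with real \<open>l\<close> at
  least 1. All are positive, and nothing cancels in the trace.\<close>

lemma abs_trace_spec_radius_sym2:
  assumes D: "p * s - q * r = 1" and t: "2 \<le> \<bar>p + s\<bar>"
  defines "A \<equiv> complexify (sym2 p q r s)"
  shows "abs_trace (pu_class A) = spec_radius A + 1 / spec_radius A + 1"
proof -
  \<comment> \<open>The root of the discriminant of the 2-by-2 characteristic polynomial; with |p +
    s| as its factor below, \<open>l\<close> is the larger of the two squared eigenvalues.\<close>
  define w where "w = sqrt ((p + s) * (p + s) - 4)"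
  have "4 \<le> (p + s) * (p + s)" using mult_mono[OF t t] by (simp flip: abs_mult)
  then have w: "w * w = (p + s) * (p + s) - 4" "0 \<le> w" by (simp_all add: w_def)
  define l where "l = ((p + s) * (p + s) - 2 + \<bar>p + s\<bar> * w) / 2"
  define l' where "l' = ((p + s) * (p + s) - 2 - \<bar>p + s\<bar> * w) / 2"
  define T m where Tm: "T = (p + s) * (p + s)" "m = \<bar>p + s\<bar> * w"
  have abs2: "\<bar>p + s\<bar> * w * (\<bar>p + s\<bar> * w) = (p + s) * (p + s) * (w * w)"
  proof -
    have "\<bar>x\<bar> * w * (\<bar>x\<bar> * w) = \<bar>x\<bar> * \<bar>x\<bar> * (w * w)" for x :: real by (simp only: mult_ac)
    then show ?thesis by (simp only: abs_mult_self_eq)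
  qed
  have sum: "l + l' = (p + s) * (p + s) - 2" by (simp add: l_def l'_def field_simps)
  have m: "m * m = T * (T - 4)" unfolding Tm abs2 w ..
  have "4 * (l * l') = (T - 2) * (T - 2) - m * m"
    unfolding l_def l'_def Tm[symmetric] by (simp add: field_simps)
  also have "\<dots> = 4" unfolding m by (simp add: algebra_simps)
  finally have prod: "l * l' = 1" by simp
  have "0 \<le> m" unfolding Tm using w(2) by simp
  moreover have "4 \<le> T" unfolding Tm by fact
  ultimately have "2 \<le> T - 2 + m" by simp
  then have l1: "1 \<le> l"
    unfolding l_def Tm[symmetric] by simp
  then have l': "l' = 1 / l" using prod by (simp add: field_simps)
  have "det (mat x - A) = (x - 1) * (x - of_real l) * (x - of_real l')" for x
  proof -
    have "(x - of_real l) * (x - of_real l') = x * x - of_real (l + l') * x + of_real (l * l')"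
      by (simp add: algebra_simps)
    then show ?thesis
      unfolding A_def det_sym2_char D sum prod by simp
  qed
  then have ev: "eigenvalues A = {1, of_real l, of_real l'}" by (rule eigenvalues_roots)
  have "1 / l \<le> l" using l1 by (meson divide_le_eq_1 order_trans zero_less_one less_le_trans)
  then have "spec_radius A = l"
    using l1 by (simp add: spec_radius_def ev l' norm_divide)
  moreover have "p * p + (p * s + q * r) + s * s = (p + s) * (p + s) - (p * s - q * r)"
    by (simp add: algebra_simps)
  then have "abs_trace (pu_class A) = \<bar>l + l' + 1\<bar>"
    unfolding A_def abs_trace_sym2 D sum by simp
  ultimately show ?thesis using l1 l' by simp
qed

subsection \<open>Elliptic elements of discrete groups\<close>

text \<open>The symmetric square of cos \<phi> + K sin \<phi>, where K has rows (a, b) and (c, -a).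
  The condition a * a + b * c = -1 says that K squares to -1, so this is the one-parameter group
  generated by K.\<close>

definition rotation :: "real \<Rightarrow> real \<Rightarrow> real \<Rightarrow> real \<Rightarrow> real^3^3" where
  "rotation a b c \<phi> = sym2 (cos \<phi> + a * sin \<phi>) (b * sin \<phi>) (c * sin \<phi>) (cos \<phi> - a * sin \<phi>)"

lemma rotation_mult:
  assumes "a * a + b * c = -1"
  shows "rotation a b c \<phi> ** rotation a b c \<psi> = rotation a b c (\<phi> + \<psi>)"
proof -
  have bc: "b * c = -1 - a * a" using assms by simp
  have bcx: "b * (c * x) = - x - a * (a * x)" for x
    unfolding mult.assoc[symmetric] bc by (simp add: algebra_simps)
  let ?c = "cos \<phi>" and ?s = "sin \<phi>" and ?c' = "cos \<psi>" and ?s' = "sin \<psi>"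
  have e: "(?c + a * ?s) * (?c' + a * ?s') + b * ?s * (c * ?s') = cos (\<phi> + \<psi>) + a * sin (\<phi> + \<psi>)"
    "(?c + a * ?s) * (b * ?s') + b * ?s * (?c' - a * ?s') = b * sin (\<phi> + \<psi>)"
    "c * ?s * (?c' + a * ?s') + (?c - a * ?s) * (c * ?s') = c * sin (\<phi> + \<psi>)"
    "c * ?s * (b * ?s') + (?c - a * ?s) * (?c' - a * ?s') = cos (\<phi> + \<psi>) - a * sin (\<phi> + \<psi>)"
    by (simp_all add: cos_add sin_add algebra_simps bcx)
  show ?thesis
    unfolding rotation_def sym2_mult e ..
qed

lemma rotation_in_real_J_group:
  assumes "a * a + b * c = -1"
  shows "rotation a b c \<phi> \<in> real_J_group"
  unfolding rotation_def
proof (rule sym2_in_real_J_group)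
  have "(cos \<phi> + a * sin \<phi>) * (cos \<phi> - a * sin \<phi>) - b * sin \<phi> * (c * sin \<phi>) =
      (cos \<phi>)\<^sup>2 - (a * a + b * c) * (sin \<phi>)\<^sup>2"
    by (simp add: algebra_simps power2_eq_square)
  then show "(cos \<phi> + a * sin \<phi>) * (cos \<phi> - a * sin \<phi>) - b * sin \<phi> * (c * sin \<phi>) = 1"
    using assms by simp
qed

text \<open>The angle has half the trace as its cosine. Subtracting the cosine from the 2-by-2
  matrix and dividing by the sine leaves a matrix of trace 0 and determinant 1, which squares to
  -1.\<close>

lemma sym2_elliptic_rotation:
  assumes D: "p * s - q * r = 1" and t: "\<bar>p + s\<bar> < 2"
  obtains a b c \<phi> where "a * a + b * c = -1" "sym2 p q r s = rotation a b c \<phi>"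
proof -
  define \<phi> where "\<phi> = arccos ((p + s) / 2)"
  have c: "cos \<phi> = (p + s) / 2" using t by (simp add: \<phi>_def)
  have "\<bar>(p + s) / 2\<bar> < 1" using t by simp
  then have "((p + s) / 2)\<^sup>2 < 1" by (simp only: abs_square_less_1)
  then have S: "(sin \<phi>)\<^sup>2 > 0" by (simp add: sin_squared_eq c)
  then have s0: "sin \<phi> \<noteq> 0" by auto
  let ?a = "(p - s) / (2 * sin \<phi>)" and ?b = "q / sin \<phi>" and ?c = "r / sin \<phi>"
  have "?a * ?a + ?b * ?c = ((p - s) * (p - s) / 4 + q * r) / (sin \<phi>)\<^sup>2"
    using s0 by (simp add: field_simps power2_eq_square)
  also have "(p - s) * (p - s) / 4 + q * r = ((p + s) / 2)\<^sup>2 - (p * s - q * r)"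
    by (simp add: field_simps power2_eq_square)
  also have "\<dots> = - (sin \<phi>)\<^sup>2" using D by (simp add: sin_squared_eq c)
  finally have "?a * ?a + ?b * ?c = -1" using S by simp
  moreover have "sym2 p q r s = rotation ?a ?b ?c \<phi>"
    unfolding rotation_def c using s0 by (simp add: field_simps)
  ultimately show thesis by (rule that)
qed

text \<open>By Dirichlet approximation of \<phi> / (2 pi), some positive multiple of the angle is as
  close as desired to a full number of turns. Rational and irrational angles are treated
  alike.\<close>

lemma rotation_multiple_near_identity:
  assumes "open U" "mat 1 \<in> U"
  obtains n where "n > 0" "complexify (rotation a b c (real n * \<phi>)) \<in> U"
proof -
  let ?f = "\<lambda>x. complexify (rotation a b c x)"
  have "\<forall>i j. continuous_on UNIV (\<lambda>x. rotation a b c x $ i $ j)"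
    unfolding forall_3 rotation_def sym2_nth by (intro conjI continuous_intros)
  then have "continuous_on UNIV ?f"
    unfolding complexify_def by (intro continuous_on_vec_lambda continuous_on_of_real) blast
  then have "open (?f -` U)" using assms(1) by (rule open_vimage[rotated])
  moreover have "?f 0 = mat 1"
    by (simp add: rotation_def vec_eq_iff forall_3 mat_def)
  then have "0 \<in> ?f -` U" using assms(2) by simp
  ultimately obtain e where e: "e > 0" "ball 0 e \<subseteq> ?f -` U"
    using openE by blast
  \<comment> \<open>The approximation error 1 / N, scaled by a full turn, must stay below the radius
    \<open>e\<close> on which the rotations remain in \<open>U\<close>.\<close>
  obtain N :: nat where Ne: "2 * pi / e < N" using reals_Archimedean2 by blast
  moreover have "0 < 2 * pi / e" using e(1) by simp
  ultimately have "0 < real N" by linarith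
  then have N: "2 * pi / N < e" "N > 0"
    using e(1) Ne by (auto simp: field_simps)
  obtain h k where hk: "0 < k" "\<bar>of_int k * (\<phi> / (2 * pi)) - of_int h\<bar> < 1 / N"
    using Dirichlet_approx[OF N(2)] by metis
  define y where "y = of_int k * \<phi> - 2 * pi * of_int h"
  have "\<bar>y\<bar> = 2 * pi * \<bar>of_int k * (\<phi> / (2 * pi)) - of_int h\<bar>"
    unfolding y_def by (simp add: abs_mult flip: abs_mult_pos) (simp add: field_simps)
  also have "\<dots> < 2 * pi * (1 / N)" using hk(2) by (intro mult_strict_left_mono) auto
  finally have "y \<in> ball 0 e" using N by simp
  then have "?f y \<in> U" using e by blast
  moreover have "rotation a b c y = rotation a b c (of_int k * \<phi>)"
    unfolding rotation_def y_def cos_diff sin_diff by simp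
  moreover have "real (nat k) = of_int k" using hk(1) by simp
  ultimately show thesis using that[of "nat k"] hk(1) by simp
qed

text \<open>Some power of the elliptic value lies in a neighbourhood of the identity that meets the
  image in the identity only. That power is then trivial, and injectivity carries this back to
  \<gamma>.\<close>

lemma discrete_faithful_elliptic_torsion:
  assumes G: "group G" and \<rho>: "\<rho> \<in> hom G PU21" and inj: "inj_on \<rho> (carrier G)"
    and disc: "subtopology PU21_topology (\<rho> ` carrier G) = discrete_topology (\<rho> ` carrier G)"
    and \<gamma>: "\<gamma> \<in> carrier G" and abc: "a * a + b * c = -1"
    and eq: "\<rho> \<gamma> = pu_class (complexify (rotation a b c \<phi>))"
  obtains n :: nat where "n > 0" "\<gamma> [^]\<^bsub>G\<^esub> n = \<one>\<^bsub>G\<^esub>"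
proof -
  interpret group_hom G PU21 \<rho>
    using G group_PU21 \<rho> by (simp add: group_hom_def group_hom_axioms_def)
  interpret U: group_hom U21 PU21 pu_class
    using group_U21 group_PU21 pu_class_hom by (simp add: group_hom_def group_hom_axioms_def)
  have carr: "complexify (rotation a b c \<psi>) \<in> carrier U21" for \<psi>
    by (intro complexify_in_U21 rotation_in_real_J_group abc)
  have one: "\<one>\<^bsub>PU21\<^esub> \<in> \<rho> ` carrier G" by (metis G.one_closed hom_one image_eqI)
  then have "openin (subtopology PU21_topology (\<rho> ` carrier G)) {\<one>\<^bsub>PU21\<^esub>}"
    by (simp add: disc)
  then obtain \<U> where \<U>: "openin PU21_topology \<U>" "\<U> \<inter> \<rho> ` carrier G = {\<one>\<^bsub>PU21\<^esub>}"
    unfolding openin_subtopology by metis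
  \<comment> \<open>By the definition of the quotient topology the isolating set pulls back to an
    open set of matrices, where the approximation takes place.\<close>
  then obtain V where V: "open V" "{A \<in> carrier U21. pu_class A \<in> \<U>} = carrier U21 \<inter> V"
    unfolding openin_PU21_topology openin_open by auto
  have "mat 1 \<in> carrier U21" using group.is_monoid[OF group_U21] monoid.one_closed by fastforce
  moreover have "pu_class (mat 1) \<in> \<U>" using \<U>(2) one_PU21 by auto
  ultimately have "mat 1 \<in> V" using V(2) by blast
  then obtain n where n: "n > 0" "complexify (rotation a b c (real n * \<phi>)) \<in> V"
    using rotation_multiple_near_identity[OF V(1)] by blast
  have pow: "\<rho> (\<gamma> [^]\<^bsub>G\<^esub> k) = pu_class (complexify (rotation a b c (real k * \<phi>)))" for k :: nat
  proof (induction k)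
    case 0
    have "rotation a b c 0 = mat 1"
      by (simp add: rotation_def vec_eq_iff forall_3 mat_def)
    then show ?case by (simp add: one_PU21 complexify_mat_1)
  next
    case (Suc k)
    have "\<rho> (\<gamma> [^]\<^bsub>G\<^esub> Suc k) = \<rho> (\<gamma> [^]\<^bsub>G\<^esub> k) \<otimes>\<^bsub>PU21\<^esub> \<rho> \<gamma>"
      using \<gamma> by simp
    also have "\<dots> = pu_class (complexify (rotation a b c (real k * \<phi>)) ** complexify (rotation a b c \<phi>))"
      unfolding Suc.IH eq using U.hom_mult[OF carr carr] by simp
    also have "\<dots> = pu_class (complexify (rotation a b c (real (Suc k) * \<phi>)))"
      by (simp add: rotation_mult[OF abc] algebra_simps flip: complexify_mult)
    finally show ?case .
  qed
  have "\<rho> (\<gamma> [^]\<^bsub>G\<^esub> n) \<in> \<U>"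
    unfolding pow using n V(2) carr by blast
  then have "\<rho> (\<gamma> [^]\<^bsub>G\<^esub> n) = \<rho> \<one>\<^bsub>G\<^esub>" using \<U>(2) \<gamma> by auto
  then have "\<gamma> [^]\<^bsub>G\<^esub> n = \<one>\<^bsub>G\<^esub>" using inj_onD[OF inj] \<gamma> by blast
  with n(1) show thesis by (rule that)
qed

text \<open>The torsion-freeness hypothesis disposes of the elliptic elements, for which the inequality
  between traces would not follow from that between lengths.\<close>

lemma abs_trace_le_of_bergman_length_le:
  assumes G: "group G" and \<rho>: "\<rho> \<in> hom G PU21" and \<rho>0: "\<rho>0 \<in> hom G PU21"
    and inj: "inj_on \<rho>0 (carrier G)" and PO: "\<rho>0 ` carrier G \<subseteq> PO21"
    and disc: "subtopology PU21_topology (\<rho>0 ` carrier G) = discrete_topology (\<rho>0 ` carrier G)"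
    and torsion_free: "\<And>x n. x \<in> carrier G \<Longrightarrow> n > 0 \<Longrightarrow> x [^]\<^bsub>G\<^esub> (n::nat) = \<one>\<^bsub>G\<^esub> \<Longrightarrow> x = \<one>\<^bsub>G\<^esub>"
    and \<gamma>: "\<gamma> \<in> carrier G" and le: "bergman_length (\<rho> \<gamma>) \<le> bergman_length (\<rho>0 \<gamma>)"
  shows "abs_trace (\<rho> \<gamma>) \<le> abs_trace (\<rho>0 \<gamma>)"
proof -
  have "\<rho>0 \<gamma> \<in> PO21" using PO \<gamma> by blast
  then obtain p q r s where D: "p * s - q * r = 1" and eq: "\<rho>0 \<gamma> = pu_class (complexify (sym2 p q r s))"
    by (rule PO21_sym2)
  show ?thesis
  proof (cases "\<bar>p + s\<bar> < 2")
    case True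
    then obtain a b c \<phi> where abc: "a * a + b * c = -1" "sym2 p q r s = rotation a b c \<phi>"
      by (rule sym2_elliptic_rotation[OF D])
    obtain n :: nat where "n > 0" "\<gamma> [^]\<^bsub>G\<^esub> n = \<one>\<^bsub>G\<^esub>"
      by (rule discrete_faithful_elliptic_torsion[OF G \<rho>0 inj disc \<gamma> abc(1)])
        (use eq abc(2) in simp)
    then have "\<gamma> = \<one>\<^bsub>G\<^esub>" using torsion_free \<gamma> by blast
    then show ?thesis using hom_one[OF \<rho> G group_PU21] hom_one[OF \<rho>0 G group_PU21] by simp
  next
    case False
    let ?A = "pu_lift (\<rho> \<gamma>)" and ?B = "complexify (sym2 p q r s)"
    have A: "?A \<in> carrier U21"
      using \<rho> \<gamma> by (intro pu_lift_in_U21) (auto simp: hom_def)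
    have B: "?B \<in> carrier U21" by (intro complexify_in_U21 sym2_in_real_J_group D)
    note a = trace_le_spec_radius_U21[OF A] and b = trace_le_spec_radius_U21[OF B]
    have "ln (spec_radius ?A) \<le> ln (spec_radius ?B)"
      using le by (simp add: bergman_length_def eq spec_radius_pu_lift)
    then have "spec_radius ?A \<le> spec_radius ?B" using a(2) b(2) by simp
    then have "spec_radius ?A + 1 / spec_radius ?A \<le> spec_radius ?B + 1 / spec_radius ?B"
      by (rule add_inverse_mono[OF a(2)])
    then show ?thesis
      using a(1) abs_trace_spec_radius_sym2[OF D] False by (simp add: abs_trace_def[of "\<rho> \<gamma>"] eq)
  qed
qed

section \<open>Fundamental groups\<close>

subsection \<open>Crossings of the boundary of a square\<close>

text \<open>The difference of two lifts is continuous with values in the even integers. In this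
  normalization the value -1 corresponds to the odd integers.\<close>

lemma cis_pi_lifts_diff_const:
  fixes w g :: "'b::real_normed_vector \<Rightarrow> real"
  assumes "connected Z" "continuous_on Z w" "continuous_on Z g"
    and eq: "\<And>z. z \<in> Z \<Longrightarrow> cis (pi * w z) = cis (pi * g z)"
    and "a \<in> Z" "b \<in> Z"
  shows "w a - g a = w b - g b"
proof -
  have int: "\<exists>n::int. w z - g z = 2 * real_of_int n" if "z \<in> Z" for z
  proof -
    have "cis (pi * w z - pi * g z) = 1"
      using eq[OF that] by (simp flip: cis_divide)
    then have "cos (pi * w z - pi * g z) = 1"
      by (metis cis.sel(1) one_complex.sel(1))
    then obtain n :: int where "pi * w z - pi * g z = real_of_int n * 2 * pi"
      using cos_one_2pi_int by blast
    then have "pi * (w z - g z) = pi * (2 * real_of_int n)"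
      by (simp add: algebra_simps)
    then show ?thesis by auto
  qed
  have "(\<lambda>z. w z - g z) constant_on Z"
  proof (rule continuous_discrete_range_constant)
    show "continuous_on Z (\<lambda>z. w z - g z)"
      using assms by (intro continuous_intros)
    fix x assume x: "x \<in> Z"
    obtain n :: int where n: "w x - g x = 2 * real_of_int n" using int[OF x] by blast
    have "1 \<le> norm ((w y - g y) - (w x - g x))"
      if y: "y \<in> Z" "w y - g y \<noteq> w x - g x" for y
    proof -
      obtain m :: int where m: "w y - g y = 2 * real_of_int m" using int[OF y(1)] by blast
      then have "m \<noteq> n" using n y(2) by auto
      then have "1 \<le> \<bar>m - n\<bar>" by linarith
      then have "1 \<le> \<bar>real_of_int m - real_of_int n\<bar>" by linarith
      then show ?thesis using m n by simp
    qed
    then show "\<exists>e>0. \<forall>y. y \<in> Z \<and> w y - g y \<noteq> w x - g x \<longrightarrow> e \<le> norm ((w y - g y) - (w x - g x))"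
      by (intro exI[of _ 1]) auto
  qed (use assms in auto)
  then show ?thesis using assms unfolding constant_on_def by metis
qed

text \<open>A nowhere vanishing function on a contractible set has a continuous logarithm; modulus
  one makes it purely imaginary.\<close>

lemma unit_circle_lift_square:
  fixes v :: "real \<times> real \<Rightarrow> complex"
  assumes "continuous_on ({0..1} \<times> {0..1}) v"
    and "\<And>z. z \<in> {0..1} \<times> {0..1} \<Longrightarrow> cmod (v z) = 1"
  obtains w where "continuous_on ({0..1} \<times> {0..1}) w"
    "\<And>z. z \<in> {0..1} \<times> {0..1} \<Longrightarrow> v z = cis (pi * w z)"
proof -
  have "contractible ({0..1::real} \<times> {0..1::real})"
    by (intro convex_imp_contractible convex_Times) auto
  then obtain l where l: "continuous_on ({0..1} \<times> {0..1}) l"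
      "\<And>z. z \<in> {0..1} \<times> {0..1} \<Longrightarrow> v z = exp (l z)"
    using continuous_logarithm_on_contractible[OF assms(1)] assms(2)
    by (metis norm_zero zero_neq_one)
  show thesis
  proof
    show "continuous_on ({0..1} \<times> {0..1}) (\<lambda>z. Im (l z) / pi)"
      using l(1) by (intro continuous_intros) auto
    fix z assume z: "z \<in> {0..1::real} \<times> {0..1::real}"
    have "Re (l z) = 0"
      using assms(2)[OF z] l(2)[OF z] by simp
    then show "v z = cis (pi * (Im (l z) / pi))"
      using l(2)[OF z] by (simp add: exp_eq_polar)
  qed
qed

text \<open>Local connectedness makes the component open in \<open>Q\<close>. It is also closed in
  the set where \<open>f\<close> differs from \<open>a\<close>, so \<open>f\<close> takes the value
  \<open>a\<close> at its boundary points, and the two definitions match there.\<close>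

lemma component_cut_continuous:
  fixes f :: "real \<times> real \<Rightarrow> complex"
  assumes cont: "continuous_on Q f" and Q: "locally connected Q"
    and C: "C = connected_component_set {z \<in> Q. f z \<noteq> a} p"
  shows "continuous_on Q (\<lambda>z. if z \<in> C then f z else a)"
proof -
  let ?O = "{z \<in> Q. f z \<noteq> a}"
  have O: "openin (top_of_set Q) ?O"
    using continuous_openin_preimage_gen[OF cont, of "- {a}"]
    by (auto simp: vimage_def Int_def conj_commute)
  have CO: "C \<subseteq> ?O" using C connected_component_subset by blast
  have "openin (top_of_set ?O) C"
    unfolding C using Q O locally_open_subset openin_connected_component_locally_connected by blast
  then have Copen: "openin (top_of_set Q) C"
    using O openin_trans by blast
  have Cclosed: "closedin (top_of_set ?O) C"
    unfolding C by (rule closedin_connected_component)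
  have bd: "f z = a" if "z \<in> Q" "z \<in> closure C" "z \<notin> C" for z
  proof (rule ccontr)
    assume "f z \<noteq> a"
    then have "z \<in> ?O" using that by simp
    then have "z \<in> C" using Cclosed that(2)
      by (metis (no_types, lifting) Int_iff closedin_closed closure_minimal inf.cobounded2 subset_iff)
    then show False using that by simp
  qed
  have "continuous_on ((Q \<inter> closure C) \<union> (Q - C)) (\<lambda>z. if z \<in> C then f z else a)"
  proof (rule continuous_on_cases_local)
    have Q': "Q \<inter> closure C \<union> (Q - C) = Q"
      using closure_subset by blast
    show "closedin (top_of_set (Q \<inter> closure C \<union> (Q - C))) (Q \<inter> closure C)"
      unfolding Q' by (simp add: closedin_closed_Int)
    show "closedin (top_of_set (Q \<inter> closure C \<union> (Q - C))) (Q - C)"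
      unfolding Q' using Copen by (simp add: closedin_diff)
    show "continuous_on (Q \<inter> closure C) f"
      using cont continuous_on_subset by blast
  qed (use bd in auto)
  moreover have "(Q \<inter> closure C) \<union> (Q - C) = Q"
    using closure_subset by blast
  ultimately show ?thesis by simp
qed

lemma increasing_upto_mono:
  fixes t :: "nat \<Rightarrow> real"
  assumes "\<And>i. i < m \<Longrightarrow> t i < t (Suc i)" and "i \<le> j" "j \<le> m"
  shows "t i \<le> t j"
  using assms(2,3)
proof (induction j)
  case (Suc j)
  then show ?case using assms(1)[of j] by (cases "i = Suc j") force+
qed simp

text \<open>The innermost-pair argument: among the crossings of the boundary path with preimages of
  edge neighbourhoods, a pair lying in a common component at minimal distance must be adjacent,
  because the component crossed just after the first of the two would otherwise separate them.\<close>

lemma nullhomotopic_adjacent_crossings: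
  fixes h :: "real \<times> real \<Rightarrow> 'a::topological_space" and u :: "'e \<Rightarrow> 'a \<Rightarrow> complex"
    and E :: "nat \<Rightarrow> 'e" and t :: "nat \<Rightarrow> real" and g :: "nat \<Rightarrow> real \<Rightarrow> real"
  assumes h: "continuous_on ({0..1} \<times> {0..1}) h" "h \<in> {0..1} \<times> {0..1} \<rightarrow> S"
    and u: "\<And>e. e \<in> \<E> \<Longrightarrow> continuous_on S (u e)" "\<And>e x. e \<in> \<E> \<Longrightarrow> x \<in> S \<Longrightarrow> cmod (u e x) = 1"
    and disj: "\<And>e e' x. e \<in> \<E> \<Longrightarrow> e' \<in> \<E> \<Longrightarrow> x \<in> S \<Longrightarrow> u e x \<noteq> -1 \<Longrightarrow> u e' x \<noteq> -1 \<Longrightarrow> e = e'"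
    and E: "\<And>i. i < m \<Longrightarrow> E i \<in> \<E>"
    and t: "t 0 = 0" "\<And>i. i < m \<Longrightarrow> t i < t (Suc i)" "t m \<le> 1"
    and g: "\<And>i. i < m \<Longrightarrow> continuous_on {t i..t (Suc i)} (g i)"
      "\<And>i s. i < m \<Longrightarrow> s \<in> {t i..t (Suc i)} \<Longrightarrow> u (E i) (h (0, s)) = cis (pi * g i s)"
      "\<And>i. i < m \<Longrightarrow> g i (t i) \<noteq> g i (t (Suc i))"
      "\<And>i s. i < m \<Longrightarrow> s \<in> {t i<..<t (Suc i)} \<Longrightarrow> \<bar>g i s\<bar> < 1"
    and vertices: "\<And>i e. i \<le> m \<Longrightarrow> e \<in> \<E> \<Longrightarrow> u e (h (0, t i)) = -1"
    and tail: "\<And>e s. e \<in> \<E> \<Longrightarrow> s \<in> {t m..1} \<Longrightarrow> u e (h (0, s)) = -1"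
    and frame: "\<And>e s. e \<in> \<E> \<Longrightarrow> s \<in> {0..1} \<Longrightarrow> u e (h (1, s)) = -1"
      "\<And>e s. e \<in> \<E> \<Longrightarrow> s \<in> {0..1} \<Longrightarrow> u e (h (s, 0)) = -1"
      "\<And>e s. e \<in> \<E> \<Longrightarrow> s \<in> {0..1} \<Longrightarrow> u e (h (s, 1)) = -1"
    and m: "m > 0"
  shows "\<exists>i. Suc i < m \<and> E i = E (Suc i)"
proof -
  define Q where "Q = {0..1::real} \<times> {0..1::real}"
  note tmono = increasing_upto_mono[of m t, OF t(2)]
  have t01: "0 \<le> t i \<and> t i \<le> 1" if "i \<le> m" for i
    using tmono[of 0 i] tmono[of i m] t that by auto
  define mid where "mid i = (0::real, (t i + t (Suc i)) / 2)" for i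
  \<comment> \<open>The component traversed by the crossing \<open>i\<close>; the function
    \<open>v i\<close> forgets all other components over the same edge.\<close>
  define C where "C i = connected_component_set {z \<in> Q. u (E i) (h z) \<noteq> -1} (mid i)" for i
  define v where "v i z = (if z \<in> C i then u (E i) (h z) else -1)" for i z
  have hS: "h z \<in> S" if "z \<in> Q" for z using h that by (auto simp: Q_def Pi_iff)
  have Q0: "(0, s) \<in> Q" if "s \<in> {t i..t (Suc i)}" "i < m" for i s
    using that t01[of i] t01[of "Suc i"] by (auto simp: Q_def)
  have cis_ne: "cis (pi * r) \<noteq> -1" if "\<bar>r\<bar> < 1" for r
  proof
    assume "cis (pi * r) = -1"
    then have "cos (pi * r) = cos pi" by (metis cis.sel(1) cis_pi cos_pi)
    then have "cos \<bar>pi * r\<bar> = cos pi" by simp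
    moreover have "\<bar>pi * r\<bar> < pi"
      using that by (simp add: abs_mult)
    ultimately show False
      using cos_inj_pi[of "\<bar>pi * r\<bar>" pi] by simp
  qed
  have une: "u (E i) (h (0, s)) \<noteq> -1" if "i < m" "s \<in> {t i<..<t (Suc i)}" for i s
    using g(2)[OF that(1), of s] g(4)[OF that] cis_ne that by auto
  have midC: "mid i \<in> C i" if "i < m" for i
  proof -
    have "mid i \<in> {z \<in> Q. u (E i) (h z) \<noteq> -1}"
      unfolding mid_def using une[OF that] Q0[of _ i] t(2)[OF that] that by auto
    then show ?thesis unfolding C_def
      by (simp add: connected_component_refl_eq)
  qed
  have inC: "(0, s) \<in> C i" if "i < m" "s \<in> {t i<..<t (Suc i)}" for i s
  proof -
    have con: "connected ({0::real} \<times> {t i<..<t (Suc i)})"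
      by (intro connected_Times) auto
    have sub: "{0::real} \<times> {t i<..<t (Suc i)} \<subseteq> {z \<in> Q. u (E i) (h z) \<noteq> -1}"
      using une[OF that(1)] Q0[OF _ that(1)] by auto
    have "mid i \<in> {0::real} \<times> {t i<..<t (Suc i)}"
      using t(2)[OF that(1)] by (auto simp: mid_def)
    from connected_component_maximal[OF this con sub]
    show ?thesis
      unfolding C_def by (rule subsetD) (use that(2) in simp)
  qed
  have CE: "E i = E j" if "i < m" "j < m" "z \<in> C i" "z \<in> C j" for i j z
  proof -
    have "z \<in> Q \<and> u (E i) (h z) \<noteq> -1" "u (E j) (h z) \<noteq> -1"
      using that(3,4) connected_component_subset unfolding C_def by blast+
    then show ?thesis using disj[OF E[OF that(1)] E[OF that(2)] hS] by blast
  qed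
  have Ceq: "C i = C j" if "i < m" "j < m" "z \<in> C i" "z \<in> C j" for i j z
  proof -
    have "C i = connected_component_set {z \<in> Q. u (E i) (h z) \<noteq> -1} z"
      unfolding C_def by (rule connected_component_eq[symmetric]) (use that(3) C_def in simp)
    moreover have "C j = connected_component_set {z \<in> Q. u (E j) (h z) \<noteq> -1} z"
      unfolding C_def by (rule connected_component_eq[symmetric]) (use that(4) C_def in simp)
    ultimately show ?thesis using CE[OF that] by simp
  qed
  have Qlc: "locally connected Q"
    unfolding Q_def by (intro convex_imp_locally_connected convex_Times) auto
  have vcont: "continuous_on Q (v i)" if "i < m" for i
    unfolding v_def
  proof (rule component_cut_continuous[OF _ Qlc])
    show "continuous_on Q (\<lambda>z. u (E i) (h z))"
      using continuous_on_compose2[OF u(1)[OF E[OF that]] h(1)] h(2) unfolding Q_def by blast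
    show "C i = connected_component_set {z \<in> Q. u (E i) (h z) \<noteq> -1} (mid i)"
      by (rule C_def)
  qed
  have vnorm: "cmod (v i z) = 1" if "i < m" "z \<in> Q" for i z
    using u(2)[OF E hS] that by (auto simp: v_def)
  have "\<forall>i. \<exists>w. i < m \<longrightarrow> continuous_on Q w \<and> (\<forall>z\<in>Q. v i z = cis (pi * w z))"
    using unit_circle_lift_square[OF vcont[unfolded Q_def] vnorm[unfolded Q_def]]
    unfolding Q_def by metis
  then obtain w where w: "\<And>i. i < m \<Longrightarrow> continuous_on Q (w i)"
      "\<And>i z. i < m \<Longrightarrow> z \<in> Q \<Longrightarrow> v i z = cis (pi * w i z)"
    by metis
  \<comment> \<open>As -1 is \<open>cis (pi * 1)\<close>, the lift is compared with the constant
    lift 1.\<close>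
  have wconst: "w i a = w i b"
    if "i < m" "connected Z" "Z \<subseteq> Q" "\<And>z. z \<in> Z \<Longrightarrow> v i z = -1" "a \<in> Z" "b \<in> Z" for i Z a b
    using cis_pi_lifts_diff_const[OF that(2), of "w i" "\<lambda>_. 1" a b] w[OF that(1)] that
      continuous_on_subset[OF w(1)[OF that(1)] that(3)] by fastforce
  have vend: "v i (0, t j) = -1" if "i < m" "j \<le> m" for i j
    using vertices[OF that(2) E[OF that(1)]] by (simp add: v_def)
  have seg: "connected ({0::real} \<times> {a..b::real})" for a b
    by (intro connected_Times) auto
  \<comment> \<open>The crossing \<open>i\<close> runs inside \<open>C i\<close> except at its ends,
    where all functions are -1; so a function cut off to another component does not notice
    it.\<close>
  have foreign: "v j z = -1" if "i < m" "j < m" "C i \<noteq> C j" "z \<in> {0} \<times> {t i..t (Suc i)}" for i j z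
  proof (rule ccontr)
    assume v: "v j z \<noteq> -1"
    then have "z \<in> C j" by (auto simp: v_def split: if_splits)
    moreover have "snd z \<noteq> t i" "snd z \<noteq> t (Suc i)"
      using v vend[OF that(2), of i] vend[OF that(2), of "Suc i"] that by auto
    then have "z \<in> C i"
      using inC[OF that(1), of "snd z"] that(4) by (cases z) force
    ultimately show False using Ceq that by metis
  qed
  have other: "w j (0, t i) = w j (0, t (Suc i))" if "i < m" "j < m" "C i \<noteq> C j" for i j
    by (rule wconst[OF that(2) seg[of "t i" "t (Suc i)"] _ foreign[OF that]])
      (use t(2)[OF that(1)] Q0 that in auto)
  \<comment> \<open>Along a crossing of its own component the lift differs from \<open>g i\<close>
    by a constant, and \<open>g i\<close> has distinct end values.\<close>
  have same: "w j (0, t i) \<noteq> w j (0, t (Suc i))" if "i < m" "j < m" "C i = C j" for i j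
  proof -
    have Eij: "E i = E j" using CE[of i j "mid i"] midC that by auto
    have "w j (0, t i) - g i (snd (0::real, t i)) = w j (0, t (Suc i)) - g i (snd (0::real, t (Suc i)))"
    proof (rule cis_pi_lifts_diff_const[OF seg[of "t i" "t (Suc i)"],
          where w = "w j" and g = "\<lambda>x. g i (snd x)" and a = "(0, t i)" and b = "(0, t (Suc i))"])
      show "continuous_on ({0} \<times> {t i..t (Suc i)}) (w j)"
        by (rule continuous_on_subset[OF w(1)[OF that(2)]]) (use Q0 that in auto)
      show "continuous_on ({0} \<times> {t i..t (Suc i)}) (\<lambda>x. g i (snd x))"
        by (rule continuous_on_compose2[OF g(1)[OF that(1)]]) (auto intro: continuous_intros)
      fix z assume z: "z \<in> {0::real} \<times> {t i..t (Suc i)}"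
      then have zQ: "z \<in> Q" using Q0 that by auto
      have "v j z = u (E i) (h z)"
      proof (cases "snd z = t i \<or> snd z = t (Suc i)")
        case True
        then have "v j z = -1 \<and> u (E i) (h z) = -1"
          using z vend[OF that(2), of i] vend[OF that(2), of "Suc i"] that
            vertices[OF _ E[OF that(1)], of i] vertices[OF _ E[OF that(1)], of "Suc i"] by auto
        then show ?thesis by simp
      next
        case False
        then have "z \<in> C i" using inC[OF that(1), of "snd z"] z by (cases z) force
        then show ?thesis using that Eij by (simp add: v_def)
      qed
      then show "cis (pi * w j z) = cis (pi * g i (snd z))"
        using w(2)[OF that(2) zQ] g(2)[OF that(1)] z by auto
    qed (use t(2)[OF that(1)] in auto)
    then show ?thesis using g(3)[OF that(1)] by auto
  qed
  have range: "w j (0, t a) = w j (0, t b)"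
    if "j < m" "a \<le> b" "b \<le> m" "\<And>i. a \<le> i \<Longrightarrow> i < b \<Longrightarrow> C i \<noteq> C j" for j a b
    using that(2,3,4)
  proof (induction b)
    case (Suc b)
    show ?case
    proof (cases "a = Suc b")
      case False
      then have "w j (0, t a) = w j (0, t b)" using Suc by auto
      also have "\<dots> = w j (0, t (Suc b))" using Suc False that(1) by (intro other) auto
      finally show ?thesis .
    qed auto
  qed auto
  \<comment> \<open>The rest of the boundary, from the end of the last crossing through (0, 1), (1,
    1) and (1, 0) back to the origin, is mapped to -1.\<close>
  have closed: "w j (0, t 0) = w j (0, t m)" if "j < m" for j
  proof -
    have vm1: "v j z = -1" if "u (E j) (h z) = -1" for z
      using that by (simp add: v_def)
    have "{0} \<times> {t m..1} \<subseteq> Q" using t01[of m] by (auto simp: Q_def)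
    then have "w j (0, t m) = w j (0, 1)"
      by (rule wconst[OF that seg]) (use tail[OF E[OF that]] vm1 t01[of m] in auto)
    also have "\<dots> = w j (1, 1)"
      by (rule wconst[OF that, of "{0..1} \<times> {1}"])
        (use frame(3)[OF E[OF that]] vm1 in \<open>auto simp: Q_def intro!: connected_Times\<close>)
    also have "\<dots> = w j (1, 0)"
      by (rule wconst[OF that, of "{1} \<times> {0..1}"])
        (use frame(1)[OF E[OF that]] vm1 in \<open>auto simp: Q_def intro!: connected_Times\<close>)
    also have "\<dots> = w j (0, 0)"
      by (rule wconst[OF that, of "{0..1} \<times> {0}"])
        (use frame(2)[OF E[OF that]] vm1 in \<open>auto simp: Q_def intro!: connected_Times\<close>)
    finally show ?thesis using t(1) by simp
  qed
  \<comment> \<open>If a component were crossed only once, its lift would change there and nowhere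
    else around the boundary.\<close>
  have ex: "\<exists>j. j \<noteq> i \<and> j < m \<and> C j = C i" if "i < m" for i
  proof (rule ccontr)
    assume "\<not> ?thesis"
    then have no: "C j \<noteq> C i" if "j < m" "j \<noteq> i" for j using that by blast
    have "w i (0, t 0) = w i (0, t i)"
      by (rule range) (use that no in \<open>auto simp: less_trans\<close>)
    moreover have "w i (0, t (Suc i)) = w i (0, t m)"
      by (rule range) (use that no in auto)
    ultimately show False using same[of i i] closed[of i] that by auto
  qed
  define R where "R d \<longleftrightarrow> (\<exists>i. d > 0 \<and> i + d < m \<and> C i = C (i + d))" for d
  obtain j where j: "j \<noteq> 0" "j < m" "C j = C 0" using ex[OF m] by auto
  then have "R j" unfolding R_def by (intro exI[of _ 0]) auto
  define d where "d = (LEAST d. R d)"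
  have "R d" and least: "\<And>d'. d' < d \<Longrightarrow> \<not> R d'"
    unfolding d_def using \<open>R j\<close> by (auto intro: LeastI dest: not_less_Least)
  then obtain i where i: "d > 0" "i + d < m" "C i = C (i + d)"
    unfolding R_def by blast
  have "d = 1"
  proof (rule ccontr)
    assume "d \<noteq> 1"
    then have d: "d \<ge> 2" using i by simp
    let ?k = "Suc i"
    have k: "?k < m" using d i by simp
    have nk: "C i \<noteq> C ?k"
      using least[of 1] d k unfolding R_def by auto
    \<comment> \<open>By minimality of \<open>d\<close> no crossing after \<open>?k\<close> and
      before \<open>i + d\<close> returns to \<open>C ?k\<close>, so this lift changes just once
      between the crossings \<open>i\<close> and \<open>i + d\<close>.\<close>
    have "w ?k (0, t (Suc ?k)) = w ?k (0, t (i + d))"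
    proof (rule range)
      fix l assume l: "Suc ?k \<le> l" "l < i + d"
      show "C l \<noteq> C ?k"
      proof
        assume "C l = C ?k"
        then have "R (l - ?k)" unfolding R_def using l i by (intro exI[of _ ?k]) auto
        moreover have "l - ?k < d" using l by auto
        ultimately show False using least by blast
      qed
    qed (use d i in auto)
    moreover have "w ?k (0, t ?k) \<noteq> w ?k (0, t (Suc ?k))"
      using same[of ?k ?k] k by auto
    moreover have "w ?k (0, t i) = w ?k (0, t ?k)"
      using other[of i ?k] nk k i by auto
    moreover have "w ?k (0, t (i + d)) = w ?k (0, t (Suc (i + d)))"
      using other[of "i + d" ?k] nk k i by auto
    \<comment> \<open>\<open>C i\<close> is connected, disjoint from \<open>C ?k\<close>, and
      contains points of both crossings \<open>i\<close> and \<open>i + d\<close>; through it the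
      lift cannot change, which is the contradiction.\<close>
    moreover have "w ?k (mid i) = w ?k (mid (i + d))"
    proof (rule wconst[OF k, of "C i"])
      show "connected (C i)" by (simp add: C_def)
      show "C i \<subseteq> Q" using connected_component_subset unfolding C_def by blast
      show "v ?k z = -1" if "z \<in> C i" for z
        using Ceq[of i ?k z] that nk k i by (auto simp: v_def)
    qed (use midC[of i] midC[of "i + d"] i in auto)
    moreover have midw: "w ?k (mid l) = w ?k (0, t l)" if "l < m" "C l \<noteq> C ?k" for l
      by (rule wconst[OF k seg[of "t l" "t (Suc l)"] _ foreign[OF that(1) k that(2)]])
        (use t(2)[OF that(1)] Q0 that in \<open>auto simp: mid_def\<close>)
    ultimately show False using midw[of i] midw[of "i + d"] nk i by auto
  qed
  then show ?thesis using i CE[of i "Suc i" "mid i"] midC[of i]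
    by (intro exI[of _ i]) auto
qed

subsection \<open>The fundamental groupoid\<close>

text \<open>Parameters are moved along straight lines in the unit interval. The unit and inverse
  laws below become instances, once both sides are written as reparametrizations of a single
  path.\<close>

lemma homotopic_reparametrizations:
  assumes "path p" "path_image p \<subseteq> S"
    and "path f" "path g" "path_image f \<subseteq> {0..1}" "path_image g \<subseteq> {0..1}"
    and "pathstart f = pathstart g" "pathfinish f = pathfinish g"
  shows "homotopic_paths S (p \<circ> f) (p \<circ> g)"
proof (rule homotopic_paths_continuous_image)
  show "homotopic_paths {0..1} f g"
  proof (rule homotopic_paths_linear)
    fix t :: real assume "t \<in> {0..1}"
    then have "f t \<in> {0..1}" "g t \<in> {0..1}" using assms(5,6) unfolding path_image_def by blast+
    then show "closed_segment (f t) (g t) \<subseteq> {0..1}" by (simp add: closed_segment_subset)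
  qed (use assms in auto)
qed (use assms in \<open>auto simp: path_def path_image_def\<close>)

definition path_in :: "'a::topological_space set \<Rightarrow> 'a \<Rightarrow> 'a \<Rightarrow> (real \<Rightarrow> 'a) \<Rightarrow> bool" where
  "path_in S a b p \<longleftrightarrow> path p \<and> path_image p \<subseteq> S \<and> pathstart p = a \<and> pathfinish p = b"

lemma path_in_join:
  "path_in S a b p \<Longrightarrow> path_in S b c q \<Longrightarrow> path_in S a c (p +++ q)"
  by (simp add: path_in_def subset_path_image_join)

lemma path_in_reversepath: "path_in S a b p \<Longrightarrow> path_in S b a (reversepath p)"
  by (simp add: path_in_def)

lemma path_in_const: "a \<in> S \<Longrightarrow> path_in S a a (\<lambda>_. a)"
  by (simp add: path_in_def path_def path_image_def pathstart_def pathfinish_def image_subset_iff)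

lemma path_in_start: "path_in S a b p \<Longrightarrow> a \<in> S"
  and path_in_finish: "path_in S a b p \<Longrightarrow> b \<in> S"
  unfolding path_in_def using pathstart_in_path_image pathfinish_in_path_image by blast+

lemma homotopic_refl: "path_in S a b p \<Longrightarrow> homotopic_paths S p p"
  by (simp add: path_in_def)

lemma homotopic_const_join:
  assumes "path_in S a b p"
  shows "homotopic_paths S ((\<lambda>_. a) +++ p) p"
proof -
  have "homotopic_paths S (p \<circ> (\<lambda>t. max 0 (2 * t - 1))) (p \<circ> id)"
    using assms by (intro homotopic_reparametrizations)
      (auto simp: path_in_def path_def path_image_def pathstart_def pathfinish_def
        intro!: continuous_intros)
  moreover have "p (max 0 (2 * t - 1)) = ((\<lambda>_. a) +++ p) t" for t
  proof (cases "t \<le> 1 / 2")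
    case True
    then have "max 0 (2 * t - 1) = 0" by simp
    then show ?thesis using True assms by (simp add: joinpaths_def path_in_def pathstart_def)
  qed (simp add: joinpaths_def)
  then have "p \<circ> (\<lambda>t. max 0 (2 * t - 1)) = (\<lambda>_. a) +++ p" by (simp add: fun_eq_iff)
  ultimately show ?thesis by simp
qed

lemma homotopic_join_const:
  assumes "path_in S a b p"
  shows "homotopic_paths S (p +++ (\<lambda>_. b)) p"
proof -
  have "homotopic_paths S (p \<circ> (\<lambda>t. min 1 (2 * t))) (p \<circ> id)"
    using assms by (intro homotopic_reparametrizations)
      (auto simp: path_in_def path_def path_image_def pathstart_def pathfinish_def
        intro!: continuous_intros)
  moreover have "p (min 1 (2 * t)) = (p +++ (\<lambda>_. b)) t" for t
  proof (cases "t \<le> 1 / 2")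
    case False
    then have "min 1 (2 * t) = 1" by simp
    then show ?thesis using False assms by (simp add: joinpaths_def path_in_def pathfinish_def)
  qed (simp add: joinpaths_def)
  then have "p \<circ> (\<lambda>t. min 1 (2 * t)) = p +++ (\<lambda>_. b)" by (simp add: fun_eq_iff)
  ultimately show ?thesis by simp
qed

lemma homotopic_join_reversepath:
  assumes "path_in S a b p"
  shows "homotopic_paths S (p +++ reversepath p) (\<lambda>_. a)"
proof -
  \<comment> \<open>This parameter runs up the interval and back down, which is the path followed by
    its reverse.\<close>
  have "homotopic_paths S (p \<circ> (\<lambda>t. 1 - \<bar>1 - 2 * t\<bar>)) (p \<circ> (\<lambda>_. 0))"
    using assms by (intro homotopic_reparametrizations)
      (auto simp: path_in_def path_def path_image_def pathstart_def pathfinish_def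
        intro!: continuous_intros)
  moreover have "p \<circ> (\<lambda>t. 1 - \<bar>1 - 2 * t\<bar>) = p +++ reversepath p"
    by (auto simp: fun_eq_iff joinpaths_def reversepath_def abs_if)
  moreover have "p \<circ> (\<lambda>_::real. 0) = (\<lambda>_. a)"
    using assms by (auto simp: path_in_def pathstart_def)
  ultimately show ?thesis by (simp only:)
qed

lemma homotopic_reversepath_join:
  assumes "path_in S a b p"
  shows "homotopic_paths S (reversepath p +++ p) (\<lambda>_. b)"
  using homotopic_join_reversepath[OF path_in_reversepath[OF assms]] by simp

lemma homotopic_join_assoc:
  assumes "path_in S a b p" "path_in S b c q" "path_in S c d r"
  shows "homotopic_paths S ((p +++ q) +++ r) (p +++ (q +++ r))"
  using assms unfolding path_in_def
  by (intro homotopic_paths_sym[OF homotopic_paths_assoc]) auto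

lemma homotopic_join_cong:
  assumes "homotopic_paths S p p'" "homotopic_paths S q q'"
    and "path_in S a b p" "path_in S b c q"
  shows "homotopic_paths S (p +++ q) (p' +++ q')"
  using assms by (intro homotopic_paths_join) (auto simp: path_in_def)

lemma homotopic_join_right:
  "homotopic_paths S q q' \<Longrightarrow> path_in S a b p \<Longrightarrow> path_in S b c q \<Longrightarrow>
    homotopic_paths S (p +++ q) (p +++ q')"
  by (rule homotopic_join_cong[OF homotopic_refl])

lemma homotopic_join_left:
  "homotopic_paths S p p' \<Longrightarrow> path_in S a b p \<Longrightarrow> path_in S b c q \<Longrightarrow>
    homotopic_paths S (p +++ q) (p' +++ q)"
  by (rule homotopic_join_cong[OF _ homotopic_refl])

lemma homotopic_cancel_left:
  assumes p: "path_in S a b p" and r: "path_in S a c r"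
  shows "homotopic_paths S (p +++ (reversepath p +++ r)) r"
proof -
  note p' = path_in_reversepath[OF p]
  have "homotopic_paths S (p +++ (reversepath p +++ r)) ((p +++ reversepath p) +++ r)"
    by (rule homotopic_paths_sym[OF homotopic_join_assoc[OF p p' r]])
  also have "homotopic_paths S \<dots> ((\<lambda>_. a) +++ r)"
    by (rule homotopic_join_left[OF homotopic_join_reversepath[OF p] path_in_join[OF p p'] r])
  also have "homotopic_paths S \<dots> r" by (rule homotopic_const_join[OF r])
  finally show ?thesis .
qed

lemma homotopic_cancel_left':
  assumes p: "path_in S b a p" and r: "path_in S a c r"
  shows "homotopic_paths S (reversepath p +++ (p +++ r)) r"
  using homotopic_cancel_left[OF path_in_reversepath[OF p] r] by simp

text \<open>The inner copies of the reversed path and of \<open>q\<close> cancel. Conjugation by a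
  path respects products in this way, so loops at the base point can be studied as words based at a
  barycenter.\<close>

lemma homotopic_conj_join:
  assumes q: "path_in S a b q" and v: "path_in S b b v" and w: "path_in S b b w"
  shows "homotopic_paths S ((q +++ (v +++ reversepath q)) +++ (q +++ (w +++ reversepath q)))
    (q +++ ((v +++ w) +++ reversepath q))"
proof -
  note R = path_in_reversepath[OF q]
  note wR = path_in_join[OF w R] and vR = path_in_join[OF v R]
  note qwR = path_in_join[OF q wR]
  have "homotopic_paths S ((v +++ reversepath q) +++ (q +++ (w +++ reversepath q)))
      (v +++ (reversepath q +++ (q +++ (w +++ reversepath q))))"
    by (rule homotopic_join_assoc[OF v R qwR])
  also have "homotopic_paths S \<dots> (v +++ (w +++ reversepath q))"
    by (rule homotopic_join_right[OF
          homotopic_cancel_left'[OF q wR] v path_in_join[OF R qwR]])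
  also have "homotopic_paths S \<dots> ((v +++ w) +++ reversepath q)"
    by (rule homotopic_paths_sym[OF homotopic_join_assoc[OF v w R]])
  finally have "homotopic_paths S ((v +++ reversepath q) +++ (q +++ (w +++ reversepath q)))
    ((v +++ w) +++ reversepath q)" .
  from homotopic_paths_trans[OF homotopic_join_assoc[OF q vR qwR]
      homotopic_join_right[OF this q path_in_join[OF vR qwR]]]
  show ?thesis .
qed

lemma homotopic_conj_cong:
  assumes q: "path_in S a b q" and v: "path_in S b b v" and vw: "homotopic_paths S v w"
  shows "homotopic_paths S (q +++ (v +++ reversepath q)) (q +++ (w +++ reversepath q))"
proof -
  note R = path_in_reversepath[OF q]
  show ?thesis
    by (rule homotopic_join_right[OF
        homotopic_join_left[OF vw v R] q
        path_in_join[OF v R]])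
qed

lemma homotopic_conj_const:
  assumes q: "path_in S a b q"
  shows "homotopic_paths S (q +++ ((\<lambda>_. b) +++ reversepath q)) (\<lambda>_. a)"
proof -
  note R = path_in_reversepath[OF q]
  note C = path_in_const[OF path_in_start[OF R]]
  show ?thesis
    by (rule homotopic_paths_trans[OF homotopic_join_right[OF
        homotopic_const_join[OF R] q path_in_join[OF C R]]
        homotopic_join_reversepath[OF q]])
qed

lemma homotopic_conj_conj:
  assumes q: "path_in S a b q" and s: "path_in S b c s" and w: "path_in S c c w"
  shows "homotopic_paths S (q +++ ((s +++ (w +++ reversepath s)) +++ reversepath q))
    ((q +++ s) +++ (w +++ reversepath (q +++ s)))"
proof -
  note Q = path_in_reversepath[OF q] and S = path_in_reversepath[OF s]
  note wS = path_in_join[OF w S] and SQ = path_in_join[OF S Q]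
  have "homotopic_paths S ((s +++ (w +++ reversepath s)) +++ reversepath q)
      (s +++ ((w +++ reversepath s) +++ reversepath q))"
    by (rule homotopic_join_assoc[OF s wS Q])
  also have "homotopic_paths S \<dots> (s +++ (w +++ (reversepath s +++ reversepath q)))"
    by (rule homotopic_join_right[OF
          homotopic_join_assoc[OF w S Q] s path_in_join[OF wS Q]])
  finally have "homotopic_paths S (q +++ ((s +++ (w +++ reversepath s)) +++ reversepath q))
      (q +++ (s +++ (w +++ (reversepath s +++ reversepath q))))"
    by (rule homotopic_join_right[OF _ q
          path_in_join[OF path_in_join[OF s wS] Q]])
  also have "homotopic_paths S \<dots> ((q +++ s) +++ (w +++ (reversepath s +++ reversepath q)))"
    by (rule homotopic_paths_sym[OF homotopic_join_assoc[OF q s path_in_join[OF w SQ]]])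
  also have "reversepath s +++ reversepath q = reversepath (q +++ s)"
    using q s by (simp add: path_in_def reversepath_joinpaths)
  finally show ?thesis .
qed

lemma homotopic_unconj:
  assumes q: "path_in S a b q" and w: "path_in S b b w"
    and null: "homotopic_paths S (q +++ (w +++ reversepath q)) (\<lambda>_. a)"
  shows "homotopic_paths S w (\<lambda>_. b)"
proof -
  note R = path_in_reversepath[OF q]
  note wR = path_in_join[OF w R]
  note qwR = path_in_join[OF q wR]
  have C: "path_in S a a (\<lambda>_. a)" by (rule path_in_const[OF path_in_start[OF q]])
  have "homotopic_paths S (w +++ reversepath q) (reversepath q +++ (q +++ (w +++ reversepath q)))"
    by (rule homotopic_paths_sym[OF homotopic_cancel_left'[OF q wR]])
  also have "homotopic_paths S \<dots> (reversepath q +++ (\<lambda>_. a))"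
    by (rule homotopic_join_right[OF null R qwR])
  also have "homotopic_paths S \<dots> (reversepath q)" by (rule homotopic_join_const[OF R])
  finally have wRR: "homotopic_paths S (w +++ reversepath q) (reversepath q)" .
  have "homotopic_paths S w (w +++ (\<lambda>_. b))"
    by (rule homotopic_paths_sym[OF homotopic_join_const[OF w]])
  also have "homotopic_paths S \<dots> (w +++ (reversepath q +++ q))"
    by (rule homotopic_join_right[OF
          homotopic_paths_sym[OF homotopic_reversepath_join[OF q]] w
          path_in_const[OF path_in_start[OF w]]])
  also have "homotopic_paths S \<dots> ((w +++ reversepath q) +++ q)"
    by (rule homotopic_paths_sym[OF homotopic_join_assoc[OF w R q]])
  also have "homotopic_paths S \<dots> (reversepath q +++ q)"
    by (rule homotopic_join_left[OF wRR wR q])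
  also have "homotopic_paths S \<dots> (\<lambda>_. b)" by (rule homotopic_reversepath_join[OF q])
  finally show ?thesis .
qed

lemma homotopic_conj_unconj:
  assumes q: "path_in S a b q" and c: "path_in S a a c"
  shows "homotopic_paths S c (q +++ ((reversepath q +++ (c +++ q)) +++ reversepath q))"
proof -
  note R = path_in_reversepath[OF q]
  note cq = path_in_join[OF c q]
  note RcqR = path_in_join[OF path_in_join[OF R cq] R]
  have "homotopic_paths S (q +++ ((reversepath q +++ (c +++ q)) +++ reversepath q))
      (q +++ (reversepath q +++ ((c +++ q) +++ reversepath q)))"
    by (rule homotopic_join_right[OF
          homotopic_join_assoc[OF R cq R] q RcqR])
  also have "homotopic_paths S \<dots> ((c +++ q) +++ reversepath q)"
    by (rule homotopic_cancel_left[OF q path_in_join[OF cq R]])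
  also have "homotopic_paths S \<dots> (c +++ (q +++ reversepath q))"
    by (rule homotopic_join_assoc[OF c q R])
  also have "homotopic_paths S \<dots> (c +++ (\<lambda>_. a))"
    by (rule homotopic_join_right[OF
          homotopic_join_reversepath[OF q] c path_in_join[OF q R]])
  also have "homotopic_paths S \<dots> c" by (rule homotopic_join_const[OF c])
  finally show ?thesis by (rule homotopic_paths_sym)
qed

subsection \<open>The fundamental group\<close>

lemma path_class_eq_iff:
  assumes "path_in S a b p"
  shows "path_class S p = path_class S q \<longleftrightarrow> homotopic_paths S p q"
proof
  assume "path_class S p = path_class S q"
  moreover have "p \<in> path_class S p"
    using homotopic_refl[OF assms] by (simp add: path_class_def)
  ultimately show "homotopic_paths S p q"
    using homotopic_paths_sym by (auto simp: path_class_def)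
next
  assume "homotopic_paths S p q"
  then show "path_class S p = path_class S q"
    unfolding path_class_def using homotopic_paths_trans homotopic_paths_sym by blast
qed

lemma carrier_pi1: "carrier (pi1 S x0) = {path_class S c | c. path_in S x0 x0 c}"
  by (simp add: pi1_def path_in_def)

lemma one_pi1: "\<one>\<^bsub>pi1 S x0\<^esub> = path_class S (\<lambda>_. x0)"
  by (simp add: pi1_def)

text \<open>The product in \<open>pi1\<close> is a union over all representatives; by compatibility
  of joins with homotopy all these classes coincide.\<close>

lemma mult_pi1:
  assumes p: "path_in S x0 x0 p" and q: "path_in S x0 x0 q"
  shows "path_class S p \<otimes>\<^bsub>pi1 S x0\<^esub> path_class S q = path_class S (p +++ q)"
proof -
  have "path_class S (a +++ b) = path_class S (p +++ q)"
    if "a \<in> path_class S p" "b \<in> path_class S q" for a b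
    using that path_class_eq_iff[OF path_in_join[OF p q]] homotopic_join_cong[OF _ _ p q]
    unfolding path_class_def by blast
  moreover have "p \<in> path_class S p" "q \<in> path_class S q"
    using homotopic_refl[OF p] homotopic_refl[OF q]
    unfolding path_class_def by blast+
  ultimately have "(\<Union>a\<in>path_class S p. \<Union>b\<in>path_class S q. path_class S (a +++ b)) = path_class S (p +++ q)"
    by blast
  then show ?thesis by (simp add: pi1_def)
qed

lemma group_pi1:
  assumes "x0 \<in> S"
  shows "group (pi1 S x0)"
proof (rule groupI)
  note C = path_in_const[OF assms]
  show "\<one>\<^bsub>pi1 S x0\<^esub> \<in> carrier (pi1 S x0)"
    unfolding carrier_pi1 one_pi1 using C by blast
  fix X assume "X \<in> carrier (pi1 S x0)"
  then obtain p where p: "path_in S x0 x0 p" "X = path_class S p" unfolding carrier_pi1 by blast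
  show "\<one>\<^bsub>pi1 S x0\<^esub> \<otimes>\<^bsub>pi1 S x0\<^esub> X = X"
    unfolding p(2) one_pi1 mult_pi1[OF C p(1)] path_class_eq_iff[OF path_in_join[OF C p(1)]]
    by (rule homotopic_const_join[OF p(1)])
  note p' = path_in_reversepath[OF p(1)]
  have "path_class S (reversepath p) \<otimes>\<^bsub>pi1 S x0\<^esub> X = \<one>\<^bsub>pi1 S x0\<^esub>"
    unfolding p(2) one_pi1 mult_pi1[OF p' p(1)] path_class_eq_iff[OF path_in_join[OF p' p(1)]]
    by (rule homotopic_reversepath_join[OF p(1)])
  then show "\<exists>Y\<in>carrier (pi1 S x0). Y \<otimes>\<^bsub>pi1 S x0\<^esub> X = \<one>\<^bsub>pi1 S x0\<^esub>"
    unfolding carrier_pi1 using p' by blast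
  fix Y assume "Y \<in> carrier (pi1 S x0)"
  then obtain q where q: "path_in S x0 x0 q" "Y = path_class S q" unfolding carrier_pi1 by blast
  show "X \<otimes>\<^bsub>pi1 S x0\<^esub> Y \<in> carrier (pi1 S x0)"
    unfolding p(2) q(2) mult_pi1[OF p(1) q(1)] carrier_pi1
    using path_in_join[OF p(1) q(1)] by blast
  fix Z assume "Z \<in> carrier (pi1 S x0)"
  then obtain r where r: "path_in S x0 x0 r" "Z = path_class S r" unfolding carrier_pi1 by blast
  note pq = path_in_join[OF p(1) q(1)] and qr = path_in_join[OF q(1) r(1)]
  show "X \<otimes>\<^bsub>pi1 S x0\<^esub> Y \<otimes>\<^bsub>pi1 S x0\<^esub> Z = X \<otimes>\<^bsub>pi1 S x0\<^esub> (Y \<otimes>\<^bsub>pi1 S x0\<^esub> Z)"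
    unfolding p(2) q(2) r(2) mult_pi1[OF p(1) q(1)] mult_pi1[OF q(1) r(1)] mult_pi1[OF pq r(1)]
      mult_pi1[OF p(1) qr] path_class_eq_iff[OF path_in_join[OF pq r(1)]]
    by (rule homotopic_join_assoc[OF p(1) q(1) r(1)])
qed

text \<open>The new factor is appended on the right, in accordance with the recursion for powers in
  a group.\<close>

primrec loop_power :: "(real \<Rightarrow> 'a::topological_space) \<Rightarrow> nat \<Rightarrow> real \<Rightarrow> 'a" where
  "loop_power c 0 = (\<lambda>_. pathstart c)"
| "loop_power c (Suc n) = loop_power c n +++ c"

lemma loop_power_from_to:
  assumes "path_in S x0 x0 c"
  shows "path_in S x0 x0 (loop_power c n)"
proof (induction n)
  case 0
  then show ?case
    using path_in_const[OF path_in_start[OF assms]] assms by (simp add: path_in_def)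
qed (use assms path_in_join in auto)

lemma pow_pi1:
  assumes "path_in S x0 x0 c"
  shows "path_class S c [^]\<^bsub>pi1 S x0\<^esub> (n::nat) = path_class S (loop_power c n)"
proof (induction n)
  case 0
  then show ?case using assms by (simp add: one_pi1 path_in_def)
next
  case (Suc n)
  then show ?case by (simp add: mult_pi1[OF loop_power_from_to assms] assms)
qed

section \<open>Ideal triangulations\<close>

subsection \<open>The triangle without its vertices\<close>

definition ideal_triangle :: "(real^3) set" where
  "ideal_triangle = {x. (\<forall>i. 0 \<le> x $ i \<and> x $ i < 1) \<and> (\<Sum>i\<in>UNIV. x $ i) = 1}"

definition side_nbhd :: "3 \<Rightarrow> (real^3) set" where
  "side_nbhd i = {x \<in> ideal_triangle. \<forall>j. j \<noteq> i \<longrightarrow> 0 < x $ j}"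

text \<open>Addition of indices is modulo 3, so \<open>i\<close>, \<open>i + 1\<close>,
  \<open>i + 2\<close> enumerates the vertices from any \<open>i\<close>, and one computation serves
  all three sides.\<close>

lemma index_3_cases: "j = i \<or> j = i + 1 \<or> j = i + 2" for i j :: 3
  using exhaust_3[of i] exhaust_3[of j] by auto

lemma index_3_neq [simp]: "i + 1 \<noteq> i" "i + 2 \<noteq> i" "i + 1 \<noteq> i + 2" for i :: 3
  using exhaust_3[of i] by auto

lemma sum_index_3: "(\<Sum>j\<in>UNIV. f j) = f i + f (i + 1) + f (i + 2)" for i :: 3
proof -
  have "UNIV = {i, i + 1, i + 2}" using index_3_cases[of _ i] by blast
  then have "(\<Sum>j\<in>UNIV. f j) = (\<Sum>j\<in>{i, i + 1, i + 2}. f j)" by (rule arg_cong)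
  moreover have "i \<notin> {i + 1, i + 2}" "i + 1 \<notin> {i + 2}"
    using index_3_neq[of i] by (auto dest: sym)
  ultimately show ?thesis by (simp add: add.assoc)
qed

lemma ideal_triangle_iff:
  "x \<in> ideal_triangle \<longleftrightarrow> x \<in> std_triangle \<and> (\<forall>i. x \<noteq> axis i 1)"
proof -
  have "x $ i < 1 \<longleftrightarrow> x \<noteq> axis i 1" if x: "x \<in> std_triangle" for i
  proof -
    have s: "x $ i + x $ (i + 1) + x $ (i + 2) = 1" and n: "\<And>j. 0 \<le> x $ j"
      using x sum_index_3[of "\<lambda>j. x $ j" i] by (auto simp: std_triangle_def)
    have "x = axis i 1" if "\<not> x $ i < 1"
    proof -
      have "x $ i = 1" "x $ (i + 1) = 0" "x $ (i + 2) = 0"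
        using that s n[of "i + 1"] n[of "i + 2"] by linarith+
      then have "x $ j = (if j = i then 1 else 0)" for j using index_3_cases[of j i] by auto
      then show ?thesis by (simp add: vec_eq_iff axis_def)
    qed
    then show ?thesis by (auto simp: axis_def)
  qed
  then show ?thesis unfolding ideal_triangle_def std_triangle_def by auto
qed

lemma convex_coordinate_sum: "convex {x::real^'n. (\<Sum>i\<in>UNIV. x $ i) = c}"
  using convex_hyperplane[of "(\<chi> i. 1) :: real^'n" c] by (simp add: inner_vec_def)

lemma convex_ideal_triangle: "convex ideal_triangle"
proof -
  have eq: "ideal_triangle = (\<Inter>i. {x. 0 \<le> x $ i} \<inter> {x. x $ i < 1}) \<inter> {x. (\<Sum>i\<in>UNIV. x $ i) = 1}"
    by (auto simp: ideal_triangle_def)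
  moreover have "convex {x::real^3. 0 \<le> x $ i}" "convex {x::real^3. x $ i < 1}" for i
    by (auto simp: convex_def add_pos_nonneg intro!: convex_bound_lt)
  moreover have "convex {x::real^3. (\<Sum>i\<in>UNIV. x $ i) = 1}" by (rule convex_coordinate_sum)
  ultimately show ?thesis unfolding eq by (intro convex_Int convex_INT)
qed

lemma compact_std_triangle: "compact std_triangle"
proof -
  have "bounded std_triangle"
  proof (rule boundedI)
    fix x assume x: "x \<in> std_triangle"
    then have "norm x \<le> (\<Sum>i\<in>UNIV. \<bar>x $ i\<bar>)" using norm_le_l1_cart by blast
    also have "\<dots> = 1" using x by (simp add: std_triangle_def)
    finally show "norm x \<le> 1" .
  qed
  moreover have "closed std_triangle"
  proof -
    have "std_triangle = (\<Inter>i. {x. 0 \<le> x $ i}) \<inter> {x. (\<Sum>i\<in>UNIV. x $ i) = 1}"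
      by (auto simp: std_triangle_def)
    also have "closed \<dots>"
      by (intro closed_Int closed_INT ballI closed_Collect_le closed_Collect_eq continuous_intros)
    finally show ?thesis .
  qed
  ultimately show ?thesis by (simp add: compact_eq_bounded_closed)
qed

lemma open_side_subset: "open_side i \<subseteq> ideal_triangle"
proof
  fix x assume x: "x \<in> open_side i"
  have "x $ i = 0" "0 < x $ (i + 1)" "0 < x $ (i + 2)" "x $ i + x $ (i + 1) + x $ (i + 2) = 1"
    using x sum_index_3[of "\<lambda>j. x $ j" i] by (auto simp: open_side_def std_triangle_def)
  then have "x $ j < 1" for j
    using index_3_cases[of j i] by auto
  then show "x \<in> ideal_triangle" using x by (auto simp: open_side_def std_triangle_def ideal_triangle_def)
qed

lemma open_triangle_subset: "open_triangle \<subseteq> ideal_triangle"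
proof
  fix x assume x: "x \<in> open_triangle"
  have "x $ j < 1" for j
  proof -
    have "0 < x $ (j + 1)" "0 < x $ (j + 2)" "x $ j + x $ (j + 1) + x $ (j + 2) = 1"
      using x sum_index_3[of "\<lambda>j. x $ j" j] by (auto simp: open_triangle_def std_triangle_def)
    then show ?thesis by linarith
  qed
  then show "x \<in> ideal_triangle" using x by (auto simp: open_triangle_def std_triangle_def ideal_triangle_def)
qed

lemma side_nbhd_eq: "side_nbhd i = open_triangle \<union> open_side i"
proof -
  have "open_triangle \<subseteq> side_nbhd i" "open_side i \<subseteq> side_nbhd i"
    using open_triangle_subset open_side_subset
    by (auto simp: side_nbhd_def open_triangle_def open_side_def)
  moreover have "x \<in> open_triangle \<union> open_side i" if "x \<in> side_nbhd i" for x
  proof (cases "x $ i = 0")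
    case True
    then show ?thesis using that
      by (auto simp: side_nbhd_def open_side_def ideal_triangle_iff)
  next
    case False
    then have "0 < x $ i" using that
      by (simp add: side_nbhd_def ideal_triangle_def order_less_le)
    then have "0 < x $ j" for j using that by (cases "j = i") (auto simp: side_nbhd_def)
    then show ?thesis using that
      by (auto simp: side_nbhd_def open_triangle_def ideal_triangle_iff)
  qed
  ultimately show ?thesis by blast
qed

text \<open>If two coordinates vanished, the third would be 1 and the point a vertex.\<close>

lemma ideal_triangle_two_pos:
  assumes "x \<in> ideal_triangle" "x $ i = 0" "j \<noteq> i"
  shows "0 < x $ j"
proof (rule ccontr)
  assume "\<not> 0 < x $ j"
  then have j: "x $ j = 0" using assms(1) by (simp add: ideal_triangle_def order_less_le)
  have "x $ i + x $ (i + 1) + x $ (i + 2) = 1" "x $ (i + 1) < 1" "x $ (i + 2) < 1"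
    using assms(1) sum_index_3[of "\<lambda>j. x $ j" i] by (auto simp: ideal_triangle_def)
  then show False using j assms(2,3) index_3_cases[of j i] by auto
qed

lemma ideal_triangle_cases:
  assumes "x \<in> ideal_triangle"
  shows "x \<in> open_triangle \<or> (\<exists>i. x \<in> open_side i)"
proof (cases "\<exists>i. x $ i = 0")
  case True
  then obtain i where "x $ i = 0" by blast
  then have "x \<in> side_nbhd i"
    using assms ideal_triangle_two_pos by (auto simp: side_nbhd_def)
  then show ?thesis by (auto simp: side_nbhd_eq)
next
  case False
  then have "\<forall>i. 0 < x $ i" using assms by (simp add: ideal_triangle_def order_less_le)
  then show ?thesis using assms by (auto simp: open_triangle_def ideal_triangle_iff)
qed

lemma side_nbhd_side: "x \<in> side_nbhd i \<Longrightarrow> x \<in> open_side j \<Longrightarrow> j = i"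
  by (auto simp: side_nbhd_def open_side_def)

lemma barycenter_open: "barycenter \<in> open_triangle"
  by (auto simp: barycenter_def open_triangle_def std_triangle_def sum_3)

lemma barycenter_nth [simp]: "barycenter $ i = 1 / 3"
  by (simp add: barycenter_def)

lemma convex_open_triangle: "convex open_triangle"
proof -
  have eq: "open_triangle = (\<Inter>i. {x. 0 < x $ i}) \<inter> {x. (\<Sum>i\<in>UNIV. x $ i) = 1}"
    by (auto simp: open_triangle_def std_triangle_def less_imp_le)
  moreover have "convex {x::real^3. 0 < x $ i}" for i
    using convex_halfspace_gt[of 0 "axis i 1 :: real^3"] by (simp add: inner_axis')
  moreover have "convex {x::real^3. (\<Sum>i\<in>UNIV. x $ i) = 1}" by (rule convex_coordinate_sum)
  ultimately show ?thesis unfolding eq by (intro convex_Int convex_INT)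
qed

lemma convex_side_nbhd: "convex (side_nbhd i)"
proof -
  have eq: "side_nbhd i = ideal_triangle \<inter> (\<Inter>j\<in>-{i}. {x. 0 < x $ j})"
    by (auto simp: side_nbhd_def)
  moreover have "convex {x::real^3. 0 < x $ j}" for j
    using convex_halfspace_gt[of 0 "axis j 1 :: real^3"] by (simp add: inner_axis')
  ultimately show ?thesis
    unfolding eq by (intro convex_Int convex_INT) (simp_all add: convex_ideal_triangle)
qed

lemma convex_open_side: "convex (open_side i)"
proof -
  have eq: "open_side i = side_nbhd i \<inter> {x. x $ i = 0}"
    unfolding side_nbhd_eq by (auto simp: open_triangle_def open_side_def)
  moreover have "convex {x::real^3. x $ i = 0}"
    using convex_hyperplane[of "axis i 1 :: real^3" 0] by (simp add: inner_axis')
  ultimately show ?thesis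
    unfolding eq by (intro convex_Int convex_side_nbhd)
qed

lemma open_side_nonempty: "open_side i \<noteq> {}"
proof -
  have "(\<chi> j. if j = i then 0 else 1 / 2) \<in> open_side i"
    using sum_index_3[of "\<lambda>j. if j = i then 0 else 1 / 2 :: real" i]
    by (auto simp: open_side_def std_triangle_def)
  then show ?thesis by blast
qed

lemma openin_side_nbhd: "openin (top_of_set ideal_triangle) (side_nbhd i)"
proof -
  have "open (\<Inter>j\<in>-{i}. {x::real^3. 0 < x $ j})"
    by (intro open_INT ballI open_Collect_less continuous_intros) auto
  moreover have "side_nbhd i = ideal_triangle \<inter> (\<Inter>j\<in>-{i}. {x. 0 < x $ j})"
    by (auto simp: side_nbhd_def)
  ultimately show ?thesis by (simp add: openin_open_Int)
qed

text \<open>The function \<open>side_coord i\<close> vanishes on the side opposite to \<open>i\<close> and increases to \<open>1\<close>, which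
  is its value outside the region where \<open>x $ i\<close> is the smallest coordinate.  The set where it is
  smaller than \<open>1\<close> is the neighbourhood of the side used for counting crossings.\<close>

definition side_coord :: "3 \<Rightarrow> real^3 \<Rightarrow> real" where
  "side_coord i x = x $ i / max (x $ i) (min (x $ (i + 1)) (x $ (i + 2)))"

text \<open>It could vanish only where \<open>x $ i\<close> and a second coordinate are zero, that
  is at a removed vertex. The quotient is therefore continuous up to the ideal points.\<close>

lemma side_coord_denominator:
  assumes "x \<in> ideal_triangle"
  shows "0 < max (x $ i) (min (x $ (i + 1)) (x $ (i + 2)))"
proof (cases "x $ i = 0")
  case True
  then show ?thesis using ideal_triangle_two_pos[OF assms True] by (simp add: less_max_iff_disj)
next
  case False
  then have "0 < x $ i" using assms by (simp add: ideal_triangle_def order_less_le)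
  then show ?thesis by (simp add: less_max_iff_disj)
qed

lemma continuous_on_side_coord: "continuous_on ideal_triangle (side_coord i)"
  unfolding side_coord_def using side_coord_denominator[of _ i]
  by (intro continuous_intros) (auto simp: less_le)

lemma side_coord_range:
  assumes "x \<in> ideal_triangle"
  shows "0 \<le> side_coord i x" "side_coord i x \<le> 1"
  using side_coord_denominator[OF assms, of i] assms
  by (auto simp: side_coord_def ideal_triangle_def divide_le_eq_1)

lemma side_coord_less_1_iff:
  assumes "x \<in> ideal_triangle"
  shows "side_coord i x < 1 \<longleftrightarrow> (\<forall>j. j \<noteq> i \<longrightarrow> x $ i < x $ j)"
proof -
  have "side_coord i x < 1 \<longleftrightarrow> x $ i < min (x $ (i + 1)) (x $ (i + 2))"
    unfolding side_coord_def pos_divide_less_eq[OF side_coord_denominator[OF assms]]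
    by (simp add: less_max_iff_disj)
  also have "\<dots> \<longleftrightarrow> (\<forall>j. j \<noteq> i \<longrightarrow> x $ i < x $ j)"
  proof
    assume L: "x $ i < min (x $ (i + 1)) (x $ (i + 2))"
    show "\<forall>j. j \<noteq> i \<longrightarrow> x $ i < x $ j"
    proof (intro allI impI)
      fix j assume "j \<noteq> i"
      then show "x $ i < x $ j" using L index_3_cases[of j i] by auto
    qed
  qed auto
  finally show ?thesis .
qed

lemma side_coord_open_side: "x \<in> open_side i \<Longrightarrow> side_coord i x = 0"
  by (simp add: side_coord_def open_side_def)

lemma side_coord_other_side:
  assumes "x \<in> open_side j" "j \<noteq> i"
  shows "side_coord i x = 1"
proof -
  have x: "x \<in> ideal_triangle" using assms(1) open_side_subset by blast
  have "\<not> side_coord i x < 1"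
    unfolding side_coord_less_1_iff[OF x] using assms by (force simp: open_side_def)
  then show ?thesis using side_coord_range(2)[OF x, of i] by simp
qed

lemma side_coord_barycenter: "side_coord i barycenter = 1"
  by (simp add: side_coord_def)

text \<open>At most one coordinate is strictly smaller than the other two. This makes the supports
  of the functions attached to different edges disjoint.\<close>

lemma side_coord_unique:
  assumes "x \<in> ideal_triangle" "side_coord i x \<noteq> 1" "side_coord j x \<noteq> 1"
  shows "i = j"
proof (rule ccontr)
  assume "i \<noteq> j"
  have "side_coord i x < 1" "side_coord j x < 1"
    using assms side_coord_range(2)[OF assms(1)] by (simp_all add: order_less_le)
  then have "x $ i < x $ j" "x $ j < x $ i"
    using \<open>i \<noteq> j\<close> by (auto simp: side_coord_less_1_iff[OF assms(1)])
  then show False by simp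
qed

text \<open>All coordinates agree at the barycenter, and on the way to the side opposite
  \<open>i\<close> the coordinate \<open>i\<close> immediately becomes the smallest.\<close>

lemma linepath_barycenter:
  assumes "z \<in> open_side i" "r \<in> {0..1}"
  shows "linepath barycenter z r \<in> side_nbhd i"
    and "r > 0 \<Longrightarrow> side_coord i (linepath barycenter z r) < 1"
proof -
  have "barycenter \<in> side_nbhd i" "z \<in> side_nbhd i"
    using barycenter_open assms(1) by (auto simp: side_nbhd_eq)
  then show mem: "linepath barycenter z r \<in> side_nbhd i"
    using convex_side_nbhd[of i] linepath_in_path[OF assms(2)]
    unfolding convex_contains_segment by blast
  assume "r > 0"
  have "(1 - r) * (1 / 3) + r * z $ i < (1 - r) * (1 / 3) + r * z $ j" if "j \<noteq> i" for j
    using \<open>r > 0\<close> assms(1) that by (simp add: open_side_def)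
  moreover have "linepath barycenter z r \<in> ideal_triangle"
    using mem by (simp add: side_nbhd_def)
  ultimately show "side_coord i (linepath barycenter z r) < 1"
    by (simp add: side_coord_less_1_iff linepath_def)
qed

text \<open>The projection from vertex \<open>i\<close> onto the opposite side. Together with the
  height \<open>x $ i\<close> it gives product coordinates on \<open>side_nbhd i\<close>, from which
  \<open>side_lift\<close> recovers the point.\<close>

definition side_proj :: "3 \<Rightarrow> real^3 \<Rightarrow> real^3" where
  "side_proj i x = (1 / (1 - x $ i)) *\<^sub>R (x - x $ i *\<^sub>R axis i 1)"

definition side_lift :: "3 \<Rightarrow> real \<Rightarrow> real^3 \<Rightarrow> real^3" where
  "side_lift i h z = (1 - h) *\<^sub>R z + h *\<^sub>R axis i 1"

lemma side_lift_proj: "x \<in> ideal_triangle \<Longrightarrow> side_lift i (x $ i) (side_proj i x) = x"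
  by (simp add: side_lift_def side_proj_def ideal_triangle_def less_le)

lemma side_lift_0 [simp]: "side_lift i 0 z = z"
  by (simp add: side_lift_def)

lemma side_proj_open_side: "x \<in> open_side i \<Longrightarrow> side_proj i x = x"
  by (simp add: side_proj_def open_side_def)

lemma side_proj_in:
  assumes "x \<in> side_nbhd i"
  shows "side_proj i x \<in> open_side i"
proof -
  have x: "x $ i < 1" "\<And>j. j \<noteq> i \<Longrightarrow> 0 < x $ j" "x $ i + x $ (i + 1) + x $ (i + 2) = 1"
    using assms sum_index_3[of "\<lambda>j. x $ j" i] by (auto simp: side_nbhd_def ideal_triangle_def)
  have nth: "side_proj i x $ j = (if j = i then 0 else x $ j / (1 - x $ i))" for j
    by (simp add: side_proj_def axis_def)
  have "x $ (i + 1) / (1 - x $ i) + x $ (i + 2) / (1 - x $ i) = 1"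
  proof -
    have "x $ (i + 1) + x $ (i + 2) = 1 - x $ i" using x(3) by linarith
    then show ?thesis using x(1) by (simp flip: add_divide_distrib)
  qed
  then show ?thesis
    using x sum_index_3[of "\<lambda>j. side_proj i x $ j" i]
    by (auto simp: open_side_def std_triangle_def nth less_imp_le)
qed

lemma side_lift_in:
  assumes "z \<in> open_side i" "0 \<le> h" "h < 1"
  shows "side_lift i h z \<in> side_nbhd i"
proof -
  have z: "z $ i = 0" "\<And>j. j \<noteq> i \<Longrightarrow> 0 < z $ j" "z $ (i + 1) + z $ (i + 2) = 1"
    using assms(1) sum_index_3[of "\<lambda>j. z $ j" i] by (auto simp: open_side_def std_triangle_def)
  have nth: "side_lift i h z $ j = (if j = i then h else (1 - h) * z $ j)" for j
    using z(1) by (simp add: side_lift_def axis_def)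
  have zj: "z $ j < 1" for j
    using assms(1) open_side_subset by (auto simp: ideal_triangle_def)
  have "(1 - h) * z $ j < 1" if "j \<noteq> i" for j
    using mult_left_le_one_le[of "z $ j" "1 - h"] assms z(2)[OF that] zj[of j] by linarith
  moreover have "h + ((1 - h) * z $ (i + 1) + (1 - h) * z $ (i + 2)) = 1"
    using z(3) by (simp flip: distrib_left)
  ultimately show ?thesis
    using assms z sum_index_3[of "\<lambda>j. side_lift i h z $ j" i]
    by (auto simp: side_nbhd_def ideal_triangle_def nth less_imp_le)
qed

lemma continuous_on_side_proj: "continuous_on (side_nbhd i) (side_proj i)"
  unfolding side_proj_def
  by (intro continuous_intros) (auto simp: side_nbhd_def ideal_triangle_def less_le)

subsection \<open>The topology of a triangulated surface\<close>

locale bipartite_triangulated_surface =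
  fixes M P :: "'a::t2_space set" and T :: "(real^3 \<Rightarrow> 'a) set"
  assumes triangulation: "ideal_triangulation M P T"
    and bipartite: "bipartite_triangulation T"
begin

abbreviation surface :: "'a set" where "surface \<equiv> M - P"

abbreviation homotopic (infix "\<simeq>" 50) where "p \<simeq> q \<equiv> homotopic_paths surface p q"

abbreviation sides :: "((real^3 \<Rightarrow> 'a) \<times> 3) set" where "sides \<equiv> T \<times> UNIV"

definition opp :: "(real^3 \<Rightarrow> 'a) \<times> 3 \<Rightarrow> (real^3 \<Rightarrow> 'a) \<times> 3" where
  "opp s = (THE s'. s' \<in> sides \<and> s' \<noteq> s \<and> side_image s' = side_image s)"

lemma finite_T: "finite T"
  using triangulation by (simp add: ideal_triangulation_def)

lemma triangle_continuous: "\<tau> \<in> T \<Longrightarrow> continuous_on std_triangle \<tau>"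
  using triangulation by (simp add: ideal_triangulation_def)

lemma triangle_vertex: "\<tau> \<in> T \<Longrightarrow> x \<in> std_triangle \<Longrightarrow> \<tau> x \<in> P \<longleftrightarrow> (\<exists>i. x = axis i 1)"
  using triangulation by (simp add: ideal_triangulation_def)

lemma triangle_inj_open: "\<tau> \<in> T \<Longrightarrow> inj_on \<tau> open_triangle"
  using triangulation by (simp add: ideal_triangulation_def)

lemma triangle_inj_side: "\<tau> \<in> T \<Longrightarrow> inj_on \<tau> (open_side i)"
  using triangulation by (simp add: ideal_triangulation_def)

lemma triangles_cover: "(\<Union>\<tau>\<in>T. \<tau> ` std_triangle) = M"
  using triangulation[unfolded ideal_triangulation_def, THEN conjunct2, THEN conjunct2, THEN conjunct1] by assumption

lemma open_triangles_disjoint: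
  "\<tau> \<in> T \<Longrightarrow> \<tau>' \<in> T \<Longrightarrow> \<tau> \<noteq> \<tau>' \<Longrightarrow> \<tau> ` open_triangle \<inter> \<tau>' ` open_triangle = {}"
  by (rule triangulation[unfolded ideal_triangulation_def, THEN conjunct2, THEN conjunct2, THEN conjunct2, THEN conjunct1, rule_format])

lemma open_triangle_side_disjoint: "\<tau> \<in> T \<Longrightarrow> s \<in> sides \<Longrightarrow> \<tau> ` open_triangle \<inter> side_image s = {}"
  by (rule triangulation[unfolded ideal_triangulation_def, THEN conjunct2, THEN conjunct2, THEN conjunct2, THEN conjunct2, THEN conjunct1, rule_format])

lemma side_images_disjoint:
  assumes "s \<in> sides" "s' \<in> sides" "side_image s \<noteq> side_image s'"
  shows "side_image s \<inter> side_image s' = {}"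
  using triangulation[unfolded ideal_triangulation_def, THEN conjunct2, THEN conjunct2, THEN conjunct2,
      THEN conjunct2, THEN conjunct2, THEN conjunct1, rule_format, OF assms(1,2)] assms(3)
  by simp

lemma opp_ex1: "s \<in> sides \<Longrightarrow> \<exists>!s'. s' \<in> sides \<and> s' \<noteq> s \<and> side_image s' = side_image s"
  by (rule triangulation[unfolded ideal_triangulation_def, THEN conjunct2, THEN conjunct2, THEN conjunct2, THEN conjunct2, THEN conjunct2, THEN conjunct2, rule_format])

lemma opp:
  assumes "s \<in> sides"
  shows "opp s \<in> sides" "opp s \<noteq> s" "side_image (opp s) = side_image s"
  using theI'[OF opp_ex1[OF assms]] unfolding opp_def by blast+

lemma side_image_eq_cases:
  assumes "s \<in> sides" "s' \<in> sides" "side_image s' = side_image s"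
  shows "s' = s \<or> s' = opp s"
proof (cases "s' = s")
  case False
  have "opp s = s'"
    unfolding opp_def by (rule the1_equality[OF opp_ex1[OF assms(1)]]) (use assms False in simp)
  then show ?thesis by simp
qed simp

lemma opp_opp: "s \<in> sides \<Longrightarrow> opp (opp s) = s"
  using side_image_eq_cases[of "opp s" s] opp[of s] by auto

lemma fst_side: "s \<in> sides \<Longrightarrow> fst s \<in> T"
  by auto

lemma fst_opp: "s \<in> sides \<Longrightarrow> fst (opp s) \<in> T"
  by (rule fst_side[OF opp(1)])

text \<open>A triangle glued to itself would be adjacent to itself and lie in both colour classes.
  Consequently the two halves of a diamond come from different triangles, and a walk never uses the
  same letter twice in succession.\<close>

lemma fst_opp_neq:
  assumes "s \<in> sides"
  shows "fst (opp s) \<noteq> fst s"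
proof -
  obtain B W where BW: "B \<inter> W = {}"
      "\<And>\<tau> \<tau>'. dual_adjacent T \<tau> \<tau>' \<Longrightarrow> (\<tau> \<in> B \<and> \<tau>' \<in> W) \<or> (\<tau> \<in> W \<and> \<tau>' \<in> B)"
    using bipartite unfolding bipartite_triangulation_def by blast
  have "(fst s, snd s) \<noteq> (fst (opp s), snd (opp s)) \<and>
      side_image (fst s, snd s) = side_image (fst (opp s), snd (opp s))"
    using opp(2,3)[OF assms] by simp
  then have "dual_adjacent T (fst s) (fst (opp s))"
    unfolding dual_adjacent_def using fst_side[OF assms] fst_opp[OF assms] by blast
  from BW(2)[OF this] show ?thesis using BW(1) by auto
qed

lemma in_surface:
  assumes "\<tau> \<in> T" "x \<in> ideal_triangle"
  shows "\<tau> x \<in> surface"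
  using assms triangle_vertex[OF assms(1), of x] triangles_cover unfolding ideal_triangle_iff by blast

lemma ideal_of_surface:
  assumes "\<tau> \<in> T" "x \<in> std_triangle" "\<tau> x \<in> surface"
  shows "x \<in> ideal_triangle"
  using assms triangle_vertex[OF assms(1,2)] unfolding ideal_triangle_iff by blast

lemma surface_cover:
  assumes "y \<in> surface"
  obtains \<tau> x where "\<tau> \<in> T" "x \<in> ideal_triangle" "y = \<tau> x"
proof -
  obtain \<tau> x where "\<tau> \<in> T" "x \<in> std_triangle" "y = \<tau> x"
    using assms triangles_cover by blast
  then show thesis using that ideal_of_surface[of \<tau> x] assms by blast
qed

lemma continuous_on_ideal_triangle: "\<tau> \<in> T \<Longrightarrow> continuous_on ideal_triangle \<tau>"
  by (rule continuous_on_subset[OF triangle_continuous]) (auto simp: ideal_triangle_iff)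

text \<open>Open triangles are disjoint from one another and from all sides, so distinct points can
  be identified only on sides. Two side images that meet are equal, and just two sides share an
  image.\<close>

lemma triangle_eq_cases:
  assumes "\<tau> \<in> T" "\<tau>' \<in> T" and x: "x \<in> ideal_triangle" and x': "x' \<in> ideal_triangle"
    and eq: "\<tau> x = \<tau>' x'"
  shows "\<tau> = \<tau>' \<and> x = x' \<or>
    (\<exists>i i'. x \<in> open_side i \<and> x' \<in> open_side i' \<and> (\<tau>', i') = opp (\<tau>, i))"
proof -
  have side: "\<tau> z \<in> side_image (\<tau>, i)" if "z \<in> open_side i" for \<tau> :: "real^3 \<Rightarrow> 'a" and z i
    using that by (auto simp: side_image_def)
  have no_mix: False if "\<sigma> \<in> T" "\<sigma>' \<in> T" "z \<in> open_triangle" "z' \<in> open_side j" "\<sigma> z = \<sigma>' z'" for \<sigma> \<sigma>' z z' j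
    using open_triangle_side_disjoint[of \<sigma> "(\<sigma>', j)"] side[OF that(4), of \<sigma>'] that by auto
  consider "x \<in> open_triangle" "x' \<in> open_triangle" | i j where "x \<in> open_side i" "x' \<in> open_side j"
    using ideal_triangle_cases[OF x] ideal_triangle_cases[OF x']
      no_mix[OF assms(1,2), of x x'] no_mix[OF assms(2,1), of x' x] eq by auto
  then show ?thesis
  proof cases
    case 1
    then have "\<tau> = \<tau>'" using open_triangles_disjoint[OF assms(1,2)] eq by blast
    then show ?thesis using 1 inj_onD[OF triangle_inj_open[OF assms(1)], of x x'] eq by simp
  next
    case 2
    have s: "(\<tau>, i) \<in> sides" "(\<tau>', j) \<in> sides" using assms by auto
    have "side_image (\<tau>', j) = side_image (\<tau>, i)"
      using side_images_disjoint[OF s] side[OF 2(1), of \<tau>] side[OF 2(2), of \<tau>'] eq by auto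
    then consider "(\<tau>', j) = (\<tau>, i)" | "(\<tau>', j) = opp (\<tau>, i)"
      using side_image_eq_cases[OF s] by blast
    then show ?thesis
    proof cases
      case 1
      then show ?thesis using 2 inj_onD[OF triangle_inj_side[OF assms(1), of i], of x x'] eq by simp
    qed (use 2 in blast)
  qed
qed

text \<open>The surface carries the quotient topology: since the triangles are compact, their
  parametrizations are closed maps.\<close>

lemma openin_surface:
  assumes V: "V \<subseteq> surface"
    and op: "\<And>\<tau>. \<tau> \<in> T \<Longrightarrow> openin (top_of_set ideal_triangle) {x \<in> ideal_triangle. \<tau> x \<in> V}"
  shows "openin (top_of_set surface) V"
proof -
  have "\<exists>K. closed K \<and> {x \<in> ideal_triangle. \<tau> x \<notin> V} = ideal_triangle \<inter> K" if "\<tau> \<in> T" for \<tau>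
  proof -
    have "closedin (top_of_set ideal_triangle) (ideal_triangle - {x \<in> ideal_triangle. \<tau> x \<in> V})"
      using op[OF that] by (simp add: closedin_diff)
    moreover have "ideal_triangle - {x \<in> ideal_triangle. \<tau> x \<in> V} = {x \<in> ideal_triangle. \<tau> x \<notin> V}"
      by blast
    ultimately show ?thesis by (simp add: closedin_closed)
  qed
  then have "\<forall>\<tau>\<in>T. \<exists>K. closed K \<and> {x \<in> ideal_triangle. \<tau> x \<notin> V} = ideal_triangle \<inter> K"
    by (rule ballI)
  from bchoice[OF this] obtain K where
    "\<forall>\<tau>\<in>T. closed (K \<tau>) \<and> {x \<in> ideal_triangle. \<tau> x \<notin> V} = ideal_triangle \<inter> K \<tau>" ..
  then have K: "\<And>\<tau>. \<tau> \<in> T \<Longrightarrow> closed (K \<tau>)"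
      "\<And>\<tau>. \<tau> \<in> T \<Longrightarrow> {x \<in> ideal_triangle. \<tau> x \<notin> V} = ideal_triangle \<inter> K \<tau>"
    by simp_all
  have "closed (\<tau> ` (std_triangle \<inter> K \<tau>))" if "\<tau> \<in> T" for \<tau>
  proof (intro compact_imp_closed compact_continuous_image)
    show "continuous_on (std_triangle \<inter> K \<tau>) \<tau>"
      by (rule continuous_on_subset[OF triangle_continuous[OF that]]) blast
    show "compact (std_triangle \<inter> K \<tau>)"
      using compact_std_triangle K(1)[OF that] by (rule compact_Int_closed)
  qed
  then have "closed (\<Union>\<tau>\<in>T. \<tau> ` (std_triangle \<inter> K \<tau>))"
    using finite_T by (intro closed_UN) auto
  \<comment> \<open>The compact sets on the right may contain vertices, but these go to
    \<open>P\<close> and disappear in the intersection with the surface.\<close>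
  moreover have "surface - V = surface \<inter> (\<Union>\<tau>\<in>T. \<tau> ` (std_triangle \<inter> K \<tau>))"
  proof (intro equalityI subsetI)
    fix y assume y: "y \<in> surface - V"
    then obtain \<tau> x where x: "\<tau> \<in> T" "x \<in> ideal_triangle" "y = \<tau> x"
      using surface_cover[of y] by blast
    then have "x \<in> K \<tau>" using K(2)[OF x(1)] y by blast
    then show "y \<in> surface \<inter> (\<Union>\<tau>\<in>T. \<tau> ` (std_triangle \<inter> K \<tau>))"
      using x y unfolding ideal_triangle_iff by blast
  next
    fix y assume y: "y \<in> surface \<inter> (\<Union>\<tau>\<in>T. \<tau> ` (std_triangle \<inter> K \<tau>))"
    then obtain \<tau> x where x: "\<tau> \<in> T" "x \<in> std_triangle" "x \<in> K \<tau>" "y = \<tau> x" by blast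
    then have "x \<in> ideal_triangle" using ideal_of_surface y by blast
    then show "y \<in> surface - V" using K(2)[OF x(1)] x y by blast
  qed
  ultimately have "closedin (top_of_set surface) (surface - V)"
    by (simp add: closedin_closed_Int)
  then show ?thesis using V by (simp add: openin_closedin_eq)
qed

lemma openin_triangle_preimage:
  assumes "openin (top_of_set surface) V" "\<tau> \<in> T"
  shows "openin (top_of_set ideal_triangle) {x \<in> ideal_triangle. \<tau> x \<in> V}"
proof -
  have "openin (top_of_set ideal_triangle) (ideal_triangle \<inter> \<tau> -` V)"
    using continuous_on_ideal_triangle[OF assms(2)] in_surface[OF assms(2)] assms(1)
    by (intro continuous_openin_preimage[where T = surface]) auto
  moreover have "ideal_triangle \<inter> \<tau> -` V = {x \<in> ideal_triangle. \<tau> x \<in> V}" by blast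
  ultimately show ?thesis by simp
qed

lemma continuous_on_surface:
  fixes f :: "'a \<Rightarrow> 'b::topological_space"
  assumes V: "openin (top_of_set surface) V"
    and cont: "\<And>\<tau>. \<tau> \<in> T \<Longrightarrow> continuous_on {x \<in> ideal_triangle. \<tau> x \<in> V} (\<lambda>x. f (\<tau> x))"
  shows "continuous_on V f"
  unfolding continuous_on_open_invariant
proof (intro allI impI)
  fix B :: "'b set" assume B: "open B"
  let ?W = "{y \<in> V. f y \<in> B}"
  have VS: "V \<subseteq> surface" using V openin_imp_subset by blast
  have "openin (top_of_set surface) ?W"
  proof (rule openin_surface)
    fix \<tau> assume \<tau>: "\<tau> \<in> T"
    let ?D = "{x \<in> ideal_triangle. \<tau> x \<in> V}"
    have "openin (top_of_set ?D) (?D \<inter> (\<lambda>x. f (\<tau> x)) -` B)"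
      using cont[OF \<tau>] B by (rule continuous_openin_preimage_gen)
    then have "openin (top_of_set ideal_triangle) (?D \<inter> (\<lambda>x. f (\<tau> x)) -` B)"
      using openin_triangle_preimage[OF V \<tau>] openin_trans by blast
    moreover have "?D \<inter> (\<lambda>x. f (\<tau> x)) -` B = {x \<in> ideal_triangle. \<tau> x \<in> ?W}" by blast
    ultimately show "openin (top_of_set ideal_triangle) {x \<in> ideal_triangle. \<tau> x \<in> ?W}" by simp
  qed (use VS in blast)
  then obtain A where "open A" "?W = surface \<inter> A" unfolding openin_open by blast
  then show "\<exists>A. open A \<and> A \<inter> V = f -` B \<inter> V"
    using VS by (intro exI[of _ A]) blast
qed

text \<open>The universal property of the quotient: functions on the triangles that agree on paired
  sides descend, since no other points are identified.\<close>

lemma glue_on_surface: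
  fixes F :: "(real^3 \<Rightarrow> 'a) \<Rightarrow> real^3 \<Rightarrow> 'b::topological_space"
  assumes V: "openin (top_of_set surface) V"
    and cont: "\<And>\<tau>. \<tau> \<in> T \<Longrightarrow> continuous_on {x \<in> ideal_triangle. \<tau> x \<in> V} (F \<tau>)"
    and compat: "\<And>\<tau> i \<tau>' i' x x'. (\<tau>, i) \<in> sides \<Longrightarrow> (\<tau>', i') = opp (\<tau>, i) \<Longrightarrow> x \<in> open_side i \<Longrightarrow>
      x' \<in> open_side i' \<Longrightarrow> \<tau> x = \<tau>' x' \<Longrightarrow> \<tau> x \<in> V \<Longrightarrow> F \<tau> x = F \<tau>' x'"
  obtains f where "continuous_on V f"
    "\<And>\<tau> x. \<tau> \<in> T \<Longrightarrow> x \<in> ideal_triangle \<Longrightarrow> \<tau> x \<in> V \<Longrightarrow> f (\<tau> x) = F \<tau> x"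
proof -
  \<comment> \<open>An arbitrary representative of the point; \<open>compat\<close> removes the
    dependence on the choice.\<close>
  define r where "r y = (SOME r. fst r \<in> T \<and> snd r \<in> ideal_triangle \<and> y = fst r (snd r))" for y
  define f where "f y = F (fst (r y)) (snd (r y))" for y
  have f: "f (\<tau> x) = F \<tau> x" if \<tau>: "\<tau> \<in> T" and x: "x \<in> ideal_triangle" and V: "\<tau> x \<in> V" for \<tau> x
  proof -
    have r: "fst (r (\<tau> x)) \<in> T \<and> snd (r (\<tau> x)) \<in> ideal_triangle \<and> \<tau> x = fst (r (\<tau> x)) (snd (r (\<tau> x)))"
      unfolding r_def by (rule someI[of _ "(\<tau>, x)"]) (use \<tau> x in simp)
    have "\<tau> = fst (r (\<tau> x)) \<and> x = snd (r (\<tau> x)) \<or>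
       (\<exists>i i'. x \<in> open_side i \<and> snd (r (\<tau> x)) \<in> open_side i' \<and> (fst (r (\<tau> x)), i') = opp (\<tau>, i))"
      by (rule triangle_eq_cases) (use \<tau> x r in auto)
    then show ?thesis
    proof
      assume "\<exists>i i'. x \<in> open_side i \<and> snd (r (\<tau> x)) \<in> open_side i' \<and> (fst (r (\<tau> x)), i') = opp (\<tau>, i)"
      then obtain i i' where "x \<in> open_side i" "snd (r (\<tau> x)) \<in> open_side i'" "(fst (r (\<tau> x)), i') = opp (\<tau>, i)"
        by blast
      then show ?thesis unfolding f_def using compat[of \<tau> i "fst (r (\<tau> x))" i' x "snd (r (\<tau> x))"] \<tau> r V by simp
    qed (simp add: f_def)
  qed
  have "continuous_on V f"
    by (rule continuous_on_surface[OF V], rule continuous_on_eq[OF cont]) (auto simp: f)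
  then show thesis using f that by blast
qed

subsection \<open>Circle-valued functions dual to the edges\<close>

text \<open>Across the edge the angle runs from pi at the barycenter of \<open>fst s\<close> through
  0 on the edge to - pi at the barycenter of \<open>fst (opp s)\<close>. So the value makes one full
  turn, and it is -1 outside the neighbourhood of the edge.\<close>

definition edge_function :: "(real^3 \<Rightarrow> 'a) \<times> 3 \<Rightarrow> (real^3 \<Rightarrow> 'a) \<Rightarrow> real^3 \<Rightarrow> complex" where
  "edge_function s \<tau> x =
    (if \<tau> = fst s then cis (pi * side_coord (snd s) x)
     else if \<tau> = fst (opp s) then cis (- (pi * side_coord (snd (opp s)) x)) else -1)"

text \<open>On open sides the value is 1 for the two sides that form the edge and -1 for all others,
  so it is the same from both adjacent triangles.\<close>

lemma edge_function_glued:
  assumes s: "s \<in> sides"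
  obtains u where "continuous_on surface u"
    "\<And>\<tau> x. \<tau> \<in> T \<Longrightarrow> x \<in> ideal_triangle \<Longrightarrow> u (\<tau> x) = edge_function s \<tau> x"
proof -
  have m: "cis (- pi) = -1" by (simp add: complex_eq_iff)
  have on_side: "edge_function s \<tau> x = (if (\<tau>, i) = s \<or> (\<tau>, i) = opp s then 1 else -1)"
    if "x \<in> open_side i" for \<tau> x i
    using that side_coord_open_side[OF that] side_coord_other_side[OF that] fst_opp_neq[OF s]
    by (auto simp: edge_function_def prod_eq_iff m)
  have cont: "continuous_on {x \<in> ideal_triangle. \<tau> x \<in> surface} (edge_function s \<tau>)" for \<tau>
  proof (rule continuous_on_subset[of ideal_triangle])
    consider "\<tau> = fst s" | "\<tau> \<noteq> fst s" "\<tau> = fst (opp s)" | "\<tau> \<noteq> fst s" "\<tau> \<noteq> fst (opp s)" by blast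
    then show "continuous_on ideal_triangle (edge_function s \<tau>)"
      by cases (simp_all add: edge_function_def[abs_def] continuous_on_cis continuous_on_side_coord
          continuous_on_mult_left continuous_on_minus)
  qed blast
  show thesis
  proof (rule glue_on_surface[OF _ cont])
    fix \<tau> i \<tau>' i' x x'
    assume *: "(\<tau>, i) \<in> sides" "(\<tau>', i') = opp (\<tau>, i)" "x \<in> open_side i" "x' \<in> open_side i'"
    then have "(\<tau>, i) = s \<or> (\<tau>, i) = opp s \<longleftrightarrow> (\<tau>', i') = s \<or> (\<tau>', i') = opp s"
      using opp_opp[OF s] opp_opp[OF *(1)] by metis
    then show "edge_function s \<tau> x = edge_function s \<tau>' x'"
      using on_side[OF *(3), of \<tau>] on_side[OF *(4), of \<tau>'] by simp
  next
    fix f assume f: "continuous_on surface f"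
      "\<And>\<tau> x. \<tau> \<in> T \<Longrightarrow> x \<in> ideal_triangle \<Longrightarrow> \<tau> x \<in> surface \<Longrightarrow> f (\<tau> x) = edge_function s \<tau> x"
    show thesis by (rule that[OF f(1)]) (use f(2) in_surface in blast)
  qed auto
qed

lemma edge_function_neq:
  assumes s: "s \<in> sides" and \<tau>: "\<tau> \<in> T" and ne: "edge_function s \<tau> x \<noteq> -1"
  obtains i where "side_image (\<tau>, i) = side_image s" "side_coord i x \<noteq> 1"
proof (cases "\<tau> = fst s")
  case True
  then have "side_coord (snd s) x \<noteq> 1" using ne by (auto simp: edge_function_def)
  then show thesis using that[of "snd s"] True by simp
next
  case False
  then have "\<tau> = fst (opp s)" using ne by (auto simp: edge_function_def split: if_splits)
  moreover from this have "side_coord (snd (opp s)) x \<noteq> 1" using ne False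
    by (auto simp: edge_function_def simp flip: cis_cnj)
  ultimately show thesis using that[of "snd (opp s)"] opp(3)[OF s] by simp
qed

lemma norm_edge_function: "cmod (edge_function s \<tau> x) = 1"
  by (simp add: edge_function_def)

subsection \<open>Crossing paths\<close>

text \<open>The point is chosen in the image of the side and then pulled back. As a side and its
  opposite have the same image, they get the same point of the surface, and half crossings from both
  triangles meet.\<close>

definition edge_point :: "(real^3 \<Rightarrow> 'a) \<times> 3 \<Rightarrow> real^3" where
  "edge_point s = inv_into (open_side (snd s)) (fst s) (SOME y. y \<in> side_image s)"

lemma edge_point:
  assumes "s \<in> sides"
  shows "edge_point s \<in> open_side (snd s)" "fst (opp s) (edge_point (opp s)) = fst s (edge_point s)"
proof -
  have ne: "side_image s' \<noteq> {}" for s' :: "(real^3 \<Rightarrow> 'a) \<times> 3"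
    using open_side_nonempty by (simp add: side_image_def)
  have some: "(SOME y. y \<in> side_image s') \<in> fst s' ` open_side (snd s')" for s' :: "(real^3 \<Rightarrow> 'a) \<times> 3"
    using someI_ex[of "\<lambda>y. y \<in> side_image s'"] ne[of s'] unfolding side_image_def by blast
  show "edge_point s \<in> open_side (snd s)"
    unfolding edge_point_def by (rule inv_into_into[OF some])
  have "fst s' (edge_point s') = (SOME y. y \<in> side_image s')" for s'
    unfolding edge_point_def by (rule f_inv_into_f[OF some])
  then show "fst (opp s) (edge_point (opp s)) = fst s (edge_point s)"
    using opp(3)[OF assms] by simp
qed

definition half_crossing :: "(real^3 \<Rightarrow> 'a) \<times> 3 \<Rightarrow> real \<Rightarrow> 'a" where
  "half_crossing s = fst s \<circ> linepath barycenter (edge_point s)"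

definition crossing :: "(real^3 \<Rightarrow> 'a) \<times> 3 \<Rightarrow> real \<Rightarrow> 'a" where
  "crossing s = half_crossing s +++ reversepath (half_crossing (opp s))"

text \<open>An open edge together with the two open triangles beside it. These sets are open, cover
  the surface, and are retracts of convex sets.\<close>

definition diamond :: "(real^3 \<Rightarrow> 'a) \<times> 3 \<Rightarrow> 'a set" where
  "diamond s = fst s ` side_nbhd (snd s) \<union> fst (opp s) ` side_nbhd (snd (opp s))"

lemma side_nbhd_subset: "side_nbhd i \<subseteq> ideal_triangle"
  by (auto simp: side_nbhd_def)

lemma diamond_subset: "s \<in> sides \<Longrightarrow> diamond s \<subseteq> surface"
proof -
  assume s: "s \<in> sides"
  have "\<tau> ` side_nbhd i \<subseteq> surface" if "\<tau> \<in> T" for \<tau> i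
    using in_surface[OF that] side_nbhd_subset by (intro image_subsetI) blast
  then show ?thesis
    unfolding diamond_def using fst_side[OF s] fst_opp[OF s] by (intro Un_least)
qed

lemma diamond_opp: "s \<in> sides \<Longrightarrow> diamond (opp s) = diamond s"
  unfolding diamond_def by (simp add: opp_opp Un_commute)

lemma path_in_triangle:
  assumes "\<tau> \<in> T" "A \<subseteq> ideal_triangle" "convex A" "x \<in> A" "y \<in> A"
  shows "path_in (\<tau> ` A) (\<tau> x) (\<tau> y) (\<tau> \<circ> linepath x y)"
proof -
  have sub: "path_image (linepath x y) \<subseteq> A" using assms by (simp add: convex_contains_segment)
  then have "path (\<tau> \<circ> linepath x y)"
    using continuous_on_ideal_triangle[OF assms(1)] assms(2)
    by (intro path_continuous_image) (auto intro: continuous_on_subset)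
  then show ?thesis
    using sub by (auto simp: path_in_def path_image_compose pathstart_compose pathfinish_compose)
qed

lemma path_in_subset: "path_in S a b p \<Longrightarrow> S \<subseteq> S' \<Longrightarrow> path_in S' a b p"
  by (auto simp: path_in_def)

lemma half_crossing_from_to:
  assumes s: "s \<in> sides"
  shows "path_in (diamond s) (fst s barycenter) (fst s (edge_point s)) (half_crossing s)"
proof -
  have "path_in (fst s ` side_nbhd (snd s)) (fst s barycenter) (fst s (edge_point s)) (half_crossing s)"
    unfolding half_crossing_def using s edge_point(1)[OF s] barycenter_open
    by (intro path_in_triangle side_nbhd_subset convex_side_nbhd)
      (auto simp: side_nbhd_eq)
  then show ?thesis by (rule path_in_subset) (auto simp: diamond_def)
qed

lemma crossing_from_to:
  assumes s: "s \<in> sides"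
  shows "path_in (diamond s) (fst s barycenter) (fst (opp s) barycenter) (crossing s)"
proof -
  have "path_in (diamond s) (fst (opp s) barycenter) (fst s (edge_point s)) (half_crossing (opp s))"
    using half_crossing_from_to[OF opp(1)[OF s]] edge_point(2)[OF s] by (simp add: diamond_opp[OF s])
  then show ?thesis
    unfolding crossing_def
    by (rule path_in_join[OF half_crossing_from_to[OF s] path_in_reversepath])
qed

lemma crossing_opp:
  assumes s: "s \<in> sides"
  shows "crossing (opp s) = reversepath (crossing s)"
proof -
  have "pathfinish (half_crossing s) = pathfinish (half_crossing (opp s))"
    using half_crossing_from_to[OF s] half_crossing_from_to[OF opp(1)[OF s]] edge_point(2)[OF s]
    by (simp add: path_in_def)
  then show ?thesis by (simp add: crossing_def reversepath_joinpaths opp_opp[OF s])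
qed

text \<open>An explicit lift along a crossing: the coordinate of the first side falls from 1 to 0,
  and minus that of the second side continues from 0 to -1. Strictly inside the crossing it stays
  away from the lifts 1 and -1 of the value -1.\<close>

lemma crossing_angle:
  assumes s: "s \<in> sides" and s0: "s0 = s \<or> s0 = opp s"
    and u: "\<And>\<tau> x. \<tau> \<in> T \<Longrightarrow> x \<in> ideal_triangle \<Longrightarrow> u (\<tau> x) = edge_function s0 \<tau> x"
  obtains g where "continuous_on {0..1} g" "\<And>r. r \<in> {0..1} \<Longrightarrow> u (crossing s r) = cis (pi * g r)"
    "g 0 \<noteq> g 1" "\<And>r. r \<in> {0<..<1} \<Longrightarrow> \<bar>g r\<bar> < 1"
proof -
  define \<theta> where "\<theta> s r = side_coord (snd s) (linepath barycenter (edge_point s) r)" for s r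
  have mem: "linepath barycenter (edge_point s) r \<in> ideal_triangle"
    if "s \<in> sides" "r \<in> {0..1}" for s r
    using linepath_barycenter(1)[OF edge_point(1)[OF that(1)] that(2)] side_nbhd_subset by blast
  have \<theta>_path: "path (\<theta> s)" if "s \<in> sides" for s
    unfolding path_def \<theta>_def
    by (rule continuous_on_compose2[OF continuous_on_side_coord])
      (use mem[OF that] in \<open>auto intro: continuous_on_linepath\<close>)
  have \<theta>0: "\<theta> s 0 = 1" for s by (simp add: \<theta>_def linepath_def side_coord_barycenter)
  have \<theta>1: "\<theta> s 1 = 0" if "s \<in> sides" for s
    using side_coord_open_side[OF edge_point(1)[OF that]] by (simp add: \<theta>_def linepath_def)
  have \<theta>_range: "0 \<le> \<theta> s r" "r > 0 \<Longrightarrow> \<theta> s r < 1" if "s \<in> sides" "r \<in> {0..1}" for s r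
    using side_coord_range(1)[OF mem[OF that]] linepath_barycenter(2)[OF edge_point(1)[OF that(1)] that(2)]
    by (simp_all add: \<theta>_def)
  \<comment> \<open>The edge may be represented by either of its sides, and exchanging them reverses
    the angle.\<close>
  define \<epsilon> :: real where "\<epsilon> = (if s0 = s then 1 else -1)"
  define g where "g r = \<epsilon> * (\<theta> s +++ (\<lambda>r. - reversepath (\<theta> (opp s)) r)) r" for r
  note so = opp(1)[OF s]
  have pth: "path (\<theta> s +++ (\<lambda>r. - reversepath (\<theta> (opp s)) r))"
  proof (rule path_join_imp)
    have "path (reversepath (\<theta> (opp s)))" using \<theta>_path[OF so] by simp
    then show "path (\<lambda>r. - reversepath (\<theta> (opp s)) r)"
      unfolding path_def by (rule continuous_on_minus)
    show "pathfinish (\<theta> s) = pathstart (\<lambda>r. - reversepath (\<theta> (opp s)) r)"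
      using \<theta>1[OF s] \<theta>1[OF so] by (simp add: pathfinish_def pathstart_def reversepath_def)
  qed (rule \<theta>_path[OF s])
  have u_half: "u (half_crossing s' r) = cis (pi * (\<epsilon> * (if s' = s then \<theta> s' r else - \<theta> s' r)))"
    if cases: "s' = s \<or> s' = opp s" and r: "r \<in> {0..1}" for s' r
  proof -
    have s': "s' \<in> sides" using cases s so by blast
    have "u (half_crossing s' r) = edge_function s0 (fst s') (linepath barycenter (edge_point s') r)"
      unfolding half_crossing_def comp_def using u mem[OF s' r] fst_side[OF s'] by blast
    also have "\<dots> = cis (pi * (\<epsilon> * (if s' = s then \<theta> s' r else - \<theta> s' r)))"
    proof -
      consider "s0 = s" "s' = s" | "s0 = s" "s' = opp s" | "s0 = opp s" "s' = s"
        | "s0 = opp s" "s' = opp s" using cases s0 by blast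
      then show ?thesis
        by cases (simp_all add: edge_function_def \<theta>_def \<epsilon>_def opp(2)[OF s] fst_opp_neq[OF s]
            fst_opp_neq[OF s, symmetric] opp_opp[OF s])
    qed
    finally show ?thesis .
  qed
  show thesis
  proof (rule that[of g])
    show "continuous_on {0..1} g"
      using pth unfolding g_def path_def by (intro continuous_intros)
    show "u (crossing s r) = cis (pi * g r)" if r: "r \<in> {0..1}" for r
    proof (cases "r \<le> 1 / 2")
      case True
      then show ?thesis
        using u_half[of s "2 * r"] r by (simp add: crossing_def joinpaths_def g_def)
    next
      case False
      then show ?thesis
        using u_half[of "opp s" "1 - (2 * r - 1)"] r opp(2)[OF s]
        by (simp add: crossing_def joinpaths_def g_def reversepath_def)
    qed
    have "g 0 = \<epsilon>" "g 1 = - \<epsilon>"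
      using \<theta>0 by (simp_all add: g_def joinpaths_def reversepath_def)
    then show "g 0 \<noteq> g 1" by (simp add: \<epsilon>_def)
    show "\<bar>g r\<bar> < 1" if r: "r \<in> {0<..<1}" for r
    proof (cases "r \<le> 1 / 2")
      case True
      then show ?thesis
        using \<theta>_range[OF s, of "2 * r"] r by (simp add: joinpaths_def g_def \<epsilon>_def)
    next
      case False
      then show ?thesis
        using \<theta>_range[OF so, of "1 - (2 * r - 1)"] r
        by (simp add: joinpaths_def g_def reversepath_def \<epsilon>_def)
    qed
  qed
qed

subsection \<open>Diamonds are simply connected\<close>

text \<open>A point of a triangle is identified with other points only on its sides. Each half of
  the diamond contains a single side, whose partner is the side of the other half.\<close>

lemma diamond_preimage:
  assumes s: "s \<in> sides" and \<tau>: "\<tau> \<in> T" and x: "x \<in> ideal_triangle"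
  shows "\<tau> x \<in> diamond s \<longleftrightarrow> \<tau> = fst s \<and> x \<in> side_nbhd (snd s) \<or>
    \<tau> = fst (opp s) \<and> x \<in> side_nbhd (snd (opp s))"
proof
  assume "\<tau> x \<in> diamond s"
  then obtain t x' where t: "t = s \<or> t = opp s" and x': "x' \<in> side_nbhd (snd t)" "\<tau> x = fst t x'"
    unfolding diamond_def by blast
  have ts: "t \<in> sides" using t s opp(1)[OF s] by auto
  have t': "opp t = s \<or> opp t = opp s" using t opp_opp[OF s] by auto
  have "\<tau> = fst t \<and> x = x' \<or>
      (\<exists>i i'. x \<in> open_side i \<and> x' \<in> open_side i' \<and> (fst t, i') = opp (\<tau>, i))"
    by (rule triangle_eq_cases[OF \<tau> fst_side[OF ts] x _ x'(2)]) (use x'(1) side_nbhd_subset in blast)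
  then show "\<tau> = fst s \<and> x \<in> side_nbhd (snd s) \<or>
      \<tau> = fst (opp s) \<and> x \<in> side_nbhd (snd (opp s))"
  proof
    assume "\<tau> = fst t \<and> x = x'"
    then show ?thesis using t x'(1) by auto
  next
    assume "\<exists>i i'. x \<in> open_side i \<and> x' \<in> open_side i' \<and> (fst t, i') = opp (\<tau>, i)"
    then obtain i i' where i: "x \<in> open_side i" "x' \<in> open_side i'" "(fst t, i') = opp (\<tau>, i)" by blast
    have "i' = snd t" using side_nbhd_side[OF x'(1) i(2)] .
    then have "t = opp (\<tau>, i)" using i(3) by simp
    moreover have "(\<tau>, i) \<in> sides" using \<tau> by simp
    ultimately have e: "opp t = (\<tau>, i)" using opp_opp by simp
    have "\<tau> = fst (opp t)" "x \<in> side_nbhd (snd (opp t))"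
      unfolding e using i(1) by (simp_all add: side_nbhd_eq)
    then show ?thesis using t' by auto
  qed
qed (auto simp: diamond_def)

lemma openin_diamond:
  assumes s: "s \<in> sides"
  shows "openin (top_of_set surface) (diamond s)"
proof (rule openin_surface[OF diamond_subset[OF s]])
  fix \<tau> assume \<tau>: "\<tau> \<in> T"
  consider "\<tau> = fst s" | "\<tau> = fst (opp s)" "\<tau> \<noteq> fst s" | "\<tau> \<noteq> fst s" "\<tau> \<noteq> fst (opp s)" by blast
  \<comment> \<open>Because the two triangles are distinct, no preimage is the union of two side
    neighbourhoods.\<close>
  then have "{x \<in> ideal_triangle. \<tau> x \<in> diamond s} \<in>
      {side_nbhd (snd s), side_nbhd (snd (opp s)), {}}"
    using diamond_preimage[OF s \<tau>] side_nbhd_subset fst_opp_neq[OF s] by cases auto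
  then show "openin (top_of_set ideal_triangle) {x \<in> ideal_triangle. \<tau> x \<in> diamond s}"
    by (elim insertE emptyE) (simp_all only: openin_side_nbhd openin_empty)
qed

lemma diamond_cover:
  assumes "y \<in> surface"
  obtains s where "s \<in> sides" "y \<in> diamond s"
proof -
  obtain \<tau> x where x: "\<tau> \<in> T" "x \<in> ideal_triangle" "y = \<tau> x" using assms by (rule surface_cover)
  obtain i where "x \<in> side_nbhd i"
    using ideal_triangle_cases[OF x(2)] by (auto simp: side_nbhd_eq)
  then have "y \<in> diamond (\<tau>, i)" using x(3) by (simp add: diamond_def)
  then show thesis using that[of "(\<tau>, i)"] x(1) by simp
qed

lemma diamond_eq:
  assumes "s \<in> sides" "s' \<in> sides" "side_image s = side_image s'"
  shows "diamond s = diamond s'"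
  using side_image_eq_cases[OF assms(1,2)] assms(3) diamond_opp[OF assms(1)] by auto

text \<open>A diamond contains no edge other than its own. A common point off the open triangles
  therefore lies on an edge that both diamonds share.\<close>

lemma diamond_inter:
  assumes s: "s \<in> sides" and s': "s' \<in> sides" and y: "y \<in> diamond s" "y \<in> diamond s'"
  shows "side_image s = side_image s' \<or> (\<exists>\<sigma> x. \<sigma> \<in> {fst s, fst (opp s)} \<and>
    \<sigma> \<in> {fst s', fst (opp s')} \<and> x \<in> open_triangle \<and> y = \<sigma> x)"
proof -
  obtain \<tau> x where x: "\<tau> \<in> T" "x \<in> ideal_triangle" "y = \<tau> x"
    using surface_cover[of y] diamond_subset[OF s] y by blast
  obtain t where t: "t = s \<or> t = opp s" "\<tau> = fst t" "x \<in> side_nbhd (snd t)"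
    using diamond_preimage[OF s x(1,2)] y(1) x(3) by blast
  obtain t' where t': "t' = s' \<or> t' = opp s'" "\<tau> = fst t'" "x \<in> side_nbhd (snd t')"
    using diamond_preimage[OF s' x(1,2)] y(2) x(3) by blast
  show ?thesis
  proof (cases "x \<in> open_triangle")
    case True
    then show ?thesis using t t' x by blast
  next
    case False
    then obtain k where "x \<in> open_side k" using ideal_triangle_cases[OF x(2)] by blast
    then have "snd t = snd t'"
      using side_nbhd_side[OF t(3)] side_nbhd_side[OF t'(3)] by simp
    then have "t = t'" using t(2) t'(2) by (simp add: prod_eq_iff)
    then show ?thesis using t(1) t'(1) opp(3)[OF s] opp(3)[OF s'] by auto
  qed
qed

section \<open>Gluing maps between paired sides, and charts of diamonds\<close>

definition edge_map :: "(real^3 \<Rightarrow> 'a) \<times> 3 \<Rightarrow> real^3 \<Rightarrow> real^3" where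
  "edge_map s z = inv_into (open_side (snd (opp s))) (fst (opp s)) (fst s z)"

lemma edge_map:
  assumes s: "s \<in> sides" and z: "z \<in> open_side (snd s)"
  shows "edge_map s z \<in> open_side (snd (opp s))" "fst (opp s) (edge_map s z) = fst s z"
proof -
  have "fst s z \<in> side_image (opp s)"
    unfolding opp(3)[OF s] using z by (simp add: side_image_def)
  then have m: "fst s z \<in> fst (opp s) ` open_side (snd (opp s))" by (simp add: side_image_def)
  show "edge_map s z \<in> open_side (snd (opp s))" unfolding edge_map_def by (rule inv_into_into[OF m])
  show "fst (opp s) (edge_map s z) = fst s z" unfolding edge_map_def by (rule f_inv_into_f[OF m])
qed

lemma edge_map_unique:
  assumes s: "s \<in> sides" and x: "x \<in> open_side (snd (opp s))" and eq: "fst (opp s) x = fst s z"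
  shows "edge_map s z = x"
  unfolding edge_map_def eq[symmetric]
  by (rule inv_into_f_f[OF triangle_inj_side[OF fst_opp[OF s]] x])

lemma edge_map_edge_map:
  assumes s: "s \<in> sides" and z: "z \<in> open_side (snd s)"
  shows "edge_map (opp s) (edge_map s z) = z"
  by (rule edge_map_unique[OF opp(1)[OF s]]) (use z edge_map(2)[OF s z] opp_opp[OF s] in auto)

text \<open>Open sides are not compact, so closed sets are first enlarged to the closed triangle:
  their images are compact, and preimages of those are closed. The vertices added in this way are
  harmless, since they do not map into the surface.\<close>

lemma continuous_on_edge_map:
  assumes s: "s \<in> sides"
  shows "continuous_on (open_side (snd s)) (edge_map s)"
  unfolding continuous_on_closed_invariant
proof (intro allI impI)
  fix B :: "(real^3) set" assume B: "closed B"
  let ?j = "snd (opp s)"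
  let ?K = "std_triangle \<inter> ({x. x $ ?j = 0} \<inter> B)"
  let ?A = "std_triangle \<inter> fst s -` (fst (opp s) ` ?K)"
  have "closed {x::real^3. x $ ?j = 0}" by (intro closed_Collect_eq continuous_intros)
  then have "compact ?K" using B compact_std_triangle by (intro compact_Int_closed closed_Int)
  then have "closed (fst (opp s) ` ?K)"
    using triangle_continuous[OF fst_opp[OF s]]
    by (intro compact_imp_closed compact_continuous_image) (auto elim: continuous_on_subset)
  then have "closed ?A"
    by (rule continuous_closed_preimage[OF triangle_continuous[OF fst_side[OF s]]
          compact_imp_closed[OF compact_std_triangle]])
  moreover have "?A \<inter> open_side (snd s) = edge_map s -` B \<inter> open_side (snd s)"
  proof (intro equalityI subsetI)
    fix z assume z: "z \<in> ?A \<inter> open_side (snd s)"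
    then obtain x where x: "x \<in> std_triangle" "x $ ?j = 0" "x \<in> B" "fst s z = fst (opp s) x" by blast
    have "z \<in> ideal_triangle" using z open_side_subset by blast
    then have "fst (opp s) x \<in> surface"
      using in_surface[OF fst_side[OF s], of z] x(4) by simp
    then have "x \<in> ideal_triangle" using ideal_of_surface[OF fst_opp[OF s] x(1)] by simp
    then have "x \<in> open_side ?j"
      using ideal_triangle_two_pos[of x ?j] x(1,2) by (simp add: open_side_def)
    then have "edge_map s z = x" using edge_map_unique[OF s] x(4) by simp
    then show "z \<in> edge_map s -` B \<inter> open_side (snd s)" using x(3) z by simp
  next
    fix z assume z: "z \<in> edge_map s -` B \<inter> open_side (snd s)"
    then have e: "edge_map s z \<in> open_side ?j" "fst (opp s) (edge_map s z) = fst s z"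
      using edge_map[OF s] by auto
    then have "edge_map s z \<in> ?K" using z by (simp add: open_side_def)
    then have "fst s z \<in> fst (opp s) ` ?K" using e(2) by (metis imageI)
    then show "z \<in> ?A \<inter> open_side (snd s)" using z by (simp add: open_side_def)
  qed
  ultimately show "\<exists>A. closed A \<and> A \<inter> open_side (snd s) = edge_map s -` B \<inter> open_side (snd s)" by blast
qed

lemma continuous_on_side_lift:
  "continuous_on A h \<Longrightarrow> continuous_on A z \<Longrightarrow> continuous_on A (\<lambda>v. side_lift i (h v) (z v))"
  unfolding side_lift_def by (intro continuous_intros)

text \<open>The coordinates are a signed height, positive in \<open>fst s\<close> and negative in
  \<open>fst (opp s)\<close>, and a position along the edge measured in \<open>fst s\<close>. The
  relation \<open>G (F y) = y\<close> exhibits the diamond as a retract of a convex set, which is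
  enough to contract loops.\<close>

lemma diamond_chart:
  assumes s: "s \<in> sides"
  obtains F G where "continuous_on (diamond s) F" "F \<in> diamond s \<rightarrow> {-1<..<1} \<times> open_side (snd s)"
    "continuous_on ({-1<..<1::real} \<times> open_side (snd s)) G"
    "G \<in> {-1<..<1} \<times> open_side (snd s) \<rightarrow> diamond s"
    "\<And>y. y \<in> diamond s \<Longrightarrow> G (F y) = y"
proof -
  let ?i = "snd s" and ?j = "snd (opp s)" and ?\<tau> = "fst s" and ?\<tau>' = "fst (opp s)"
  let ?V = "{-1<..<1::real} \<times> open_side ?i"
  note so = opp(1)[OF s]
  define G where "G v = (if fst v \<le> 0 then ?\<tau>' (side_lift ?j (- fst v) (edge_map s (snd v)))
    else ?\<tau> (side_lift ?i (fst v) (snd v)))" for v :: "real \<times> (real^3)"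
  have "continuous_on ?V G"
    unfolding G_def
  proof (rule continuous_on_cases_le)
    show "continuous_on {v \<in> ?V. fst v \<le> 0} (\<lambda>v. ?\<tau>' (side_lift ?j (- fst v) (edge_map s (snd v))))"
    proof (rule continuous_on_compose2[OF continuous_on_ideal_triangle[OF fst_opp[OF s]]])
      show "continuous_on {v \<in> ?V. fst v \<le> 0} (\<lambda>v. side_lift ?j (- fst v) (edge_map s (snd v)))"
        by (intro continuous_on_side_lift continuous_on_compose2[OF continuous_on_edge_map[OF s]]
            continuous_intros) auto
      show "(\<lambda>v. side_lift ?j (- fst v) (edge_map s (snd v))) ` {v \<in> ?V. fst v \<le> 0} \<subseteq> ideal_triangle"
      proof (rule image_subsetI)
        fix v assume v: "v \<in> {v \<in> ?V. fst v \<le> 0}"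
        show "side_lift ?j (- fst v) (edge_map s (snd v)) \<in> ideal_triangle"
          by (rule subsetD[OF side_nbhd_subset side_lift_in[OF edge_map(1)[OF s]]]) (use v in auto)
      qed
    qed
    show "continuous_on {v \<in> ?V. 0 \<le> fst v} (\<lambda>v. ?\<tau> (side_lift ?i (fst v) (snd v)))"
    proof (rule continuous_on_compose2[OF continuous_on_ideal_triangle[OF fst_side[OF s]]])
      show "continuous_on {v \<in> ?V. 0 \<le> fst v} (\<lambda>v. side_lift ?i (fst v) (snd v))"
        by (intro continuous_on_side_lift continuous_intros)
      show "(\<lambda>v. side_lift ?i (fst v) (snd v)) ` {v \<in> ?V. 0 \<le> fst v} \<subseteq> ideal_triangle"
      proof (rule image_subsetI)
        fix v assume v: "v \<in> {v \<in> ?V. 0 \<le> fst v}"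
        show "side_lift ?i (fst v) (snd v) \<in> ideal_triangle"
          by (rule subsetD[OF side_nbhd_subset side_lift_in]) (use v in auto)
      qed
    qed
    show "continuous_on ?V fst" by (intro continuous_intros)
    fix v assume "v \<in> ?V" "fst v = 0"
    then show "?\<tau>' (side_lift ?j (- fst v) (edge_map s (snd v))) = ?\<tau> (side_lift ?i (fst v) (snd v))"
      using edge_map(2)[OF s] by auto
  qed
  moreover have "G v \<in> diamond s" if v: "v \<in> ?V" for v
  proof (cases "fst v \<le> 0")
    case True
    then have "side_lift ?j (- fst v) (edge_map s (snd v)) \<in> side_nbhd ?j"
      using v by (intro side_lift_in edge_map(1)[OF s]) auto
    then show ?thesis using True by (simp add: G_def diamond_def)
  next
    case False
    then have "side_lift ?i (fst v) (snd v) \<in> side_nbhd ?i"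
      using v by (intro side_lift_in) auto
    then show ?thesis using False by (simp add: G_def diamond_def)
  qed
  moreover
  \<comment> \<open>The chart read in a single triangle; on the opposite half the gluing map
    transports the position back to the side of \<open>fst s\<close>.\<close>
  define F0 where "F0 \<sigma> x = (if \<sigma> = ?\<tau> then (x $ ?i, side_proj ?i x)
    else (- (x $ ?j), edge_map (opp s) (side_proj ?j x)))" for \<sigma> :: "real^3 \<Rightarrow> 'a" and x :: "real^3"
  obtain F where F: "continuous_on (diamond s) F"
    "\<And>\<sigma> x. \<sigma> \<in> T \<Longrightarrow> x \<in> ideal_triangle \<Longrightarrow> \<sigma> x \<in> diamond s \<Longrightarrow> F (\<sigma> x) = F0 \<sigma> x"
  proof (rule glue_on_surface[OF openin_diamond[OF s], of F0])
    fix \<sigma> assume \<sigma>: "\<sigma> \<in> T"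
    consider "\<sigma> = ?\<tau>" | "\<sigma> = ?\<tau>'" "\<sigma> \<noteq> ?\<tau>" | "\<sigma> \<noteq> ?\<tau>" "\<sigma> \<noteq> ?\<tau>'" by blast
    then show "continuous_on {x \<in> ideal_triangle. \<sigma> x \<in> diamond s} (F0 \<sigma>)"
    proof cases
      case 1
      then have "{x \<in> ideal_triangle. \<sigma> x \<in> diamond s} \<subseteq> side_nbhd ?i"
        using diamond_preimage[OF s \<sigma>] fst_opp_neq[OF s] by auto
      moreover have "continuous_on (side_nbhd ?i) (\<lambda>x. (x $ ?i, side_proj ?i x))"
        by (intro continuous_on_Pair continuous_on_side_proj continuous_intros)
      ultimately show ?thesis
        using 1 by (simp add: F0_def[abs_def] continuous_on_subset)
    next
      case 2
      then have "{x \<in> ideal_triangle. \<sigma> x \<in> diamond s} \<subseteq> side_nbhd ?j"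
        using diamond_preimage[OF s \<sigma>] by auto
      moreover have "continuous_on (side_nbhd ?j) (\<lambda>x. (- (x $ ?j), edge_map (opp s) (side_proj ?j x)))"
        using side_proj_in
        by (intro continuous_on_Pair continuous_on_compose2[OF continuous_on_edge_map[OF so]]
            continuous_on_side_proj continuous_intros) auto
      ultimately show ?thesis
        using 2 by (simp add: F0_def[abs_def] continuous_on_subset)
    next
      case 3
      then have "{x \<in> ideal_triangle. \<sigma> x \<in> diamond s} = {}"
        using diamond_preimage[OF s \<sigma>] by auto
      then show ?thesis by (simp only: continuous_on_empty)
    qed
  next
    fix \<sigma> k \<sigma>' k' x x'
    assume *: "(\<sigma>, k) \<in> sides" "(\<sigma>', k') = opp (\<sigma>, k)" "x \<in> open_side k" "x' \<in> open_side k'"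
      "\<sigma> x = \<sigma>' x'" "\<sigma> x \<in> diamond s"
    have \<sigma>: "\<sigma> \<in> T" using *(1) by simp
    have "x \<in> ideal_triangle" using *(3) open_side_subset by blast
    from diamond_preimage[OF s \<sigma> this] *(6) side_nbhd_side[OF _ *(3)]
    have "\<sigma> = ?\<tau> \<and> k = ?i \<or> \<sigma> = ?\<tau>' \<and> k = ?j" by blast
    \<comment> \<open>A side that meets the diamond is one of the two sides forming its edge, so
      compatibility has to be checked across this edge only.\<close>
    then consider "(\<sigma>, k) = s" | "(\<sigma>, k) = opp s" by (auto simp: prod_eq_iff)
    then show "F0 \<sigma> x = F0 \<sigma>' x'"
    proof cases
      case 1
      then have e: "\<sigma> = ?\<tau>" "k = ?i" "\<sigma>' = ?\<tau>'" "k' = ?j" using *(2) by (auto simp: prod_eq_iff)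
      have "edge_map (opp s) x' = x"
        by (rule edge_map_unique[OF so]) (use * e opp_opp[OF s] in auto)
      then show ?thesis
        using *(3,4) fst_opp_neq[OF s] unfolding F0_def e
        by (simp add: side_proj_open_side) (simp add: open_side_def)
    next
      case 2
      then have "(\<sigma>', k') = s" using *(2) opp_opp[OF s] by simp
      then have e: "\<sigma> = ?\<tau>'" "k = ?j" "\<sigma>' = ?\<tau>" "k' = ?i" using 2 by (auto simp: prod_eq_iff)
      have "edge_map (opp s) x = x'"
        by (rule edge_map_unique[OF so]) (use * e opp_opp[OF s] in auto)
      then show ?thesis
        using *(3,4) fst_opp_neq[OF s] unfolding F0_def e
        by (simp add: side_proj_open_side) (simp add: open_side_def)
    qed
  next
    fix F assume "continuous_on (diamond s) F"
      "\<And>\<sigma> x. \<sigma> \<in> T \<Longrightarrow> x \<in> ideal_triangle \<Longrightarrow> \<sigma> x \<in> diamond s \<Longrightarrow> F (\<sigma> x) = F0 \<sigma> x"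
    then show thesis by (rule that)
  qed
  have FG: "F y \<in> ?V \<and> G (F y) = y" if y: "y \<in> diamond s" for y
  proof -
    obtain \<sigma> x where x: "\<sigma> \<in> T" "x \<in> ideal_triangle" "y = \<sigma> x"
      using surface_cover[of y] diamond_subset[OF s] y by blast
    have Fy: "F y = F0 \<sigma> x" using F(2)[OF x(1,2)] x(3) y by simp
    consider "\<sigma> = ?\<tau>" "x \<in> side_nbhd ?i" | "\<sigma> = ?\<tau>'" "x \<in> side_nbhd ?j"
      using diamond_preimage[OF s x(1,2)] y x(3) by blast
    then show ?thesis
    proof cases
      case 1
      then have F: "F y = (x $ ?i, side_proj ?i x)" by (simp add: Fy F0_def)
      have p: "side_proj ?i x \<in> open_side ?i" by (rule side_proj_in[OF 1(2)])
      have x01: "0 \<le> x $ ?i" "x $ ?i < 1" using x(2) by (auto simp: ideal_triangle_def)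
      have G: "G (x $ ?i, side_proj ?i x) = ?\<tau> x"
      proof (cases "x $ ?i = 0")
        case True
        then have "side_proj ?i x = x" by (simp add: side_proj_def)
        then show ?thesis using True edge_map(2)[OF s p] by (simp add: G_def)
      next
        case False
        then show ?thesis using x01 side_lift_proj[OF x(2)] by (simp add: G_def)
      qed
      show ?thesis unfolding F using G p x01 x(3) 1(1) by simp
    next
      case 2
      then have F: "F y = (- (x $ ?j), edge_map (opp s) (side_proj ?j x))"
        using fst_opp_neq[OF s] by (simp add: Fy F0_def)
      have p: "side_proj ?j x \<in> open_side (snd (opp s))" by (rule side_proj_in[OF 2(2)])
      have x01: "0 \<le> x $ ?j" "x $ ?j < 1" using x(2) by (auto simp: ideal_triangle_def)
      have e: "edge_map (opp s) (side_proj ?j x) \<in> open_side ?i"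
        using edge_map(1)[OF so p] opp_opp[OF s] by simp
      have "edge_map s (edge_map (opp s) (side_proj ?j x)) = side_proj ?j x"
        using edge_map_edge_map[OF so p] opp_opp[OF s] by simp
      then have G: "G (- (x $ ?j), edge_map (opp s) (side_proj ?j x)) = ?\<tau>' x"
        using x01 side_lift_proj[OF x(2)] by (simp add: G_def)
      show ?thesis unfolding F using G e x01 x(3) 2(1) by simp
    qed
  qed
  ultimately show thesis
    by (intro that[of F G] F(1)) auto
qed

text \<open>\<open>F\<close> carries both paths into a convex set, where they are joined by a
  straight-line homotopy; \<open>G\<close> brings it back.\<close>

lemma diamond_homotopic_paths:
  assumes s: "s \<in> sides" and p: "path_in (diamond s) a b p" and q: "path_in (diamond s) a b q"
  shows "p \<simeq> q"
proof -
  obtain F G where FG: "continuous_on (diamond s) F" "F \<in> diamond s \<rightarrow> {-1<..<1::real} \<times> open_side (snd s)"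
    "continuous_on ({-1<..<1} \<times> open_side (snd s)) G"
    "G \<in> {-1<..<1} \<times> open_side (snd s) \<rightarrow> diamond s" "\<And>y. y \<in> diamond s \<Longrightarrow> G (F y) = y"
    using diamond_chart[OF s] by metis
  let ?V = "{-1<..<1::real} \<times> open_side (snd s)"
  have V: "convex ?V" by (intro convex_Times convex_open_side) simp
  have pth: "path (F \<circ> r)" "path_image (F \<circ> r) \<subseteq> ?V" if "path_in (diamond s) a b r" for r
  proof -
    have r: "path r" "path_image r \<subseteq> diamond s" using that by (auto simp: path_in_def)
    show "path (F \<circ> r)"
      using r continuous_on_subset[OF FG(1) r(2)] by (intro path_continuous_image)
    show "path_image (F \<circ> r) \<subseteq> ?V"
      unfolding path_image_compose using r(2) FG(2) by blast
  qed
  have GF: "r \<simeq> G \<circ> (F \<circ> r)" if "path_in (diamond s) a b r" for r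
    using that FG(5) diamond_subset[OF s]
    by (intro homotopic_paths_eq) (auto simp: path_in_def path_image_def image_subset_iff)
  have "homotopic_paths ?V (F \<circ> p) (F \<circ> q)"
  proof (rule homotopic_paths_linear)
    fix t :: real assume t: "t \<in> {0..1}"
    then have "(F \<circ> p) t \<in> ?V" "(F \<circ> q) t \<in> ?V"
      using pth(2)[OF p] pth(2)[OF q] unfolding path_image_def by blast+
    then show "closed_segment ((F \<circ> p) t) ((F \<circ> q) t) \<subseteq> ?V" using V by (rule closed_segment_subset)
  qed (use pth(1)[OF p] pth(1)[OF q] p q in \<open>auto simp: path_in_def pathstart_def pathfinish_def\<close>)
  then have "G \<circ> (F \<circ> p) \<simeq> G \<circ> (F \<circ> q)"
    by (rule homotopic_paths_continuous_image[OF _ FG(3)]) (use FG(4) diamond_subset[OF s] in blast)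
  with GF[OF p] GF[OF q] show ?thesis
    using homotopic_paths_trans homotopic_paths_sym by blast
qed

subsection \<open>Edge words\<close>

text \<open>A letter is a side \<open>s\<close>, read as leaving the triangle \<open>fst s\<close>
  through it and entering \<open>fst (opp s)\<close>. The triangle argument supplies the base of the
  empty word; \<open>walk\<close> ensures that consecutive letters fit.\<close>

primrec word_path :: "(real^3 \<Rightarrow> 'a) \<Rightarrow> ((real^3 \<Rightarrow> 'a) \<times> 3) list \<Rightarrow> real \<Rightarrow> 'a" where
  "word_path \<tau> [] = (\<lambda>_. \<tau> barycenter)"
| "word_path \<tau> (s # w) = crossing s +++ word_path (fst (opp s)) w"

primrec walk :: "(real^3 \<Rightarrow> 'a) \<Rightarrow> ((real^3 \<Rightarrow> 'a) \<times> 3) list \<Rightarrow> (real^3 \<Rightarrow> 'a) \<Rightarrow> bool" where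
  "walk \<tau> [] \<tau>' \<longleftrightarrow> \<tau> \<in> T \<and> \<tau>' = \<tau>"
| "walk \<tau> (s # w) \<tau>' \<longleftrightarrow> s \<in> sides \<and> fst s = \<tau> \<and> walk (fst (opp s)) w \<tau>'"

lemma walk_append: "walk \<tau> (v @ w) \<tau>' \<longleftrightarrow> (\<exists>\<sigma>. walk \<tau> v \<sigma> \<and> walk \<sigma> w \<tau>')"
proof (induction v arbitrary: \<tau>)
  case Nil
  have "\<tau> \<in> T" if "walk \<tau> w \<tau>'" using that by (cases w) auto
  then show ?case by auto
qed auto

lemma barycenter_in_surface: "\<tau> \<in> T \<Longrightarrow> \<tau> barycenter \<in> surface"
  using in_surface barycenter_open open_triangle_subset by blast

lemma barycenter_in_diamond: "fst s barycenter \<in> diamond s" "fst (opp s) barycenter \<in> diamond s"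
  using barycenter_open by (auto simp: diamond_def side_nbhd_eq)

lemma crossing_from_to_surface:
  "s \<in> sides \<Longrightarrow> path_in surface (fst s barycenter) (fst (opp s) barycenter) (crossing s)"
  using path_in_subset[OF crossing_from_to diamond_subset] by blast

lemma word_path_in:
  "walk \<tau> w \<tau>' \<Longrightarrow> path_in surface (\<tau> barycenter) (\<tau>' barycenter) (word_path \<tau> w)"
proof (induction w arbitrary: \<tau>)
  case Nil
  then show ?case using path_in_const[OF barycenter_in_surface] by simp
next
  case (Cons s w)
  then have s: "s \<in> sides" "fst s = \<tau>" "walk (fst (opp s)) w \<tau>'" by simp_all
  show ?case
    using path_in_join[OF crossing_from_to_surface[OF s(1)] Cons.IH[OF s(3)]] s(2) by simp
qed

lemma word_path_append:
  "walk \<tau> v \<sigma> \<Longrightarrow> walk \<sigma> w \<tau>' \<Longrightarrow>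
    word_path \<tau> (v @ w) \<simeq> word_path \<tau> v +++ word_path \<sigma> w"
proof (induction v arbitrary: \<tau>)
  case Nil
  then show ?case
    using homotopic_paths_sym[OF homotopic_const_join[OF word_path_in[OF Nil(2)]]] by simp
next
  case (Cons s v)
  then have s: "s \<in> sides" "walk (fst (opp s)) v \<sigma>" by simp_all
  note c = crossing_from_to_surface[OF s(1)]
  have vw: "walk (fst (opp s)) (v @ w) \<tau>'" using s(2) Cons.prems(2) walk_append by blast
  have "crossing s +++ word_path (fst (opp s)) (v @ w) \<simeq>
      crossing s +++ (word_path (fst (opp s)) v +++ word_path \<sigma> w)"
    by (rule homotopic_join_right[OF
          Cons.IH[OF s(2) Cons.prems(2)] c word_path_in[OF vw]])
  also have "\<dots> \<simeq> (crossing s +++ word_path (fst (opp s)) v) +++ word_path \<sigma> w"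
    by (rule homotopic_paths_sym[OF homotopic_join_assoc[OF c word_path_in[OF s(2)]
          word_path_in[OF Cons.prems(2)]]])
  finally show ?case by simp
qed

text \<open>The crossing of the opposite side is the reverse of the crossing, literally as a
  path.\<close>

lemma word_path_cancel:
  assumes u: "walk \<tau> u (fst s)" and s: "s \<in> sides" and v: "walk (fst s) v \<tau>'"
  shows "word_path \<tau> (u @ s # opp s # v) \<simeq> word_path \<tau> (u @ v)"
proof -
  note c = crossing_from_to_surface[OF s]
  have w: "walk (fst s) (s # opp s # v) \<tau>'"
    using s opp(1)[OF s] v by (simp add: opp_opp)
  have "word_path (fst s) (s # opp s # v) \<simeq> word_path (fst s) v"
    using homotopic_cancel_left[OF c word_path_in[OF v]] by (simp add: crossing_opp[OF s] opp_opp[OF s])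
  then have "word_path \<tau> u +++ word_path (fst s) (s # opp s # v) \<simeq>
      word_path \<tau> u +++ word_path (fst s) v"
    using homotopic_join_cong homotopic_refl word_path_in[OF u]
      word_path_in[OF w] by blast
  from homotopic_paths_trans[OF homotopic_paths_trans[OF word_path_append[OF u w] this]
      homotopic_paths_sym[OF word_path_append[OF u v]]]
  show ?thesis .
qed

lemma walk_snoc_consecutive:
  "walk \<tau> w \<tau>' \<Longrightarrow> Suc i < length w \<Longrightarrow> fst (w ! Suc i) = fst (opp (w ! i))"
proof (induction w arbitrary: \<tau> i)
  case (Cons s w)
  show ?case
  proof (cases i)
    case 0
    then show ?thesis using Cons.prems by (cases w) auto
  next
    case (Suc j)
    then show ?thesis using Cons.IH[of "fst (opp s)" j] Cons.prems by simp
  qed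
qed simp

lemma walk_sides: "walk \<tau> w \<tau>' \<Longrightarrow> set w \<subseteq> sides"
  by (induction w arbitrary: \<tau>) auto

text \<open>At 1 / 2 \<open>joinpaths\<close> evaluates its first path. The closed intervals of the
  subdivision below contain this point, hence the assumption on the ends.\<close>

lemma join_second_half:
  assumes "pathfinish p = pathstart q" "1 / 2 \<le> r"
  shows "(p +++ q) r = q (2 * r - 1)"
proof (cases "r = 1 / 2")
  case True
  show ?thesis
    using assms(1) unfolding True by (simp add: joinpaths_def pathfinish_def pathstart_def)
next
  case False
  then show ?thesis using assms(2) by (simp add: joinpaths_def)
qed

text \<open>Joins are nested to the right, so each letter takes half of the time that remains: the
  crossing \<open>i\<close> ends at 1 - 2^-(i + 1), and the final interval belongs to the constant
  path of the empty word.\<close>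

lemma word_path_times:
  assumes "walk \<tau> w \<tau>'"
  shows "\<exists>t. t 0 = 0 \<and> (\<forall>i<length w. t i < t (Suc i)) \<and> t (length w) \<le> 1 \<and>
    (\<forall>i<length w. \<forall>r\<in>{t i..t (Suc i)}.
      word_path \<tau> w r = crossing (w ! i) ((r - t i) / (t (Suc i) - t i))) \<and>
    (\<forall>r\<in>{t (length w)..1}. word_path \<tau> w r = \<tau>' barycenter)"
  using assms
proof (induction w arbitrary: \<tau>)
  case Nil
  then show ?case by (intro exI[of _ "\<lambda>_. 0"]) auto
next
  case (Cons s w)
  then have s: "s \<in> sides" "walk (fst (opp s)) w \<tau>'" by simp_all
  obtain t where t: "t 0 = 0" "\<And>i. i < length w \<Longrightarrow> t i < t (Suc i)" "t (length w) \<le> 1"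
    "\<And>i r. i < length w \<Longrightarrow> r \<in> {t i..t (Suc i)} \<Longrightarrow>
      word_path (fst (opp s)) w r = crossing (w ! i) ((r - t i) / (t (Suc i) - t i))"
    "\<And>r. r \<in> {t (length w)..1} \<Longrightarrow> word_path (fst (opp s)) w r = \<tau>' barycenter"
    using Cons.IH[OF s(2)] by blast
  have tpos: "i \<le> length w \<Longrightarrow> 0 \<le> t i" for i
  proof (induction i)
    case (Suc i)
    then show ?case using t(2)[of i] by simp
  qed (simp add: t(1))
  define t' where "t' i = (case i of 0 \<Rightarrow> 0 | Suc j \<Rightarrow> 1 / 2 + t j / 2)" for i
  have t'_simps: "t' 0 = 0" "\<And>j. t' (Suc j) = 1 / 2 + t j / 2" by (simp_all add: t'_def)
  have pf: "pathfinish (crossing s) = pathstart (word_path (fst (opp s)) w)"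
    using crossing_from_to_surface[OF s(1)] word_path_in[OF s(2)] by (simp add: path_in_def)
  have second: "word_path \<tau> (s # w) r = word_path (fst (opp s)) w (2 * r - 1)" if "1 / 2 \<le> r" for r
    using join_second_half[OF pf that] by simp
  have "t' i < t' (Suc i)" if "i < length (s # w)" for i
    using that t(1,2) by (cases i) (simp_all add: t'_simps)
  moreover have "word_path \<tau> (s # w) r = crossing ((s # w) ! i) ((r - t' i) / (t' (Suc i) - t' i))"
    if i: "i < length (s # w)" and r: "r \<in> {t' i..t' (Suc i)}" for i r
  proof (cases i)
    case 0
    then show ?thesis using r by (simp add: t'_simps t(1) joinpaths_def mult.commute)
  next
    case (Suc j)
    have j: "j < length w" using i Suc by simp
    have "1 / 2 \<le> r" "2 * r - 1 \<in> {t j..t (Suc j)}"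
      using r Suc tpos[of j] j by (auto simp: t'_simps)
    then have "word_path \<tau> (s # w) r = crossing (w ! j) ((2 * r - 1 - t j) / (t (Suc j) - t j))"
      using second t(4)[OF j] by simp
    also have "(2 * r - 1 - t j) / (t (Suc j) - t j) = (r - t' i) / (t' (Suc i) - t' i)"
      using t(2)[OF j] by (simp add: Suc t'_simps field_simps)
    finally show ?thesis by (simp add: Suc)
  qed
  moreover have "word_path \<tau> (s # w) r = \<tau>' barycenter" if r: "r \<in> {t' (length (s # w))..1}" for r
  proof -
    have "1 / 2 \<le> r" "2 * r - 1 \<in> {t (length w)..1}"
      using r tpos[of "length w"] by (auto simp: t'_simps)
    then show ?thesis using second t(5) by simp
  qed
  ultimately show ?case
    using t(3) by (intro exI[of _ t']) (auto simp: t'_simps(1) t'_simps(2)[of "length w"])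
qed

text \<open>The null homotopy is a square with the word path on its left side and a barycenter on
  the other three. All edge functions are -1 at barycenters, so the separation argument yields two
  consecutive crossings of the same edge.\<close>

lemma nullhomotopic_word_backtracks:
  assumes w: "walk \<tau> w \<tau>" "w \<noteq> []"
    and null: "word_path \<tau> w \<simeq> (\<lambda>_. \<tau> barycenter)"
  shows "\<exists>i. Suc i < length w \<and> w ! Suc i = opp (w ! i)"
proof -
  let ?m = "length w"
  have sd: "w ! i \<in> sides" if "i < ?m" for i using walk_sides[OF w(1)] that nth_mem by blast
  obtain h where h: "continuous_on ({0..1} \<times> {0..1}) h" "h \<in> {0..1} \<times> {0..1} \<rightarrow> surface"
    "\<And>r. r \<in> {0..1} \<Longrightarrow> h (0, r) = word_path \<tau> w r"
    "\<And>r. r \<in> {0..1} \<Longrightarrow> h (1, r) = \<tau> barycenter"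
    "\<And>r. r \<in> {0..1::real} \<Longrightarrow> pathstart (h \<circ> Pair r) = pathstart (word_path \<tau> w) \<and>
      pathfinish (h \<circ> Pair r) = pathfinish (word_path \<tau> w)"
    using null unfolding homotopic_paths by blast
  have ends: "h (r, 0) = \<tau> barycenter" "h (r, 1) = \<tau> barycenter" if "r \<in> {0..1}" for r
    using h(5)[OF that] word_path_in[OF w(1)]
    by (auto simp: path_in_def pathstart_def pathfinish_def)
  obtain t where t: "t 0 = 0" "\<And>i. i < ?m \<Longrightarrow> t i < t (Suc i)" "t ?m \<le> 1"
    "\<And>i r. i < ?m \<Longrightarrow> r \<in> {t i..t (Suc i)} \<Longrightarrow>
      word_path \<tau> w r = crossing (w ! i) ((r - t i) / (t (Suc i) - t i))"
    "\<And>r. r \<in> {t ?m..1} \<Longrightarrow> word_path \<tau> w r = \<tau> barycenter"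
    using word_path_times[OF w(1)] by blast
  note tmono = increasing_upto_mono[of ?m t, OF t(2)]
  have t01: "0 \<le> t i" "t i \<le> 1" if "i \<le> ?m" for i
    using tmono[of 0 i] tmono[of i ?m] t(1,3) that by auto
  have h0: "h (0, r) = crossing (w ! i) ((r - t i) / (t (Suc i) - t i))"
    if "i < ?m" "r \<in> {t i..t (Suc i)}" for i r
    using t(4)[OF that] h(3)[of r] that t01[of i] t01[of "Suc i"] by auto
  \<comment> \<open>Edges are images of sides, so that a side and its opposite count as one;
    \<open>rep\<close> chooses one of the two.\<close>
  define \<E> where "\<E> = side_image ` sides"
  define rep where "rep e = (SOME s. s \<in> sides \<and> side_image s = e)" for e
  have rep: "rep e \<in> sides" "side_image (rep e) = e" if "e \<in> \<E>" for e
    using that someI_ex[of "\<lambda>s. s \<in> sides \<and> side_image s = e"] unfolding \<E>_def rep_def by blast+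
  have "\<forall>e\<in>\<E>. \<exists>u. continuous_on surface u \<and>
      (\<forall>\<sigma>\<in>T. \<forall>x\<in>ideal_triangle. u (\<sigma> x) = edge_function (rep e) \<sigma> x)"
  proof
    fix e assume "e \<in> \<E>"
    then have "rep e \<in> sides" by (rule rep)
    then obtain u where "continuous_on surface u"
        "\<And>\<sigma> x. \<sigma> \<in> T \<Longrightarrow> x \<in> ideal_triangle \<Longrightarrow> u (\<sigma> x) = edge_function (rep e) \<sigma> x"
      by (rule edge_function_glued) blast
    then show "\<exists>u. continuous_on surface u \<and>
      (\<forall>\<sigma>\<in>T. \<forall>x\<in>ideal_triangle. u (\<sigma> x) = edge_function (rep e) \<sigma> x)" by blast
  qed
  from bchoice[OF this] obtain u where
    "\<forall>e\<in>\<E>. continuous_on surface (u e) \<and>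
      (\<forall>\<sigma>\<in>T. \<forall>x\<in>ideal_triangle. u e (\<sigma> x) = edge_function (rep e) \<sigma> x)" ..
  then have u: "\<And>e. e \<in> \<E> \<Longrightarrow> continuous_on surface (u e)"
    "\<And>e \<sigma> x. e \<in> \<E> \<Longrightarrow> \<sigma> \<in> T \<Longrightarrow> x \<in> ideal_triangle \<Longrightarrow> u e (\<sigma> x) = edge_function (rep e) \<sigma> x"
    by simp_all
  have E: "side_image (w ! i) \<in> \<E>" if "i < ?m" for i using sd[OF that] by (simp add: \<E>_def)
  have bary: "u e (\<sigma> barycenter) = -1" if "e \<in> \<E>" "\<sigma> \<in> T" for e \<sigma>
  proof -
    have "barycenter \<in> ideal_triangle" using barycenter_open open_triangle_subset by blast
    then show ?thesis
      using u(2)[OF that] by (simp add: edge_function_def side_coord_barycenter complex_eq_iff)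
  qed
  have \<tau>T: "\<tau> \<in> T" using w fst_side[of "hd w"] by (cases w) auto
  have ex_g: "\<forall>i\<in>{..<?m}. \<exists>g. continuous_on {0..1} g \<and>
      (\<forall>r\<in>{0..1}. u (side_image (w ! i)) (crossing (w ! i) r) = cis (pi * g r)) \<and>
      g 0 \<noteq> g 1 \<and> (\<forall>r\<in>{0<..<1}. \<bar>g r\<bar> < 1)"
  proof
    fix i assume "i \<in> {..<?m}"
    then have i: "i < ?m" by simp
    let ?e = "side_image (w ! i)"
    have "rep ?e = w ! i \<or> rep ?e = opp (w ! i)"
      by (rule side_image_eq_cases[OF sd[OF i] rep[OF E[OF i]]])
    then show "\<exists>g. continuous_on {0..1} g \<and>
      (\<forall>r\<in>{0..1}. u ?e (crossing (w ! i) r) = cis (pi * g r)) \<and>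
      g 0 \<noteq> g 1 \<and> (\<forall>r\<in>{0<..<1}. \<bar>g r\<bar> < 1)"
    proof (rule crossing_angle[OF sd[OF i] _ u(2)[OF E[OF i]]])
      fix g assume "continuous_on {0..1} g" "\<And>r. r \<in> {0..1} \<Longrightarrow> u ?e (crossing (w ! i) r) = cis (pi * g r)"
        "g 0 \<noteq> g 1" "\<And>r. r \<in> {0<..<1} \<Longrightarrow> \<bar>g r\<bar> < 1"
      then show ?thesis by (intro exI[of _ g] conjI ballI)
    qed
  qed
  from bchoice[OF ex_g] obtain g0 where g0':
    "\<forall>i\<in>{..<?m}. continuous_on {0..1} (g0 i) \<and>
      (\<forall>r\<in>{0..1}. u (side_image (w ! i)) (crossing (w ! i) r) = cis (pi * g0 i r)) \<and>
      g0 i 0 \<noteq> g0 i 1 \<and> (\<forall>r\<in>{0<..<1}. \<bar>g0 i r\<bar> < 1)" ..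
  then have g0: "\<And>i. i < ?m \<Longrightarrow> continuous_on {0..1} (g0 i)"
    "\<And>i r. i < ?m \<Longrightarrow> r \<in> {0..1} \<Longrightarrow> u (side_image (w ! i)) (crossing (w ! i) r) = cis (pi * g0 i r)"
    "\<And>i. i < ?m \<Longrightarrow> g0 i 0 \<noteq> g0 i 1" "\<And>i r. i < ?m \<Longrightarrow> r \<in> {0<..<1} \<Longrightarrow> \<bar>g0 i r\<bar> < 1"
    by simp_all
  define \<sigma> where "\<sigma> i r = (r - t i) / (t (Suc i) - t i)" for i r
  have \<sigma>_in: "\<sigma> i r \<in> {0..1}" if "i < ?m" "r \<in> {t i..t (Suc i)}" for i r
    using that t(2)[of i] by (auto simp: \<sigma>_def divide_le_eq_1)
  have \<sigma>_in': "\<sigma> i r \<in> {0<..<1}" if "i < ?m" "r \<in> {t i<..<t (Suc i)}" for i r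
    using that t(2)[of i] by (auto simp: \<sigma>_def divide_less_eq_1)
  have \<sigma>_ends: "\<sigma> i (t i) = 0" "\<sigma> i (t (Suc i)) = 1" if "i < ?m" for i
    using t(2)[OF that] by (simp_all add: \<sigma>_def)
  have vert: "h (0, t i) \<in> (\<lambda>\<sigma>. \<sigma> barycenter) ` T" if "i \<le> ?m" for i
  proof (cases "i < ?m")
    case True
    have "h (0, t i) = crossing (w ! i) 0"
      using h0[OF True, of "t i"] t(2)[OF True] by simp
    also have "\<dots> = fst (w ! i) barycenter"
      using crossing_from_to_surface[OF sd[OF True]] by (simp add: path_in_def pathstart_def)
    finally show ?thesis using fst_side[OF sd[OF True]] by simp
  next
    case False
    then have "i = ?m" using that by simp
    then show ?thesis using t(3) t(5)[of "t ?m"] h(3)[of "t ?m"] t01[of ?m] \<tau>T by simp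
  qed
  have "\<exists>i. Suc i < ?m \<and> side_image (w ! i) = side_image (w ! Suc i)"
  proof (rule nullhomotopic_adjacent_crossings[OF h(1,2), where u = u and \<E> = \<E> and t = t
        and g = "\<lambda>i r. g0 i (\<sigma> i r)"])
    show "cmod (u e y) = 1" if e: "e \<in> \<E>" and y: "y \<in> surface" for e y
    proof -
      obtain \<sigma> x where "\<sigma> \<in> T" "x \<in> ideal_triangle" "y = \<sigma> x"
        using y by (rule surface_cover)
      then show ?thesis using u(2)[OF e] by (simp add: norm_edge_function)
    qed
    show "e = e'" if e: "e \<in> \<E>" "e' \<in> \<E>" and y: "y \<in> surface" and ne: "u e y \<noteq> -1" "u e' y \<noteq> -1" for e e' y
    proof -
      obtain \<sigma> x where x: "\<sigma> \<in> T" "x \<in> ideal_triangle" "y = \<sigma> x"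
        using y by (rule surface_cover)
      have "edge_function (rep e) \<sigma> x \<noteq> -1" using ne(1) u(2)[OF e(1) x(1,2)] x(3) by simp
      then obtain i where i: "side_image (\<sigma>, i) = side_image (rep e)" "side_coord i x \<noteq> 1"
        by (rule edge_function_neq[OF rep(1)[OF e(1)] x(1)])
      have "edge_function (rep e') \<sigma> x \<noteq> -1" using ne(2) u(2)[OF e(2) x(1,2)] x(3) by simp
      then obtain i' where i': "side_image (\<sigma>, i') = side_image (rep e')" "side_coord i' x \<noteq> 1"
        by (rule edge_function_neq[OF rep(1)[OF e(2)] x(1)])
      show ?thesis using side_coord_unique[OF x(2) i(2) i'(2)] i(1) i'(1) rep(2) e by simp
    qed
    show "continuous_on {t i..t (Suc i)} (\<lambda>r. g0 i (\<sigma> i r))" if "i < ?m" for i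
      using \<sigma>_in[OF that] t(2)[OF that] unfolding \<sigma>_def
      by (intro continuous_on_compose2[OF g0(1)[OF that]] continuous_intros) auto
    show "u (side_image (w ! i)) (h (0, r)) = cis (pi * g0 i (\<sigma> i r))"
      if "i < ?m" "r \<in> {t i..t (Suc i)}" for i r
      using h0[OF that] g0(2)[OF that(1) \<sigma>_in[OF that]] by (simp add: \<sigma>_def)
    show "g0 i (\<sigma> i (t i)) \<noteq> g0 i (\<sigma> i (t (Suc i)))" if "i < ?m" for i
      using g0(3)[OF that] \<sigma>_ends[OF that] by simp
    show "\<bar>g0 i (\<sigma> i r)\<bar> < 1" if "i < ?m" "r \<in> {t i<..<t (Suc i)}" for i r
      using g0(4)[OF that(1) \<sigma>_in'[OF that]] .
    show "u e (h (0, t i)) = -1" if "i \<le> ?m" "e \<in> \<E>" for i e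
      using vert[OF that(1)] bary[OF that(2)] by auto
    show "u e (h (0, r)) = -1" if "e \<in> \<E>" "r \<in> {t ?m..1}" for e r
      using t(5)[OF that(2)] h(3)[of r] that(2) t01[of ?m] bary[OF that(1) \<tau>T] by simp
    show "u e (h (1, r)) = -1" "u e (h (r, 0)) = -1" "u e (h (r, 1)) = -1"
      if "e \<in> \<E>" "r \<in> {0..1}" for e r
      using h(4)[OF that(2)] ends[OF that(2)] bary[OF that(1) \<tau>T] by simp_all
    show "0 < ?m" using w(2) by simp
  qed (use u(1) E t(1,2,3) in auto)
  then obtain i where i: "Suc i < ?m" "side_image (w ! i) = side_image (w ! Suc i)" by blast
  \<comment> \<open>The edge determines the letter up to \<open>opp\<close>. Repeating the letter is
    impossible, since a walk has moved on to a different triangle.\<close>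
  have "w ! Suc i = w ! i \<or> w ! Suc i = opp (w ! i)"
    using side_image_eq_cases[of "w ! i" "w ! Suc i"] sd[of i] sd[of "Suc i"] i by simp
  moreover have "w ! Suc i \<noteq> w ! i"
    using walk_snoc_consecutive[OF w(1) i(1)] fst_opp_neq[OF sd[of i]] i(1) by auto
  ultimately show ?thesis using i(1) by blast
qed

subsection \<open>Torsion-freeness of the fundamental group\<close>

lemma ray_in_diamond:
  assumes s: "s \<in> sides" and \<tau>: "\<tau> \<in> {fst s, fst (opp s)}" and x: "x \<in> open_triangle"
  shows "path_in (diamond s) (\<tau> barycenter) (\<tau> x) (\<tau> \<circ> linepath barycenter x)"
proof -
  have "\<tau> \<in> T" using \<tau> fst_side[OF s] fst_opp[OF s] by auto
  then have "path_in (\<tau> ` open_triangle) (\<tau> barycenter) (\<tau> x) (\<tau> \<circ> linepath barycenter x)"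
    by (rule path_in_triangle[OF _ open_triangle_subset convex_open_triangle barycenter_open x])
  then show ?thesis by (rule path_in_subset) (use \<tau> in \<open>auto simp: diamond_def side_nbhd_eq\<close>)
qed

text \<open>In a diamond all paths with the same ends are homotopic. So the path is replaced by the
  empty word or by a single crossing, followed by the ray to its end point.\<close>

lemma diamond_path_word:
  assumes s: "s \<in> sides" and \<tau>: "\<tau> \<in> {fst s, fst (opp s)}" and \<tau>': "\<tau>' \<in> {fst s, fst (opp s)}"
    and x: "x \<in> open_triangle" and q: "path_in (diamond s) (\<tau> barycenter) (\<tau>' x) q"
  obtains w where "walk \<tau> w \<tau>'"
    "q \<simeq> word_path \<tau> w +++ (\<tau>' \<circ> linepath barycenter x)"
proof -
  have \<tau>T: "\<tau> \<in> T" "\<tau>' \<in> T" using \<tau> \<tau>' fst_side[OF s] fst_opp[OF s] by auto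
  have bd: "\<tau>'' barycenter \<in> diamond s" if "\<tau>'' \<in> {fst s, fst (opp s)}" for \<tau>''
    using that barycenter_in_diamond[of s] by auto
  note r = ray_in_diamond[OF s \<tau>' x]
  have "\<exists>w. walk \<tau> w \<tau>' \<and> path_in (diamond s) (\<tau> barycenter) (\<tau>' barycenter) (word_path \<tau> w)"
  proof (cases "\<tau>' = \<tau>")
    case True
    then show ?thesis
      using \<tau>T(1) path_in_const[OF bd[OF \<tau>]] by (intro exI[of _ "[]"]) simp
  next
    case False
    define t where "t = (if \<tau> = fst s then s else opp s)"
    have t: "t \<in> sides" "fst t = \<tau>" "fst (opp t) = \<tau>'" "diamond t = diamond s"
      using \<tau> \<tau>' False s opp(1)[OF s] opp_opp[OF s] diamond_opp[OF s] by (auto simp: t_def)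
    have "path_in (diamond s) (\<tau> barycenter) (\<tau>' barycenter) (crossing t)"
      using crossing_from_to[OF t(1)] t(2,3,4) by simp
    from path_in_join[OF this path_in_const[OF bd[OF \<tau>']]]
    show ?thesis using t \<tau>T(2) by (intro exI[of _ "[t]"]) simp
  qed
  then obtain w where w: "walk \<tau> w \<tau>'"
    "path_in (diamond s) (\<tau> barycenter) (\<tau>' barycenter) (word_path \<tau> w)" by blast
  show thesis
    by (rule that[OF w(1) diamond_homotopic_paths[OF s q path_in_join[OF w(2) r]]])
qed

text \<open>Connectedness of the interval replaces an explicit subdivision. The invariant says that
  the loop up to time \<open>r\<close> is homotopic to a word followed by a path inside one diamond;
  it propagates in both directions within each time interval on which the loop stays in one
  diamond.\<close>

lemma loop_homotopic_word:
  assumes \<tau>0: "\<tau>0 \<in> T" and p: "path_in surface (\<tau>0 barycenter) (\<tau>0 barycenter) p"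
  obtains w where "walk \<tau>0 w \<tau>0" "p \<simeq> word_path \<tau>0 w"
proof -
  have pp: "path p" "path_image p \<subseteq> surface" "p 0 = \<tau>0 barycenter" "p 1 = \<tau>0 barycenter"
    using p by (auto simp: path_in_def pathstart_def pathfinish_def)
  have seg: "closed_segment a b \<subseteq> {0..1}" if "a \<in> {0..1}" "b \<in> {0..1}" for a b :: real
    using that by (simp add: closed_segment_subset)
  have sub: "path_in surface (p a) (p b) ((p \<circ> linepath a b))" if "a \<in> {0..1}" "b \<in> {0..1}" for a b
  proof -
    have "path ((p \<circ> linepath a b))"
      using seg[OF that] pp(1) unfolding path_def
      by (intro continuous_on_compose2[of "{0..1}" p "{0..1}" "linepath a b", folded comp_def]
          continuous_on_linepath) (auto simp flip: path_image_linepath simp: path_image_def)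
    moreover have "path_image ((p \<circ> linepath a b)) \<subseteq> surface"
      using seg[OF that] pp(2)
      unfolding path_image_compose path_image_linepath unfolding path_image_def by blast
    ultimately show ?thesis by (simp add: path_in_def pathstart_compose pathfinish_compose)
  qed
  have join_sub: "(p \<circ> linepath a b) +++ (p \<circ> linepath b c) \<simeq> (p \<circ> linepath a c)"
    if "a \<in> {0..1}" "b \<in> {0..1}" "c \<in> {0..1}" for a b c
    unfolding path_compose_join[symmetric]
    using seg[OF that(1,2)] seg[OF that(2,3)] seg[OF that(1,3)]
    by (intro homotopic_reparametrizations[OF pp(1,2)]) (simp_all add: path_image_join)
  have p01: "p \<circ> linepath 0 1 = p" by (auto simp: linepath_def)
  define Q where "Q r \<longleftrightarrow> (\<exists>w \<tau> s q. walk \<tau>0 w \<tau> \<and> s \<in> sides \<and> \<tau> \<in> {fst s, fst (opp s)} \<and>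
     path_in (diamond s) (\<tau> barycenter) (p r) q \<and>
     (p \<circ> linepath 0 r) \<simeq> word_path \<tau>0 w +++ q)" for r
  have "Q 0"
  proof -
    let ?s = "(\<tau>0, 1) :: (real^3 \<Rightarrow> 'a) \<times> 3"
    have s: "?s \<in> sides" using \<tau>0 by simp
    have "(p \<circ> linepath 0 0) = (\<lambda>_. \<tau>0 barycenter)" using pp(3) by (auto simp: linepath_def)
    moreover have "(\<lambda>_. \<tau>0 barycenter) \<simeq> word_path \<tau>0 [] +++ (\<lambda>_. \<tau>0 barycenter)"
      using homotopic_paths_sym[OF homotopic_const_join[OF path_in_const[OF barycenter_in_surface[OF \<tau>0]]]]
      by simp
    moreover have "path_in (diamond ?s) (\<tau>0 barycenter) (p 0) (\<lambda>_. \<tau>0 barycenter)"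
      using path_in_const[OF barycenter_in_diamond(1)[of ?s]] pp(3) by simp
    ultimately show ?thesis
      unfolding Q_def using \<tau>0 s
      by (intro exI[of _ "[]"] exI[of _ \<tau>0] exI[of _ ?s] exI[of _ "\<lambda>_. \<tau>0 barycenter"]) simp
  qed
  have "Q 1"
  proof (rule connected_induction_simple[of "{0..1::real}" 0 1 Q])
    fix a :: real assume a: "a \<in> {0..1}"
    then have "p a \<in> surface" using pp(2) unfolding path_image_def by blast
    then obtain s' where s': "s' \<in> sides" "p a \<in> diamond s'" by (rule diamond_cover)
    have "openin (top_of_set {0..1}) ({0..1} \<inter> p -` diamond s')"
      using pp(1,2) openin_diamond[OF s'(1)] unfolding path_def path_image_def
      by (intro continuous_openin_preimage[where T = surface]) blast+
    then obtain e where e: "e > 0" "ball a e \<inter> {0..1} \<subseteq> {0..1} \<inter> p -` diamond s'"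
      using a s'(2) unfolding openin_contains_ball by blast
    let ?N = "{0..1} \<inter> ball a e"
    have step: "Q y" if x: "x \<in> ?N" and y: "y \<in> ?N" and Qx: "Q x" for x y
    proof -
      have xy: "x \<in> {0..1}" "y \<in> {0..1}" using x y by simp_all
      have nbhd: "p z \<in> diamond s'" if "z \<in> ?N" for z using e(2) that by blast
      have "closed_segment x y \<subseteq> ?N" using x y by (intro closed_segment_subset convex_Int) auto
      then have "path_image ((p \<circ> linepath x y)) \<subseteq> diamond s'"
        unfolding path_image_compose path_image_linepath using nbhd by blast
      then have r: "path_in (diamond s') (p x) (p y) ((p \<circ> linepath x y))"
        using sub[OF xy] by (simp add: path_in_def)
      obtain w \<tau> s q where w: "walk \<tau>0 w \<tau>" and s: "s \<in> sides" "\<tau> \<in> {fst s, fst (opp s)}"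
        and q: "path_in (diamond s) (\<tau> barycenter) (p x) q"
        and hom: "(p \<circ> linepath 0 x) \<simeq> word_path \<tau>0 w +++ q"
        using Qx unfolding Q_def by blast
      have "\<exists>w \<tau> q. walk \<tau>0 w \<tau> \<and> \<tau> \<in> {fst s', fst (opp s')} \<and>
        path_in (diamond s') (\<tau> barycenter) (p x) q \<and>
        (p \<circ> linepath 0 x) \<simeq> word_path \<tau>0 w +++ q"
      proof (cases "side_image s = side_image s'")
        case True
        have "{fst s, fst (opp s)} = {fst s', fst (opp s')}"
          using side_image_eq_cases[OF s(1) s'(1) True[symmetric]] opp_opp[OF s(1)] by auto
        then show ?thesis
          using w s(2) q hom diamond_eq[OF s(1) s'(1) True] by metis
      next
        case False
        have px: "p x \<in> diamond s" "p x \<in> diamond s'"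
          using path_in_finish[OF q] nbhd[OF x] by auto
        \<comment> \<open>Distinct diamonds meet in open triangles only. A word and a ray in a
          common triangle replace the path in the old diamond, and this ray lies in the new diamond
          as well.\<close>
        obtain \<sigma> z where z: "\<sigma> \<in> {fst s, fst (opp s)}" "\<sigma> \<in> {fst s', fst (opp s')}"
            "z \<in> open_triangle" "p x = \<sigma> z"
          using diamond_inter[OF s(1) s'(1) px] False by blast
        let ?r = "\<sigma> \<circ> linepath barycenter z"
        obtain v where v: "walk \<tau> v \<sigma>" "q \<simeq> word_path \<tau> v +++ ?r"
          by (rule diamond_path_word[OF s(1,2) z(1,3) q[unfolded z(4)]])
        have rr: "path_in (diamond s') (\<sigma> barycenter) (p x) ?r"
          unfolding z(4) by (rule ray_in_diamond[OF s'(1) z(2,3)])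
        note W = word_path_in[OF w] and V = word_path_in[OF v(1)]
        note R = path_in_subset[OF rr diamond_subset[OF s'(1)]]
        have wv: "walk \<tau>0 (w @ v) \<sigma>" using w v(1) walk_append by blast
        have "(p \<circ> linepath 0 x) \<simeq> word_path \<tau>0 w +++ (word_path \<tau> v +++ ?r)"
          by (rule homotopic_paths_trans[OF hom homotopic_join_right[OF v(2) W path_in_subset[OF q diamond_subset[OF s(1)]]]])
        also have "\<dots> \<simeq> (word_path \<tau>0 w +++ word_path \<tau> v) +++ ?r"
          by (rule homotopic_paths_sym[OF homotopic_join_assoc[OF W V R]])
        also have "\<dots> \<simeq> word_path \<tau>0 (w @ v) +++ ?r"
          by (rule homotopic_join_left[OF homotopic_paths_sym[OF word_path_append[OF w v(1)]] path_in_join[OF W V] R])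
        finally have "(p \<circ> linepath 0 x) \<simeq> word_path \<tau>0 (w @ v) +++ ?r" .
        then show ?thesis using wv z(2) rr by blast
      qed
      then obtain w \<tau> q where w: "walk \<tau>0 w \<tau>" and \<tau>: "\<tau> \<in> {fst s', fst (opp s')}"
        and q: "path_in (diamond s') (\<tau> barycenter) (p x) q"
        and hom: "(p \<circ> linepath 0 x) \<simeq> word_path \<tau>0 w +++ q" by blast
      note W = word_path_in[OF w] and q' = path_in_subset[OF q diamond_subset[OF s'(1)]]
      have "(p \<circ> linepath 0 y) \<simeq> (p \<circ> linepath 0 x) +++ (p \<circ> linepath x y)"
        by (rule homotopic_paths_sym[OF join_sub[OF _ xy]]) simp
      also have "\<dots> \<simeq> (word_path \<tau>0 w +++ q) +++ (p \<circ> linepath x y)"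
        by (rule homotopic_join_left[OF hom
              sub[OF _ xy(1), of 0] sub[OF xy]]) simp
      also have "\<dots> \<simeq> word_path \<tau>0 w +++ (q +++ (p \<circ> linepath x y))"
        by (rule homotopic_join_assoc[OF W q' sub[OF xy]])
      finally have "(p \<circ> linepath 0 y) \<simeq> word_path \<tau>0 w +++ (q +++ (p \<circ> linepath x y))" .
      then show "Q y"
        unfolding Q_def using w s'(1) \<tau> path_in_join[OF q r] by blast
    qed
    show "\<exists>N. openin (top_of_set {0..1}) N \<and> a \<in> N \<and> (\<forall>x\<in>N. \<forall>y\<in>N. Q x \<longrightarrow> Q y)"
    proof (intro exI[of _ ?N] conjI ballI impI)
      show "openin (top_of_set {0..1}) ?N" by (rule openin_open_Int) simp
      show "a \<in> ?N" using a e(1) by simp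
    qed (rule step)
  qed (use \<open>Q 0\<close> in auto)
  then obtain w \<tau> s q where w: "walk \<tau>0 w \<tau>" and s: "s \<in> sides" "\<tau> \<in> {fst s, fst (opp s)}"
    and q: "path_in (diamond s) (\<tau> barycenter) (\<tau>0 barycenter) q"
    and hom: "p \<simeq> word_path \<tau>0 w +++ q"
    unfolding Q_def pp(4) p01 by blast
  have bp: "barycenter \<in> ideal_triangle" using barycenter_open open_triangle_subset by blast
  \<comment> \<open>At time 1 the loop is back at a barycenter, which lies only in diamonds having
    this triangle as a half; the remaining path inside the diamond becomes a word.\<close>
  have \<tau>0s: "\<tau>0 \<in> {fst s, fst (opp s)}"
    using diamond_preimage[OF s(1) \<tau>0 bp] path_in_finish[OF q] by blast
  obtain v where v: "walk \<tau> v \<tau>0"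
      "q \<simeq> word_path \<tau> v +++ (\<tau>0 \<circ> linepath barycenter barycenter)"
    by (rule diamond_path_word[OF s \<tau>0s barycenter_open q])
  note W = word_path_in[OF w] and V = word_path_in[OF v(1)]
  have c: "\<tau>0 \<circ> linepath barycenter barycenter = (\<lambda>_. \<tau>0 barycenter)" by (auto simp: linepath_def algebra_simps)
  have "q \<simeq> word_path \<tau> v"
    using homotopic_paths_trans[OF v(2)[unfolded c] homotopic_join_const[OF V]] .
  then have "p \<simeq> word_path \<tau>0 w +++ word_path \<tau> v"
    by (rule homotopic_paths_trans[OF hom homotopic_join_right[OF _ W path_in_subset[OF q diamond_subset[OF s(1)]]]])
  from homotopic_paths_trans[OF this homotopic_paths_sym[OF word_path_append[OF w v(1)]]]
  show thesis using that[of "w @ v"] w v(1) walk_append by blast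
qed

section \<open>Powers of words and torsion elements\<close>

lemma concat_replicate_commute: "concat (replicate n w) @ w = w @ concat (replicate n w)"
  by (induction n) auto

lemma nth_concat_replicate:
  "k < n * length w \<Longrightarrow> concat (replicate n w) ! k = w ! (k mod length w)"
proof (induction n arbitrary: k)
  case (Suc n)
  then show ?case by (auto simp: nth_append le_mod_geq)
qed simp

lemma walk_concat_replicate:
  assumes "walk \<tau> w \<tau>"
  shows "walk \<tau> (concat (replicate n w)) \<tau>"
proof (induction n)
  case 0
  have "\<tau> \<in> T" using assms fst_side[of "hd w"] by (cases w) auto
  then show ?case by simp
qed (use assms walk_append in auto)

text \<open>Conjugation turns powers of the loop into repetitions of the word. As
  \<open>loop_power\<close> adds its factor on the right and \<open>replicate\<close> on the left,
  the repeated word has to commute with \<open>w\<close>.\<close>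

lemma loop_power_word:
  assumes w: "walk \<tau> w \<tau>" and q: "path_in surface x0 (\<tau> barycenter) q"
    and c: "path_in surface x0 x0 c"
    and hom: "c \<simeq> q +++ (word_path \<tau> w +++ reversepath q)"
  shows "loop_power c n \<simeq>
    q +++ (word_path \<tau> (concat (replicate n w)) +++ reversepath q)"
proof (induction n)
  case 0
  have "loop_power c 0 = (\<lambda>_. x0)" using c by (simp add: path_in_def)
  then show ?case using homotopic_paths_sym[OF homotopic_conj_const[OF q]] by simp
next
  case (Suc n)
  let ?v = "concat (replicate n w)"
  note v = walk_concat_replicate[OF w, of n]
  note W = word_path_in[OF w] and V = word_path_in[OF v]
  have "loop_power c (Suc n) \<simeq>
      (q +++ (word_path \<tau> ?v +++ reversepath q)) +++ (q +++ (word_path \<tau> w +++ reversepath q))"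
    using homotopic_join_cong[OF Suc.IH hom loop_power_from_to[OF c] c] by simp
  also have "\<dots> \<simeq> q +++ ((word_path \<tau> ?v +++ word_path \<tau> w) +++ reversepath q)"
    by (rule homotopic_conj_join[OF q V W])
  also have "\<dots> \<simeq> q +++ (word_path \<tau> (?v @ w) +++ reversepath q)"
    by (rule homotopic_conj_cong[OF q path_in_join[OF V W]
          homotopic_paths_sym[OF word_path_append[OF v w]]])
  finally show ?case by (simp add: concat_replicate_commute)
qed

text \<open>A word of minimal length among those conjugate to a torsion element must be empty, since its
  powers are contractible, hence backtrack, so that it backtracks itself, at least cyclically.\<close>

lemma torsion_word_nullhomotopic:
  assumes c: "path_in surface x0 x0 c" and n: "n > 0"
    and null: "loop_power c n \<simeq> (\<lambda>_. x0)"
    and w: "walk \<tau> w \<tau>" and q: "path_in surface x0 (\<tau> barycenter) q"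
    and hom: "c \<simeq> q +++ (word_path \<tau> w +++ reversepath q)"
  shows "c \<simeq> (\<lambda>_. x0)"
  using w q hom
proof (induction "length w" arbitrary: w \<tau> q rule: less_induct)
  case less
  note w = less.prems(1) and q = less.prems(2) and hom = less.prems(3)
  note W = word_path_in[OF w]
  show ?case
  proof (cases "w = []")
    case True
    then show ?thesis using homotopic_paths_trans[OF hom] homotopic_conj_const[OF q] by simp
  next
    case False
    let ?l = "length w" and ?V = "concat (replicate n w)"
    note v = walk_concat_replicate[OF w, of n]
    have l: "?l > 0" "?V \<noteq> []" using False n by auto
    have "q +++ (word_path \<tau> ?V +++ reversepath q) \<simeq> (\<lambda>_. x0)"
      by (rule homotopic_paths_trans[OF homotopic_paths_sym[OF loop_power_word[OF w q c hom]] null])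
    then have "word_path \<tau> ?V \<simeq> (\<lambda>_. \<tau> barycenter)"
      by (rule homotopic_unconj[OF q word_path_in[OF v]])
    then obtain i where i: "Suc i < length ?V" "?V ! Suc i = opp (?V ! i)"
      using nullhomotopic_word_backtracks[OF v l(2)] by blast
    \<comment> \<open>Positions in the repeated word are taken modulo the length of
      \<open>w\<close>, so the backtracking pair either lies inside \<open>w\<close> or joins its
      last letter to its first.\<close>
    define a where "a = i mod ?l"
    have "length ?V = n * ?l" by (simp add: length_concat sum_list_replicate)
    then have Va: "w ! (Suc i mod ?l) = opp (w ! a)"
      using i nth_concat_replicate[of i n w] nth_concat_replicate[of "Suc i" n w] by (simp add: a_def)
    have al: "a < ?l" using l(1) by (simp add: a_def)
    define s where "s = w ! a"
    have s: "s \<in> sides" using walk_sides[OF w] al nth_mem unfolding s_def by blast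
    show ?thesis
    proof (cases "Suc a < ?l")
      case True
      then have "Suc i mod ?l = Suc a" by (simp add: a_def mod_Suc)
      then have s2: "w ! Suc a = opp s" using Va by (simp add: s_def)
      let ?u = "take a w" and ?v = "drop (Suc (Suc a)) w"
      have split: "w = ?u @ s # opp s # ?v"
        using True al s2 id_take_nth_drop[OF al] Cons_nth_drop_Suc[OF True] by (simp add: s_def)
      obtain \<sigma> where "walk \<tau> ?u \<sigma>" "walk \<sigma> (s # opp s # ?v) \<tau>"
        using w walk_append[of \<tau> ?u "s # opp s # ?v" \<tau>] split by auto
      then have uv: "walk \<tau> ?u (fst s)" "walk (fst s) ?v \<tau>" by (auto simp: opp_opp[OF s])
      have red: "word_path \<tau> w \<simeq> word_path \<tau> (?u @ ?v)"
        using word_path_cancel[OF uv(1) s uv(2)] split by simp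
      show ?thesis
      proof (rule less.hyps[of "?u @ ?v" \<tau> q])
        show "length (?u @ ?v) < ?l" using True by simp
        show "walk \<tau> (?u @ ?v) \<tau>" using uv walk_append by blast
        show "c \<simeq> q +++ (word_path \<tau> (?u @ ?v) +++ reversepath q)"
          by (rule homotopic_paths_trans[OF hom homotopic_conj_cong[OF q W red]])
      qed (rule q)
    next
      case False
      then have last: "Suc a = ?l" using al by simp
      then have "Suc i mod ?l = 0" by (simp add: a_def mod_Suc)
      then have hd: "w ! 0 = opp s" using Va by (simp add: s_def)
      define t where "t = opp s"
      have t: "t \<in> sides" "opp t = s" using opp(1)[OF s] opp_opp[OF s] by (simp_all add: t_def)
      \<comment> \<open>With a single letter the pair would make that letter its own
        opposite.\<close>
      have "a \<noteq> 0"
      proof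
        assume "a = 0"
        then show False using hd opp(2)[OF s] by (simp add: s_def)
      qed
      obtain w1 where w1: "w = t # w1" "w1 \<noteq> []"
        using hd last \<open>a \<noteq> 0\<close> by (cases w) (auto simp: t_def)
      have "last w1 = s" using w1 last by (simp add: s_def last_conv_nth nth_Cons')
      \<comment> \<open>The word begins with \<open>t\<close> and ends with \<open>opp t\<close>.
        The outer letters are absorbed into the conjugating path, which leaves the shorter word
        \<open>w'\<close> based at the neighbouring triangle.\<close>
      then obtain w' where w': "w = t # w' @ [opp t]"
        using w1 t(2) append_butlast_last_id[OF w1(2)] by metis
      have \<tau>: "\<tau> = fst t" and "walk (fst (opp t)) (w' @ [opp t]) \<tau>" using w w' by simp_all
      then have ww: "walk (fst (opp t)) w' (fst (opp t))" and wt: "walk (fst (opp t)) [opp t] \<tau>"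
        using walk_append by auto
      note ct = crossing_from_to_surface[OF t(1)] and W' = word_path_in[OF ww]
      note rct = path_in_reversepath[OF ct]
      have "word_path (fst (opp t)) (w' @ [opp t]) \<simeq>
          word_path (fst (opp t)) w' +++ word_path (fst (opp t)) [opp t]"
        by (rule word_path_append[OF ww wt])
      also have "word_path (fst (opp t)) [opp t] = reversepath (crossing t) +++ (\<lambda>_. fst t barycenter)"
        by (simp add: crossing_opp[OF t(1)] opp_opp[OF t(1)])
      also have "word_path (fst (opp t)) w' +++ \<dots> \<simeq>
          word_path (fst (opp t)) w' +++ reversepath (crossing t)"
        by (rule homotopic_join_right[OF
              homotopic_join_const[OF rct] W' path_in_join[OF rct
                path_in_const[OF path_in_finish[OF rct]]]])
      finally have "crossing t +++ word_path (fst (opp t)) (w' @ [opp t]) \<simeq>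
          crossing t +++ (word_path (fst (opp t)) w' +++ reversepath (crossing t))"
        by (rule homotopic_join_right[OF _ ct
              word_path_in[OF \<open>walk (fst (opp t)) (w' @ [opp t]) \<tau>\<close>]])
      then have "word_path \<tau> w \<simeq>
          crossing t +++ (word_path (fst (opp t)) w' +++ reversepath (crossing t))"
        unfolding w' by simp
      then have red: "c \<simeq>
          q +++ ((crossing t +++ (word_path (fst (opp t)) w' +++ reversepath (crossing t))) +++ reversepath q)"
        by (rule homotopic_paths_trans[OF hom homotopic_conj_cong[OF q W]])
      note q' = q[unfolded \<tau>]
      show ?thesis
      proof (rule less.hyps[of w' "fst (opp t)" "q +++ crossing t"])
        show "length w' < ?l" by (simp add: w')
        show "c \<simeq>
            (q +++ crossing t) +++ (word_path (fst (opp t)) w' +++ reversepath (q +++ crossing t))"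
          by (rule homotopic_paths_trans[OF red homotopic_conj_conj[OF q' ct W']])
      qed (rule ww path_in_join[OF q' ct])+
    qed
  qed
qed

theorem torsion_free_pi1:
  assumes x0: "x0 \<in> surface" and \<gamma>: "\<gamma> \<in> carrier (pi1 surface x0)" and n: "n > 0"
    and pow: "\<gamma> [^]\<^bsub>pi1 surface x0\<^esub> (n::nat) = \<one>\<^bsub>pi1 surface x0\<^esub>"
  shows "\<gamma> = \<one>\<^bsub>pi1 surface x0\<^esub>"
proof -
  obtain c where c: "path_in surface x0 x0 c" "\<gamma> = path_class surface c"
    using \<gamma> unfolding carrier_pi1 by blast
  have null: "loop_power c n \<simeq> (\<lambda>_. x0)"
    using pow unfolding c(2) pow_pi1[OF c(1)] one_pi1 path_class_eq_iff[OF loop_power_from_to[OF c(1)]] .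
  obtain \<tau> x where x: "\<tau> \<in> T" "x \<in> ideal_triangle" "x0 = \<tau> x" using x0 by (rule surface_cover)
  have bp: "barycenter \<in> ideal_triangle" using barycenter_open open_triangle_subset by blast
  have "\<tau> ` ideal_triangle \<subseteq> surface" using in_surface[OF x(1)] by blast
  from path_in_subset[OF path_in_triangle[OF x(1) order_refl convex_ideal_triangle x(2) bp] this]
  have q: "path_in surface x0 (\<tau> barycenter) (\<tau> \<circ> linepath x barycenter)" by (simp add: x(3))
  \<comment> \<open>The base point is arbitrary, whereas words start at barycenters; a segment
    inside a triangle containing the base point connects the two.\<close>
  let ?q = "\<tau> \<circ> linepath x barycenter"
  note loop = path_in_join[OF path_in_reversepath[OF q] path_in_join[OF c(1) q]]
  obtain w where w: "walk \<tau> w \<tau>" "reversepath ?q +++ (c +++ ?q) \<simeq> word_path \<tau> w"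
    by (rule loop_homotopic_word[OF x(1) loop])
  have "c \<simeq> ?q +++ (word_path \<tau> w +++ reversepath ?q)"
    by (rule homotopic_paths_trans[OF homotopic_conj_unconj[OF q c(1)]
          homotopic_conj_cong[OF q loop w(2)]])
  then have "c \<simeq> (\<lambda>_. x0)"
    by (rule torsion_word_nullhomotopic[OF c(1) n null w(1) q])
  then show ?thesis unfolding c(2) one_pi1 path_class_eq_iff[OF c(1)] .
qed

end

theorem corollary1p6:
  fixes M P :: "'a::t2_space set" and T :: "(real^3 \<Rightarrow> 'a) set" and x0 :: 'a
    and g k :: nat
    and \<rho> \<rho>\<^sub>0 :: "(real \<Rightarrow> 'a) set \<Rightarrow> (complex^3^3) set"
  assumes "punctured_surface g k M P"
    and "k \<ge> 1"
    and "2 - 2 * int g - int k < 0"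
    and "ideal_triangulation M P T"
    and "bipartite_triangulation T"
    and "x0 \<in> M - P"
    and "T_bent (M - P) P T x0 \<rho>"
    and "discrete_faithful_PO21 (M - P) x0 \<rho>\<^sub>0"
    and "\<forall>\<gamma>\<in>carrier (pi1 (M - P) x0). bergman_length (\<rho> \<gamma>) \<le> bergman_length (\<rho>\<^sub>0 \<gamma>)"
    and "\<forall>\<gamma>\<in>carrier (pi1 (M - P) x0). peripheral M P \<gamma> \<longrightarrow>
           bergman_length (\<rho> \<gamma>) = bergman_length (\<rho>\<^sub>0 \<gamma>)"
  shows "\<forall>\<gamma>\<in>carrier (pi1 (M - P) x0). abs_trace (\<rho> \<gamma>) \<le> abs_trace (\<rho>\<^sub>0 \<gamma>)"
proof
  interpret bipartite_triangulated_surface M P T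
    using assms(4,5) by unfold_locales
  fix \<gamma> assume \<gamma>: "\<gamma> \<in> carrier (pi1 (M - P) x0)"
  have \<rho>: "\<rho> \<in> hom (pi1 (M - P) x0) PU21"
    using assms(7) by (simp add: T_bent_def)
  show "abs_trace (\<rho> \<gamma>) \<le> abs_trace (\<rho>\<^sub>0 \<gamma>)"
  proof (rule abs_trace_le_of_bergman_length_le[OF group_pi1[OF assms(6)] \<rho>])
    show "bergman_length (\<rho> \<gamma>) \<le> bergman_length (\<rho>\<^sub>0 \<gamma>)" using assms(9) \<gamma> by blast
  qed (use assms(8) \<gamma> torsion_free_pi1[OF assms(6)] in \<open>auto simp: discrete_faithful_PO21_def\<close>)
qed

end
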